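(* Let $U$ and $V$ be any $m\times m$ matrix weights on $\mathbb{R}^d$ (not necessarily satisfying any Muckenhoupt condition), and let $B$ be any locally integrable $m\times m$ matrix-valued function. Then $$\max\left\{\|B\|_{\widetilde{\mathrm{BMO}}^{p,q}_{V,U}},\ \|B^*\|_{\widetilde{\mathrm{BMO}}^{q',p'}_{U',V'}}\right\}\le C\,\|[M_B,I_\alpha]\|_{L^p(U^{p/q})\to L^q(V)},$$ where $U'=U^{-p'/q}$, $V'=V^{-p'/q}$, and $C$ is independent of $U$, $V$ and $B$ (it may depend on $m,d,p,q,\alpha$).
   Context: Throughout $0<\alpha<d$, $p,q>1$ and $\frac{\alpha}{d}+\frac1q=\frac1p$; $p',q'$ are the conjugate exponents of $p,q$. $\fint_Q$ denotes the unweighted average over a cube $Q\subseteq\mathbb{R}^d$; $\|\cdot\|$ applied to a matrix is the operator norm; $B^*$ is the pointwise conjugate transpose. An $m\times m$ matrix weight is a function on $\mathbb{R}^d$ with values in the $m\times m$ complex matrices that is positive definite a.e. For $r>1$, $L^r(W)$ is the space of $\mathbb{C}^m$-valued $\vec f$ with $\|\vec f\|_{L^r(W)}=\left(\int_{\mathbb{R}^d}|W^{1/r}(x)\vec f(x)|^r\,dx\right)^{1/r}<\infty$. The fractional integral operator is $I_\alpha f(x)=\int_{\mathbb{R}^d}\frac{f(y)}{|x-y|^{d-\alpha}}\,dy$, acting on $\mathbb{C}^m$-valued functions coordinatewise; $M_B$ is multiplication by $B$ and $[M_B,I_\alpha]=M_BI_\alpha-I_\alpha M_B$. For matrix weights $U,V$,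 $$\|B\|_{\widetilde{\mathrm{BMO}}^{p,q}_{V,U}}^q=\sup_Q\fint_Q\left(\fint_Q\left\|V^{1/q}(x)(B(x)-B(y))U^{-1/q}(y)\right\|^{p'}dy\right)^{q/p'}dx ,$$ and the second quantity is obtained from this definition by replacing $(p,q)$ by $(q',p')$ and $(V,U)$ by $(U',V')$, and $B$ by $B^*$, i.e. $$\|B^*\|_{\widetilde{\mathrm{BMO}}^{q',p'}_{U',V'}}^{p'}=\sup_Q\fint_Q\left(\fint_Q\left\|U^{-1/q}(x)(B^*(x)-B^*(y))V^{1/q}(y)\right\|^{q}dy\right)^{p'/q}dx .$$ *)

theory Defs
  imports "HOL-Analysis.Analysis"
begin

subsection \<open>Positive definite matrices and their real powers\<close>

definition conj_transpose :: "complex^'n^'m \<Rightarrow> complex^'m^'n" where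
  "conj_transpose A = (\<chi> i j. cnj (A $ j $ i))"

definition positive_definite :: "complex^'m^'m \<Rightarrow> bool" where
  "positive_definite A \<longleftrightarrow>
     conj_transpose A = A \<and>
     (\<forall>v. v \<noteq> 0 \<longrightarrow> 0 < Re (\<Sum>i\<in>UNIV. cnj (v $ i) * (A *v v) $ i))"

definition unitary :: "complex^'m^'m \<Rightarrow> bool" where
  "unitary P \<longleftrightarrow> conj_transpose P ** P = mat 1 \<and> P ** conj_transpose P = mat 1"

definition diag_matrix :: "real^'m \<Rightarrow> complex^'m^'m" where
  "diag_matrix d = (\<chi> i j. if i = j then complex_of_real (d $ i) else 0)"

text \<open>
  The power \<open>A\<^sup>s\<close> given by the functional calculus: diagonalise \<open>A = P D P\<^sup>*\<close> and raise the
  eigenvalues to the power \<open>s\<close>.  For positive definite \<open>A\<close> such a diagonalisation exists and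
  the result does not depend on it; for other \<open>A\<close> the value is irrelevant.
\<close>

definition mat_powr :: "complex^'m^'m \<Rightarrow> real \<Rightarrow> complex^'m^'m" where
  "mat_powr A s =
     (THE X. \<exists>P d. unitary P \<and> (\<forall>i. 0 < d $ i) \<and>
        A = P ** diag_matrix d ** conj_transpose P \<and>
        X = P ** diag_matrix (\<chi> i. d $ i powr s) ** conj_transpose P)"

definition mat_opnorm :: "complex^'m^'m \<Rightarrow> real" where
  "mat_opnorm A = onorm (\<lambda>v. A *v v)"


subsection \<open>Weights and weighted Lebesgue spaces\<close>

definition matrix_weight :: "(real^'d \<Rightarrow> complex^'m^'m) \<Rightarrow> bool" where
  "matrix_weight W \<longleftrightarrow>
     W \<in> borel_measurable lebesgue \<and> (AE x in lebesgue. positive_definite (W x))"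

definition locally_integrable :: "(real^'d \<Rightarrow> complex^'m^'m) \<Rightarrow> bool" where
  "locally_integrable B \<longleftrightarrow> (\<forall>K. compact K \<longrightarrow> B absolutely_integrable_on K)"

definition conj_exponent :: "real \<Rightarrow> real" where
  "conj_exponent r = r / (r - 1)"

text \<open>Positive powers on \<open>[0,\<infinity>]\<close>; only used for \<open>r > 0\<close>.\<close>

definition ennreal_powr :: "ennreal \<Rightarrow> real \<Rightarrow> ennreal" where
  "ennreal_powr a r = (if a = top then top else ennreal (enn2real a powr r))"

definition weighted_norm ::
  "real \<Rightarrow> (real^'d \<Rightarrow> complex^'m^'m) \<Rightarrow> (real^'d \<Rightarrow> complex^'m) \<Rightarrow> ennreal" where
  "weighted_norm r W f =
     ennreal_powr
       (\<integral>\<^sup>+x. ennreal (norm (mat_powr (W x) (1 / r) *v f x) powr r) \<partial>lebesgue) (1 / r)"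

definition weighted_Lp ::
  "real \<Rightarrow> (real^'d \<Rightarrow> complex^'m^'m) \<Rightarrow> (real^'d \<Rightarrow> complex^'m) set" where
  "weighted_Lp r W = {f \<in> borel_measurable lebesgue. weighted_norm r W f < top}"


subsection \<open>The fractional integral operator and its commutator\<close>

text \<open>The value of the kernel at \<open>y = x\<close> is \<open>1 / 0 = 0\<close>, which affects only a null set.\<close>

definition riesz_integrand ::
  "real \<Rightarrow> (real^'d \<Rightarrow> complex^'m) \<Rightarrow> real^'d \<Rightarrow> real^'d \<Rightarrow> complex^'m" where
  "riesz_integrand \<alpha> f x y = (1 / norm (x - y) powr (real CARD('d) - \<alpha>)) *\<^sub>R f y"

definition riesz_defined :: "real \<Rightarrow> (real^'d \<Rightarrow> complex^'m) \<Rightarrow> bool" where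
  "riesz_defined \<alpha> f \<longleftrightarrow> (AE x in lebesgue. integrable lebesgue (riesz_integrand \<alpha> f x))"

definition riesz ::
  "real \<Rightarrow> (real^'d \<Rightarrow> complex^'m) \<Rightarrow> real^'d \<Rightarrow> complex^'m" where
  "riesz \<alpha> f x = (\<integral>y. riesz_integrand \<alpha> f x y \<partial>lebesgue)"

definition mult_op ::
  "(real^'d \<Rightarrow> complex^'m^'m) \<Rightarrow> (real^'d \<Rightarrow> complex^'m) \<Rightarrow> real^'d \<Rightarrow> complex^'m" where
  "mult_op B f x = B x *v f x"

definition riesz_commutator ::
  "(real^'d \<Rightarrow> complex^'m^'m) \<Rightarrow> real \<Rightarrow> (real^'d \<Rightarrow> complex^'m) \<Rightarrow> real^'d \<Rightarrow> complex^'m" where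
  "riesz_commutator B \<alpha> f x = mult_op B (riesz \<alpha> f) x - riesz \<alpha> (mult_op B f) x"

text \<open>
  The norm of \<open>[M\<^sub>B, I\<^sub>\<alpha>]\<close> from \<open>L\<^sup>p(W)\<close> to \<open>L\<^sup>q(V)\<close>, with value \<open>\<infinity>\<close> if the commutator is unbounded.
  For general weights and \<open>B\<close> the two defining integrals need not converge for every
  \<open>f \<in> L\<^sup>p(W)\<close>, so the supremum is over the \<open>f\<close> for which both converge absolutely almost
  everywhere.  For locally integrable \<open>B\<close> this domain contains every bounded, compactly
  supported \<open>f \<in> L\<^sup>p(W)\<close>; these are dense, and by dominated convergence and Fatou's lemma the
  supremum over them is the same.
\<close>

definition commutator_norm ::
  "(real^'d \<Rightarrow> complex^'m^'m) \<Rightarrow> real \<Rightarrow> real \<Rightarrow> (real^'d \<Rightarrow> complex^'m^'m) \<Rightarrow>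
   real \<Rightarrow> (real^'d \<Rightarrow> complex^'m^'m) \<Rightarrow> ennreal" where
  "commutator_norm B \<alpha> p W q V =
     (SUP f \<in> {f \<in> weighted_Lp p W. riesz_defined \<alpha> f \<and> riesz_defined \<alpha> (mult_op B f) \<and>
                                   weighted_norm p W f \<le> 1}.
        weighted_norm q V (riesz_commutator B \<alpha> f))"


subsection \<open>The two-weight BMO quantity\<close>

definition cubes :: "(real^'d) set set" where
  "cubes = {cbox a (a + (\<chi> i. l)) | a l. 0 < l}"

definition average :: "(real^'d) set \<Rightarrow> (real^'d \<Rightarrow> ennreal) \<Rightarrow> ennreal" where
  "average Q F = (\<integral>\<^sup>+x\<in>Q. F x \<partial>lebesgue) / emeasure lebesgue Q"

definition bmo_tilde ::
  "real \<Rightarrow> real \<Rightarrow> (real^'d \<Rightarrow> complex^'m^'m) \<Rightarrow> (real^'d \<Rightarrow> complex^'m^'m) \<Rightarrow>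
   (real^'d \<Rightarrow> complex^'m^'m) \<Rightarrow> ennreal" where
  "bmo_tilde p q V U B =
     ennreal_powr
       (SUP Q \<in> cubes.
          average Q (\<lambda>x.
            ennreal_powr
              (average Q (\<lambda>y.
                 ennreal (mat_opnorm
                   (mat_powr (V x) (1 / q) ** (B x - B y) ** mat_powr (U y) (- (1 / q)))
                   powr conj_exponent p)))
              (q / conj_exponent p)))
       (1 / q)"

end

theory Submission
  imports Defs "HOL-Real_Asymp.Real_Asymp"
begin

text \<open>
  On a cube of side \<open>l\<close>, the kernel \<open>k(x,y) = V\<^bsup>1/q\<^esup>(x) (B(x) - B(y)) U\<^bsup>-1/q\<^esup>(y)\<close> is the kernel
  of the conjugated commutator times \<open>\<bar>x - y\<bar>\<^bsup>d - \<alpha>\<^esup>\<close>. This factor is a bounded multiplier of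
  bilinear forms, with norm at most a constant times \<open>l\<^bsup>d - \<alpha>\<^esup>\<close>: characters are contractive multipliers, hence so are
  Gaussians \<open>exp (- u)\<close>, \<open>u = \<kappa> \<bar>x - y\<bar>\<^sup>2\<close>, as limits of products of cosines, and for \<open>0 < \<sigma> < 1\<close> the
  power \<open>u\<^sup>\<sigma>\<close> is \<open>(1 - exp (- u))\<^sup>\<sigma>\<close>, an absolutely convergent binomial series, times an analytic
  function of \<open>u\<close>. So \<open>k\<close> defines a bounded operator from \<open>L\<^sup>p\<close> to \<open>L\<^sup>q\<close> on the cube. Since each entry of \<open>k\<close>
  has rank at most \<open>2 m\<close>, its mixed norms (in either order of integration) are bounded by
  the operator norm up to a constant depending on the rank: a finite dimensional space is normed by finitely many
  functionals. The two mixed norms are the two BMO quantities, and no condition on the weights is used.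
\<close>

subsection \<open>The spectral theorem and powers of positive definite matrices\<close>

text \<open>Boundedness from L^p to L^q does not control the mixed norms of a general kernel; it
  does so only when the rank is bounded in advance. The singular kernel of the commutator is in
  general not of finite rank, so its singular factor has to be divided out before the two norms can
  be compared. A pointwise bound on a factor says nothing about the form it multiplies, hence the
  detour through functions whose action on forms is known exactly.

  Bilinear forms are convenient for this: a product \<phi>(x) \<eta>(y) is absorbed into the test
  functions, limits follow by dominated convergence, and exchanging the variables leads from one BMO
  quantity to the other.

  Since the weights are arbitrary, natural test functions are admissible only where the powers of
  the weights and B are bounded. The estimates are proved on such sets with constants that do not
  see the bound, and the sets exhaust the cube. The side length disappears at the end because the
  exponent relation says d - \<alpha> = d/q + d/p', which is what the two averages cost.\<close>

definition hinner :: "complex^'n \<Rightarrow> complex^'n \<Rightarrow> complex" where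
  "hinner u v = (\<Sum>i\<in>UNIV. cnj (u $ i) * v $ i)"

lemma hinner_add_right: "hinner u (v + w) = hinner u v + hinner u w"
  by (simp add: hinner_def algebra_simps sum.distrib)

lemma hinner_diff_right: "hinner u (v - w) = hinner u v - hinner u w"
  by (simp add: hinner_def algebra_simps sum_subtractf)

lemma hinner_scale_right: "hinner u (c *s v) = c * hinner u v"
  by (simp add: hinner_def sum_distrib_left algebra_simps)

lemma hinner_scale_left: "hinner (c *s u) v = cnj c * hinner u v"
  by (simp add: hinner_def sum_distrib_left algebra_simps)

lemma hinner_cnj: "cnj (hinner u v) = hinner v u"
  by (simp add: hinner_def mult.commute)

lemma Re_hinner: "Re (hinner u v) = u \<bullet> v"
  by (simp add: hinner_def inner_vec_def inner_complex_def)

lemma hinner_self: "hinner u u = complex_of_real ((norm u)\<^sup>2)"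
proof -
  have "Im (hinner u u) = 0"
    by (simp add: hinner_def mult.commute)
  then show ?thesis
    by (simp add: complex_eq_iff Re_hinner power2_norm_eq_inner del: of_real_power)
qed

lemma hinner_mult_matrix: "hinner u (A *v v) = hinner (conj_transpose A *v u) v"
proof -
  have "hinner u (A *v v) = (\<Sum>i\<in>UNIV. \<Sum>j\<in>UNIV. cnj (u $ i) * A $ i $ j * v $ j)"
    by (simp add: hinner_def matrix_vector_mult_def sum_distrib_left mult.assoc)
  also have "\<dots> = (\<Sum>j\<in>UNIV. \<Sum>i\<in>UNIV. cnj (u $ i) * A $ i $ j * v $ j)"
    by (rule sum.swap)
  also have "\<dots> = hinner (conj_transpose A *v u) v"
    by (simp add: hinner_def matrix_vector_mult_def conj_transpose_def sum_distrib_left sum_distrib_right mult_ac)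
  finally show ?thesis .
qed

lemma conj_transpose_mult: "conj_transpose (A ** B) = conj_transpose B ** conj_transpose A"
  by (simp add: conj_transpose_def matrix_matrix_mult_def vec_eq_iff mult.commute)

lemma conj_transpose_conj_transpose [simp]: "conj_transpose (conj_transpose A) = A"
  by (simp add: conj_transpose_def vec_eq_iff)

lemma conj_transpose_diag [simp]: "conj_transpose (diag_matrix d) = diag_matrix d"
  by (auto simp add: conj_transpose_def diag_matrix_def vec_eq_iff)

lemma diag_matrix_mult: "diag_matrix d ** diag_matrix e = diag_matrix (\<chi> i. d $ i * e $ i)"
proof -
  have "(diag_matrix d ** diag_matrix e) $ i $ j = (diag_matrix (\<chi> i. d $ i * e $ i) :: complex^'a^'a) $ i $ j" for i j
  proof -
    have "(diag_matrix d ** diag_matrix e) $ i $ j =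
        (\<Sum>k\<in>UNIV. if k = i then (if i = j then complex_of_real (d $ i * e $ i) else 0) else 0)"
      unfolding matrix_matrix_mult_def diag_matrix_def vec_lambda_beta by (intro sum.cong) auto
    then show ?thesis by (simp add: diag_matrix_def)
  qed
  then show ?thesis by (simp add: vec_eq_iff)
qed

lemma diag_matrix_one: "diag_matrix (\<chi> i. 1) = mat 1"
  by (auto simp add: diag_matrix_def mat_def vec_eq_iff)

lemma diag_matrix_vec: "(diag_matrix d *v v) $ i = complex_of_real (d $ i) * v $ i"
  by (simp add: diag_matrix_def matrix_vector_mult_def if_distrib if_distribR cong: if_cong)

lemma positive_definite_hinner:
  "positive_definite A \<longleftrightarrow> conj_transpose A = A \<and> (\<forall>v. v \<noteq> 0 \<longrightarrow> 0 < Re (hinner v (A *v v)))"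
  by (simp add: positive_definite_def hinner_def)

text \<open>Complex orthogonality to \<open>e i\<close> is real orthogonality to both
  \<open>e i\<close> and \<open>\<i> *s e i\<close>. These are at most 2k real vectors in a space of
  real dimension 2 CARD('m), so they leave room for another direction.\<close>

lemma exists_orthogonal_vector:
  fixes e :: "nat \<Rightarrow> complex^'m"
  assumes "k < CARD('m)"
  shows "\<exists>v. v \<noteq> 0 \<and> (\<forall>i<k. hinner (e i) v = 0)"
proof -
  define S where "S = e ` {..<k} \<union> (\<lambda>i. \<i> *s e i) ` {..<k}"
  have "dim (span S) \<le> card S"
    unfolding S_def by (metis dim_le_card' dim_span finite_Un finite_imageI finite_lessThan)
  also have "card S \<le> k + k"
    unfolding S_def
    by (metis (no_types, lifting) add_mono card_Un_le card_image_le card_lessThan finite_lessThan le_trans)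
  also have "\<dots> < DIM(complex^'m)" using assms by simp
  finally have "dim S < DIM(complex^'m)" by simp
  then obtain v where v: "v \<noteq> 0" "\<And>y. y \<in> span S \<Longrightarrow> orthogonal v y"
    using orthogonal_to_subspace_exists by blast
  have "hinner (e i) v = 0" if "i < k" for i
  proof -
    have a: "v \<bullet> e i = 0" "v \<bullet> (\<i> *s e i) = 0"
      using that v(2) span_base[of _ S] by (auto simp: S_def orthogonal_def)
    have "Re (hinner (e i) v) = 0" using a(1) by (simp add: Re_hinner inner_commute)
    moreover have "Re (hinner (\<i> *s e i) v) = 0"
      using a(2) by (simp add: Re_hinner inner_commute)
    then have "Im (hinner (e i) v) = 0" by (simp add: hinner_scale_left)
    ultimately show ?thesis by (simp add: complex_eq_iff)
  qed
  with v(1) show ?thesis by blast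
qed

lemma continuous_on_hinner_matrix: "continuous_on S (\<lambda>v. Re (hinner v (A *v v)))"
  unfolding hinner_def matrix_vector_mult_def
  by (intro continuous_intros) 

lemma scaleR_eq_scalar_mult: "r *\<^sub>R (w :: complex^'n) = complex_of_real r *s w"
  unfolding vec_eq_iff vector_scaleR_component vector_smult_component
  by (simp add: scaleR_conv_of_real)

lemma hinner_scaleR_right: "hinner u (r *\<^sub>R v) = of_real r * hinner u v"
  by (simp add: scaleR_eq_scalar_mult hinner_scale_right)

lemma hinner_scaleR_left: "hinner (r *\<^sub>R u) v = of_real r * hinner u v"
  by (simp add: scaleR_eq_scalar_mult hinner_scale_left)

lemma matrix_vector_mult_scaleR: "A *v (r *\<^sub>R v) = r *\<^sub>R (A *v (v :: complex^'n))"
  by (simp add: scaleR_eq_scalar_mult vector_scalar_commute)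

text \<open>Rayleigh quotient: a maximiser of \<open>q\<close> on the unit sphere of the orthogonal
  complement \<open>S\<close> of the earlier eigenvectors is an eigenvector, because
  \<open>S\<close> is invariant under \<open>A\<close> and a nonzero residual would be a direction
  in \<open>S\<close> along which the maximum is exceeded.\<close>

lemma hermitian_eigenvector:
  fixes A :: "complex^'m^'m"
  assumes herm: "conj_transpose A = A" and k: "k < CARD('m)"
    and e: "\<And>i. i < k \<Longrightarrow> A *v e i = l i *\<^sub>R e i"
  shows "\<exists>v c. norm v = 1 \<and> (\<forall>i<k. hinner (e i) v = 0) \<and> A *v v = c *\<^sub>R v"
proof -
  define S where "S = {v::complex^'m. \<forall>i<k. hinner (e i) v = 0}"
  define q where "q v = Re (hinner v (A *v v))" for v
  have herm': "hinner u (A *v v) = hinner (A *v u) v" for u v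
    using hinner_mult_matrix[of u A v] herm by simp
  have clS: "closed S"
    unfolding S_def hinner_def Collect_ball_eq[symmetric]
    by (intro closed_Collect_all closed_Collect_imp open_Collect_const closed_Collect_eq continuous_intros)
  have "compact (S \<inter> sphere 0 1)" using clS by (simp add: closed_Int_compact)
  moreover have "S \<inter> sphere 0 1 \<noteq> {}"
  proof -
    obtain v where v: "v \<noteq> 0" "\<forall>i<k. hinner (e i) v = 0" using exists_orthogonal_vector[OF k] by blast
    have "(1 / norm v) *\<^sub>R v \<in> S \<inter> sphere 0 1"
      using v by (auto simp: S_def hinner_scaleR_right)
    then show ?thesis by blast
  qed
  ultimately obtain v where v: "v \<in> S" "norm v = 1" and vmax: "\<And>w. w \<in> S \<Longrightarrow> norm w = 1 \<Longrightarrow> q w \<le> q v"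
    using continuous_attains_sup[of "S \<inter> sphere 0 1" q, OF _ _ continuous_on_hinner_matrix[of _ A, folded q_def]]
    by (force simp: sphere_def dist_norm)
  have qs: "q (r *\<^sub>R w) = r\<^sup>2 * q w" for r w
    by (simp add: q_def matrix_vector_mult_scaleR hinner_scaleR_left hinner_scaleR_right power2_eq_square)
  define c where "c = q v"
  have qle: "q w \<le> c * (norm w)\<^sup>2" if "w \<in> S" for w
  proof (cases "w = 0")
    case True then show ?thesis by (simp add: q_def hinner_def)
  next
    case False
    have "(1 / norm w) *\<^sub>R w \<in> S" using that by (auto simp: S_def hinner_scaleR_right)
    from vmax[OF this] False have "(1 / norm w)\<^sup>2 * q w \<le> c" by (simp only: qs c_def) simp
    then show ?thesis using False by (simp add: field_simps power2_eq_square)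
  qed
  \<comment> \<open>The residual of the eigenvalue equation. It stays in \<open>S\<close> because
    the \<open>e i\<close> are eigenvectors, so \<open>v + t *\<^sub>R r\<close> is an admissible
    competitor for every t.\<close>
  define r where "r = c *\<^sub>R v - A *v v"
  have rS: "r \<in> S"
  proof -
    have "hinner (e i) r = 0" if "i < k" for i
      using v(1) that by (simp add: r_def hinner_diff_right hinner_scaleR_right herm' e hinner_scaleR_left S_def)
    then show ?thesis by (simp add: S_def)
  qed
  have vr: "Re (hinner v r) = 0"
    by (simp add: r_def hinner_diff_right hinner_scaleR_right hinner_self v(2) c_def q_def)
  define g where "g t = c * (norm (v + t *\<^sub>R r))\<^sup>2 - q (v + t *\<^sub>R r)" for t
  have gpos: "0 \<le> g t" for t
  proof -
    have "v + t *\<^sub>R r \<in> S" using v(1) rS by (simp add: S_def hinner_add_right hinner_scaleR_right)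
    then show ?thesis using qle by (simp add: g_def)
  qed
  define b where "b = c * (norm r)\<^sup>2 - q r"
  have geq: "g t = 2 * t * (norm r)\<^sup>2 + t\<^sup>2 * b" for t
  proof -
    have 1: "q (v + t *\<^sub>R r) = q v + 2 * t * Re (hinner r (A *v v)) + t\<^sup>2 * q r"
    proof -
      have "q (v + t *\<^sub>R r) = (v + t *\<^sub>R r) \<bullet> (A *v v + t *\<^sub>R (A *v r))"
        by (simp add: q_def Re_hinner matrix_vector_right_distrib matrix_vector_mult_scaleR)
      also have "\<dots> = v \<bullet> (A *v v) + t * (v \<bullet> (A *v r)) + t * (r \<bullet> (A *v v)) + t\<^sup>2 * (r \<bullet> (A *v r))"
        by (simp add: inner_add_left inner_add_right power2_eq_square algebra_simps)
      also have "v \<bullet> (A *v r) = r \<bullet> (A *v v)"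
        by (metis Re_hinner herm' inner_commute)
      finally show ?thesis by (simp add: q_def Re_hinner)
    qed
    have 2: "(norm (v + t *\<^sub>R r))\<^sup>2 = (norm v)\<^sup>2 + 2 * t * (r \<bullet> v) + t\<^sup>2 * (norm r)\<^sup>2"
      by (simp only: power2_norm_eq_inner)
         (simp add: inner_add_left inner_add_right power2_eq_square algebra_simps inner_commute)
    have 3: "c * (r \<bullet> v) - Re (hinner r (A *v v)) = (norm r)\<^sup>2"
    proof -
      have "Re (hinner r r) = c * (r \<bullet> v) - Re (hinner r (A *v v))"
        by (subst (2) r_def) (simp add: hinner_diff_right hinner_scaleR_right Re_hinner)
      then show ?thesis by (simp add: hinner_self)
    qed
    have "g t = 2 * t * (c * (r \<bullet> v) - Re (hinner r (A *v v))) + t\<^sup>2 * b"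
      unfolding g_def 1 2 b_def c_def[symmetric] v(2) by (simp add: algebra_simps)
    then show ?thesis by (simp only: 3)
  qed
  have "norm r = 0"
  proof (rule ccontr)
    assume "norm r \<noteq> 0"
    define n where "n = (norm r)\<^sup>2"
    have n: "n > 0" using \<open>norm r \<noteq> 0\<close> by (simp add: n_def)
    \<comment> \<open>Negative, and so small that the linear term outweighs the quadratic one: |t b|
      \<le> n gives 2n + t b > 0, hence g t < 0.\<close>
    define t where "t = - n / (\<bar>b\<bar> + 1)"
    have "t < 0" using n by (simp add: t_def divide_neg_pos)
    have "t * (2 * n + t * b) = g t" by (simp add: geq n_def power2_eq_square algebra_simps)
    then have "0 \<le> t * (2 * n + t * b)" using gpos by simp
    then have "2 * n + t * b \<le> 0"
      using \<open>t < 0\<close> by (simp add: zero_le_mult_iff)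
    moreover have "\<bar>t * b\<bar> \<le> n"
      using n by (simp add: t_def abs_mult divide_simps)
    ultimately show False using n by linarith
  qed
  then have "A *v v = c *\<^sub>R v" by (simp add: r_def)
  with v show ?thesis unfolding S_def by blast
qed


lemma hermitian_orthonormal_eigenvectors:
  fixes A :: "complex^'m^'m"
  assumes herm: "conj_transpose A = A" and "k \<le> CARD('m)"
  shows "\<exists>e l. (\<forall>i<k. \<forall>j<k. hinner (e i) (e j) = (if i = j then 1 else 0)) \<and>
                (\<forall>i<k. A *v e i = l i *\<^sub>R e i)"
  using assms(2)
proof (induction k)
  case 0
  then show ?case by simp
next
  case (Suc k)
  then obtain e l where e: "\<forall>i<k. \<forall>j<k. hinner (e i) (e j) = (if i = j then 1 else 0)"
    and l: "\<forall>i<k. A *v e i = l i *\<^sub>R e i" by auto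
  obtain v c where v: "norm v = 1" "\<forall>i<k. hinner (e i) v = 0" "A *v v = c *\<^sub>R v"
    using hermitian_eigenvector[OF herm, of k e l] Suc.prems l by auto
  have v': "hinner v (e i) = 0" if "i < k" for i
    using v(2) that hinner_cnj[of "e i" v] by simp
  have vv: "hinner v v = 1" by (simp add: hinner_self v(1))
  show ?case
  proof (intro exI conjI allI impI)
    fix i j assume "i < Suc k" "j < Suc k"
    then show "hinner ((e(k := v)) i) ((e(k := v)) j) = (if i = j then 1 else 0)"
      using e v(2) v' vv by (auto simp: less_Suc_eq)
  next
    fix i assume "i < Suc k"
    then show "A *v (e(k := v)) i = (l(k := c)) i *\<^sub>R (e(k := v)) i"
      using l v(3) by (auto simp: less_Suc_eq)
  qed
qed

lemma conj_transpose_mult_nth: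
  "(conj_transpose A ** B) $ i $ j = hinner (\<chi> a. A $ a $ i) (\<chi> a. B $ a $ j)"
  by (simp add: matrix_matrix_mult_def conj_transpose_def hinner_def)

lemma unitary_iff: "unitary P \<longleftrightarrow> conj_transpose P ** P = mat 1"
  unfolding unitary_def using matrix_left_right_inverse[of P "conj_transpose P"] by blast

theorem hermitian_diagonalization:
  fixes A :: "complex^'m^'m"
  assumes herm: "conj_transpose A = A"
  shows "\<exists>P d. unitary P \<and> A = P ** diag_matrix d ** conj_transpose P"
proof -
  obtain e l where e: "\<And>i j. i < CARD('m) \<Longrightarrow> j < CARD('m) \<Longrightarrow> hinner (e i) (e j) = (if i = j then 1 else 0)"
    and l: "\<And>i. i < CARD('m) \<Longrightarrow> A *v e i = l i *\<^sub>R e i"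
    using hermitian_orthonormal_eigenvectors[OF herm, of "CARD('m)"] by auto
  obtain h :: "'m \<Rightarrow> nat" where h: "bij_betw h UNIV {0..<CARD('m)}"
    using ex_bij_betw_finite_nat[of "UNIV :: 'm set"] by auto
  have hless: "h i < CARD('m)" for i using bij_betwE[OF h] by auto
  have hinj: "h i = h j \<longleftrightarrow> i = j" for i j using h by (auto simp: bij_betw_def inj_on_def)
  define P :: "complex^'m^'m" where "P = (\<chi> i j. e (h j) $ i)"
  define d :: "real^'m" where "d = (\<chi> j. l (h j))"
  have "conj_transpose P ** P = mat 1"
    by (simp add: vec_eq_iff conj_transpose_mult_nth P_def mat_def e hless hinj)
  then have P: "unitary P" by (simp add: unitary_iff)
  have AP: "A ** P = P ** diag_matrix d"
  proof -
    have "(A ** P) $ i $ j = (P ** diag_matrix d) $ i $ j" for i j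
    proof -
      have "(A ** P) $ i $ j = (A *v e (h j)) $ i"
        by (simp add: matrix_matrix_mult_def matrix_vector_mult_def P_def)
      also have "\<dots> = complex_of_real (l (h j)) * e (h j) $ i"
        unfolding l[OF hless] vector_scaleR_component by (rule scaleR_conv_of_real)
      also have "\<dots> = (P ** diag_matrix d) $ i $ j"
        by (simp add: matrix_matrix_mult_def P_def diag_matrix_def d_def if_distrib cong: if_cong)
      finally show ?thesis .
    qed
    then show ?thesis by (simp add: vec_eq_iff)
  qed
  have "A = A ** (P ** conj_transpose P)" using P by (simp add: unitary_def)
  also have "\<dots> = P ** diag_matrix d ** conj_transpose P"
    by (simp add: matrix_mul_assoc AP)
  finally show ?thesis using P by blast
qed

section \<open>Functional calculus in a diagonalising basis\<close>

lemma hinner_diag: "hinner v (diag_matrix d *v v) = complex_of_real (\<Sum>i\<in>UNIV. d $ i * (cmod (v $ i))\<^sup>2)"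
proof -
  have "cnj (v $ i) * (complex_of_real (d $ i) * v $ i) = complex_of_real (d $ i * (cmod (v $ i))\<^sup>2)" for i
    using complex_norm_square[of "v $ i"] by (simp add: mult_ac)
  then show ?thesis unfolding hinner_def diag_matrix_vec of_real_sum by (intro sum.cong refl)
qed

lemma positive_definite_diag_conj:
  assumes P: "unitary P"
  shows "positive_definite (P ** diag_matrix d ** conj_transpose P) \<longleftrightarrow> (\<forall>i. 0 < d $ i)"
proof -
  let ?A = "P ** diag_matrix d ** conj_transpose P"
  have inv: "conj_transpose P *v (P *v v) = v" "P *v (conj_transpose P *v v) = v" for v
    using P by (simp_all add: unitary_def matrix_vector_mul_assoc)
  have herm: "conj_transpose ?A = ?A"
    by (simp add: conj_transpose_mult matrix_mul_assoc)
  have form: "Re (hinner v (?A *v v)) = (\<Sum>i\<in>UNIV. d $ i * (cmod ((conj_transpose P *v v) $ i))\<^sup>2)" for v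
  proof -
    have "hinner v (?A *v v) = hinner (conj_transpose P *v v) (diag_matrix d *v (conj_transpose P *v v))"
      by (metis conj_transpose_conj_transpose hinner_mult_matrix matrix_vector_mul_assoc matrix_mul_assoc)
    then show ?thesis by (simp add: hinner_diag del: of_real_sum)
  qed
  show ?thesis
  proof
    assume pd: "positive_definite ?A"
    show "\<forall>i. 0 < d $ i"
    proof
      fix i
      have ne: "P *v axis i 1 \<noteq> 0" using inv(1)[of "axis i 1"] by (metis axis_eq_0_iff matrix_vector_mult_0_right zero_neq_one)
      then have "0 < Re (hinner (P *v axis i 1) (?A *v (P *v axis i 1)))"
        using pd by (simp add: positive_definite_hinner)
      also have "\<dots> = (\<Sum>j\<in>UNIV. d $ j * (cmod (axis i 1 $ j))\<^sup>2)"
        by (simp add: form inv)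
      also have "\<dots> = (\<Sum>j\<in>UNIV. if j = i then d $ i else 0)"
        by (intro sum.cong) (auto simp: axis_def)
      finally show "0 < d $ i" by simp
    qed
  next
    assume d: "\<forall>i. 0 < d $ i"
    have "0 < Re (hinner v (?A *v v))" if "v \<noteq> 0" for v
    proof -
      have "conj_transpose P *v v \<noteq> 0" using inv(2)[of v] that by (metis matrix_vector_mult_0_right)
      then obtain i where "(conj_transpose P *v v) $ i \<noteq> 0" by (auto simp: vec_eq_iff)
      then show ?thesis unfolding form
        using d by (intro sum_pos2[of _ i]) (auto simp: less_imp_le)
    qed
    then show "positive_definite ?A" using herm by (simp add: positive_definite_hinner)
  qed
qed

text \<open>This makes the \<open>THE\<close> in \<open>mat_powr\<close> meaningful. The change of
  basis \<open>W\<close> intertwines the two diagonal matrices, so its entry (i, j) vanishes unless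
  \<open>d $ j = e $ i\<close>; therefore it also intertwines their images under any
  \<open>f\<close>.\<close>

lemma diag_conj_eq_imp_map_eq:
  assumes P: "unitary P" and R: "unitary R"
    and eq: "P ** diag_matrix d ** conj_transpose P = R ** diag_matrix e ** conj_transpose R"
  shows "P ** diag_matrix (\<chi> i. f (d $ i)) ** conj_transpose P = R ** diag_matrix (\<chi> i. f (e $ i)) ** conj_transpose R"
proof -
  define W where "W = conj_transpose R ** P"
  have RR: "conj_transpose R ** R = mat 1" "R ** conj_transpose R = mat 1"
    and PP: "conj_transpose P ** P = mat 1" "P ** conj_transpose P = mat 1"
    using P R by (auto simp: unitary_def)
  have comm: "W ** diag_matrix d = diag_matrix e ** W"
  proof -
    have "W ** diag_matrix d = conj_transpose R ** (P ** diag_matrix d ** conj_transpose P) ** P"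
      using PP unfolding W_def by (simp add: matrix_mul_assoc[symmetric])
    also have "\<dots> = diag_matrix e ** W"
      unfolding eq W_def using RR by (simp add: matrix_mul_assoc)
    finally show ?thesis .
  qed
  have "W $ i $ j * complex_of_real (d $ j) = complex_of_real (e $ i) * W $ i $ j" for i j
    using comm by (simp add: vec_eq_iff matrix_matrix_mult_def diag_matrix_def if_distrib if_distribR cong: if_cong)
  then have "W $ i $ j = 0 \<or> d $ j = e $ i" for i j
    by (metis mult.commute mult_cancel_left of_real_eq_iff)
  then have "W $ i $ j * complex_of_real (f (d $ j)) = complex_of_real (f (e $ i)) * W $ i $ j" for i j
    by (metis mult.commute mult_zero_left)
  then have fcomm: "W ** diag_matrix (\<chi> i. f (d $ i)) = diag_matrix (\<chi> i. f (e $ i)) ** W"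
    by (simp add: vec_eq_iff matrix_matrix_mult_def diag_matrix_def if_distrib if_distribR cong: if_cong)
  have RW: "R ** W = P" using RR by (simp add: W_def matrix_mul_assoc)
  have WP: "W ** conj_transpose P = conj_transpose R"
    using PP by (simp add: W_def matrix_mul_assoc[symmetric])
  have "P ** diag_matrix (\<chi> i. f (d $ i)) ** conj_transpose P = R ** (W ** diag_matrix (\<chi> i. f (d $ i))) ** conj_transpose P"
    by (simp add: matrix_mul_assoc RW)
  also have "\<dots> = R ** diag_matrix (\<chi> i. f (e $ i)) ** (W ** conj_transpose P)"
    unfolding fcomm by (simp add: matrix_mul_assoc)
  finally show ?thesis by (simp add: WP)
qed

lemma positive_definite_diagonalization:
  assumes "positive_definite A"
  obtains P d where "unitary P" "\<And>i. 0 < d $ i" "A = P ** diag_matrix d ** conj_transpose P"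
  using hermitian_diagonalization[of A] assms positive_definite_diag_conj
  by (metis positive_definite_def)

lemma mat_powr_diag_conj:
  assumes P: "unitary P" and d: "\<And>i. 0 < d $ i"
  shows "mat_powr (P ** diag_matrix d ** conj_transpose P) s =
    P ** diag_matrix (\<chi> i. d $ i powr s) ** conj_transpose P"
  unfolding mat_powr_def
proof (rule the_equality)
  show "\<exists>Pa da. unitary Pa \<and> (\<forall>i. 0 < da $ i) \<and>
     P ** diag_matrix d ** conj_transpose P = Pa ** diag_matrix da ** conj_transpose Pa \<and>
     P ** diag_matrix (\<chi> i. d $ i powr s) ** conj_transpose P =
     Pa ** diag_matrix (\<chi> i. da $ i powr s) ** conj_transpose Pa"
    using P d by blast
next
  fix X
  assume "\<exists>Pa da. unitary Pa \<and> (\<forall>i. 0 < da $ i) \<and>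
     P ** diag_matrix d ** conj_transpose P = Pa ** diag_matrix da ** conj_transpose Pa \<and>
     X = Pa ** diag_matrix (\<chi> i. da $ i powr s) ** conj_transpose Pa"
  then show "X = P ** diag_matrix (\<chi> i. d $ i powr s) ** conj_transpose P"
    using diag_conj_eq_imp_map_eq[OF P, of _ d _ "\<lambda>t. t powr s"] by fastforce
qed

lemma positive_definite_mat_powr:
  assumes "positive_definite A"
  shows "positive_definite (mat_powr A s)"
proof -
  obtain P d where "unitary P" "\<And>i. 0 < d $ i" "A = P ** diag_matrix d ** conj_transpose P"
    using positive_definite_diagonalization[OF assms] by blast
  then show ?thesis by (simp add: mat_powr_diag_conj positive_definite_diag_conj order.strict_implies_not_eq[symmetric])
qed

lemma conj_transpose_mat_powr:
  assumes "positive_definite A"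
  shows "conj_transpose (mat_powr A s) = mat_powr A s"
  using positive_definite_mat_powr[OF assms] by (simp add: positive_definite_def)

lemma mat_powr_powr:
  assumes "positive_definite A"
  shows "mat_powr (mat_powr A s) t = mat_powr A (s * t)"
proof -
  obtain P d where "unitary P" "\<And>i. 0 < d $ i" "A = P ** diag_matrix d ** conj_transpose P"
    using positive_definite_diagonalization[OF assms] by blast
  moreover from this have "0 < d $ i powr s" for i
    by (simp add: order.strict_implies_not_eq[symmetric])
  ultimately show ?thesis by (simp add: mat_powr_diag_conj powr_powr)
qed

lemma mat_powr_mult_minus:
  assumes "positive_definite A"
  shows "mat_powr A s ** mat_powr A (- s) = mat 1"
proof -
  obtain P d where P: "unitary P" and d: "\<And>i. 0 < d $ i" "A = P ** diag_matrix d ** conj_transpose P"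
    using positive_definite_diagonalization[OF assms] by blast
  have 1: "d $ i powr s * d $ i powr - s = 1" for i using d(1)[of i] by (simp add: powr_minus)
  have "P ** diag_matrix (\<chi> i. d $ i powr s) ** conj_transpose P ** (P ** diag_matrix (\<chi> i. d $ i powr - s) ** conj_transpose P)
    = P ** diag_matrix (\<chi> i. d $ i powr s) ** (conj_transpose P ** P) ** diag_matrix (\<chi> i. d $ i powr - s) ** conj_transpose P"
    by (simp only: matrix_mul_assoc)
  also have "\<dots> = P ** (diag_matrix (\<chi> i. d $ i powr s) ** diag_matrix (\<chi> i. d $ i powr - s)) ** conj_transpose P"
    using P by (simp add: unitary_def matrix_mul_assoc)
  also have "\<dots> = mat 1"
    using P unfolding diag_matrix_mult by (simp only: vec_lambda_beta 1 diag_matrix_one matrix_mul_rid unitary_def)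
  finally show ?thesis unfolding d(2) mat_powr_diag_conj[OF P d(1)] .
qed

subsection \<open>Measurability of matrix powers\<close>

lemma diag_conj_nth:
  "(P ** diag_matrix d ** conj_transpose P) $ i $ j =
    (\<Sum>k\<in>UNIV. P $ i $ k * complex_of_real (d $ k) * cnj (P $ j $ k))"
proof -
  have 1: "(P ** diag_matrix d) $ i $ k = P $ i $ k * complex_of_real (d $ k)" for i k
  proof -
    have "(P ** diag_matrix d) $ i $ k = (\<Sum>l\<in>UNIV. if l = k then P $ i $ k * complex_of_real (d $ k) else 0)"
      unfolding matrix_matrix_mult_def diag_matrix_def vec_lambda_beta by (intro sum.cong) auto
    then show ?thesis by simp
  qed
  show ?thesis
    by (simp add: matrix_matrix_mult_def[of "P ** diag_matrix d"] conj_transpose_def 1)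
qed

primrec mat_pow :: "complex^'n^'n \<Rightarrow> nat \<Rightarrow> complex^'n^'n" where
  "mat_pow A 0 = mat 1"
| "mat_pow A (Suc k) = mat_pow A k ** A"

lemma mat_pow_diag_conj:
  assumes P: "unitary P"
  shows "mat_pow (P ** diag_matrix d ** conj_transpose P) k =
    P ** diag_matrix (\<chi> i. d $ i ^ k) ** conj_transpose P"
proof (induction k)
  case 0
  then show ?case using P by (simp add: diag_matrix_one unitary_def)
next
  case (Suc k)
  have "P ** diag_matrix (\<chi> i. d $ i ^ k) ** conj_transpose P ** (P ** diag_matrix d ** conj_transpose P) =
    P ** diag_matrix (\<chi> i. d $ i ^ k) ** (conj_transpose P ** P) ** diag_matrix d ** conj_transpose P"
    by (simp only: matrix_mul_assoc)
  also have "\<dots> = P ** (diag_matrix (\<chi> i. d $ i ^ k) ** diag_matrix d) ** conj_transpose P"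
    using P by (simp add: unitary_def matrix_mul_assoc)
  also have "\<dots> = P ** diag_matrix (\<chi> i. d $ i ^ Suc k) ** conj_transpose P"
    by (simp add: diag_matrix_mult mult.commute)
  finally show ?case by (simp add: Suc)
qed

lemma continuous_on_mat_pow: "continuous_on S (\<lambda>A. mat_pow A k)"
proof (induction k)
  case 0
  then show ?case by simp
next
  case (Suc k)
  then show ?case unfolding mat_pow.simps matrix_matrix_mult_def
    by (intro continuous_intros)
qed

definition mat_poly :: "(nat \<Rightarrow> real) \<Rightarrow> nat \<Rightarrow> complex^'n^'n \<Rightarrow> complex^'n^'n" where
  "mat_poly a n A = (\<Sum>i\<le>n. a i *\<^sub>R mat_pow A i)"

lemma continuous_on_mat_poly: "continuous_on S (mat_poly a n)"
  unfolding mat_poly_def[abs_def] by (intro continuous_intros continuous_on_mat_pow)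

lemma mat_poly_diag_conj:
  assumes P: "unitary P"
  shows "mat_poly a n (P ** diag_matrix d ** conj_transpose P) =
    P ** diag_matrix (\<chi> k. \<Sum>i\<le>n. a i * d $ k ^ i) ** conj_transpose P"
proof -
  have "mat_poly a n (P ** diag_matrix d ** conj_transpose P) $ i $ j =
      (\<Sum>l\<le>n. \<Sum>k\<in>UNIV. P $ i $ k * complex_of_real (a l * d $ k ^ l) * cnj (P $ j $ k))" for i j
    unfolding mat_poly_def mat_pow_diag_conj[OF P] sum_component vector_scaleR_component diag_conj_nth
    by (simp add: scaleR_conv_of_real sum_distrib_left mult_ac)
  moreover have "(\<Sum>l\<le>n. \<Sum>k\<in>UNIV. P $ i $ k * complex_of_real (a l * d $ k ^ l) * cnj (P $ j $ k)) =
      (P ** diag_matrix (\<chi> k. \<Sum>i\<le>n. a i * d $ k ^ i) ** conj_transpose P) $ i $ j" for i j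
    by (subst sum.swap) (simp add: diag_conj_nth sum_distrib_left sum_distrib_right mult.assoc)
  ultimately show ?thesis by (simp add: vec_eq_iff)
qed

text \<open>Weierstrass on the growing intervals [1/(n+1), n+1] with error 1/(n+1). They avoid 0,
  where the power may be singular, and each t > 0 lies in all but finitely many of them.\<close>

lemma powr_polynomial_approximation:
  fixes s :: real
  shows "\<exists>a N. \<forall>t>0. (\<lambda>n. \<Sum>i\<le>N n. a n i * t ^ i) \<longlonglongrightarrow> t powr s"
proof -
  have "\<exists>a N. \<forall>t\<in>{1 / Suc n..Suc n}. \<bar>t powr s - (\<Sum>i\<le>N. a i * t ^ i)\<bar> < 1 / Suc n" for n
  proof -
    have "continuous_on {1 / real (Suc n)..real (Suc n)} (\<lambda>t. t powr s)"
      by (intro continuous_intros) (auto simp: field_simps)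
    then obtain g where g: "real_polynomial_function g"
      "\<And>t. t \<in> {1 / real (Suc n)..real (Suc n)} \<Longrightarrow> \<bar>t powr s - g t\<bar> < 1 / Suc n"
      using Stone_Weierstrass_real_polynomial_function[of "{1 / real (Suc n)..real (Suc n)}" "\<lambda>t. t powr s" "1 / Suc n"]
      by auto
    then show ?thesis unfolding real_polynomial_function_iff_sum by metis
  qed
  then obtain a N where aN: "\<And>n t. t \<in> {1 / real (Suc n)..real (Suc n)} \<Longrightarrow>
      \<bar>t powr s - (\<Sum>i\<le>N n. a n i * t ^ i)\<bar> < 1 / Suc n"
    by metis
  have "(\<lambda>n. \<Sum>i\<le>N n. a n i * t ^ i) \<longlonglongrightarrow> t powr s" if "t > 0" for t :: real
  proof (rule Lim_transform2[OF tendsto_const])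
    have "\<forall>\<^sub>F n in sequentially. norm (t powr s - (\<Sum>i\<le>N n. a n i * t ^ i)) \<le> 1 / Suc n"
    proof -
      obtain n0 where n0: "max t (1 / t) < real n0" using reals_Archimedean2 by blast
      show ?thesis
      proof (rule eventually_sequentiallyI[of n0])
        fix n assume "n0 \<le> n"
        then have "max t (1 / t) \<le> real (Suc n)" using n0 by simp
        then have "t \<in> {1 / real (Suc n)..real (Suc n)}" using that by (auto simp: field_simps)
        from aN[OF this] show "norm (t powr s - (\<Sum>i\<le>N n. a n i * t ^ i)) \<le> 1 / Suc n" by simp
      qed
    qed
    then show "(\<lambda>n. t powr s - (\<Sum>i\<le>N n. a n i * t ^ i)) \<longlonglongrightarrow> 0"
      by (rule Lim_null_comparison) (rule LIMSEQ_Suc[OF lim_1_over_n])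
  qed
  then show ?thesis by blast
qed

text \<open>The polynomials are the same for all matrices, since convergence is only tested on
  eigenvalues. Thus the power is a pointwise limit of a fixed sequence of continuous functions,
  which is how its measurability is obtained.\<close>

lemma mat_powr_limit_of_polynomials:
  "\<exists>a N. \<forall>A :: complex^'n^'n. positive_definite A \<longrightarrow> (\<lambda>n. mat_poly (a n) (N n) A) \<longlonglongrightarrow> mat_powr A s"
proof -
  obtain a N where aN: "\<And>t. t > 0 \<Longrightarrow> (\<lambda>n. \<Sum>i\<le>N n. a n i * t ^ i) \<longlonglongrightarrow> t powr s"
    using powr_polynomial_approximation by blast
  have "(\<lambda>n. mat_poly (a n) (N n) A) \<longlonglongrightarrow> mat_powr A s" if pd: "positive_definite A" for A :: "complex^'n^'n"
  proof -
    obtain P d where P: "unitary P" and d: "\<And>i. 0 < d $ i" and A: "A = P ** diag_matrix d ** conj_transpose P"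
      using positive_definite_diagonalization[OF pd] by blast
    show ?thesis unfolding A mat_poly_diag_conj[OF P] mat_powr_diag_conj[OF P d]
      by (intro vec_tendstoI) (auto simp: diag_conj_nth simp del: of_real_sum intro!: tendsto_intros aN d)
  qed
  then show ?thesis by blast
qed

text \<open>The exceptional set is null, and Lebesgue measure is complete.\<close>

lemma sets_positive_definite:
  assumes "AE x in lebesgue. positive_definite (W x)"
  shows "{x. positive_definite (W x)} \<in> sets lebesgue"
proof -
  have "{x \<in> space lebesgue. \<not> positive_definite (W x)} \<in> null_sets lebesgue"
    using assms by (rule completion.AE_iff_null_sets[THEN iffD1])
  then have "space lebesgue - {x \<in> space lebesgue. \<not> positive_definite (W x)} \<in> sets lebesgue"
    by (intro sets.compl_sets) auto
  moreover have "space lebesgue - {x \<in> space lebesgue. \<not> positive_definite (W x)} = {x. positive_definite (W x)}"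
    by auto
  ultimately show ?thesis by simp
qed

text \<open>Off the positive definite matrices \<open>mat_powr\<close> is an unspecified
  \<open>THE\<close>; the default 0 restores measurability and concerns only a null set.\<close>

lemma borel_measurable_mat_powr:
  fixes W :: "'a::euclidean_space \<Rightarrow> complex^'n^'n"
  assumes W: "W \<in> borel_measurable lebesgue" and pd: "AE x in lebesgue. positive_definite (W x)"
  shows "(\<lambda>x. if positive_definite (W x) then mat_powr (W x) s else 0) \<in> borel_measurable lebesgue"
proof -
  obtain a N where aN: "\<And>A :: complex^'n^'n. positive_definite A \<Longrightarrow> (\<lambda>n. mat_poly (a n) (N n) A) \<longlonglongrightarrow> mat_powr A s"
    using mat_powr_limit_of_polynomials by blast
  have S: "{x \<in> space lebesgue. positive_definite (W x)} \<in> sets lebesgue"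
    using sets_positive_definite[OF pd] by simp
  have m: "(\<lambda>x. if positive_definite (W x) then mat_poly (a n) (N n) (W x) else 0) \<in> borel_measurable lebesgue" for n
  proof (rule measurable_If[OF _ _ S])
    show "(\<lambda>x. mat_poly (a n) (N n) (W x)) \<in> borel_measurable lebesgue"
      using borel_measurable_continuous_onI[OF continuous_on_mat_poly] W by (rule measurable_compose_rev)
  qed simp
  show ?thesis
    using aN by (intro borel_measurable_LIMSEQ_metric[OF m]) auto
qed

subsection \<open>Multipliers of bilinear forms\<close>

text \<open>The unit ball of L^r, cut down to bounded functions so that every pairing with an
  integrable kernel converges. The size of the bound never enters an estimate.\<close>

definition lball :: "'a measure \<Rightarrow> real \<Rightarrow> ('a \<Rightarrow> complex) set" where
  "lball M r = {f \<in> borel_measurable M. (\<exists>K. \<forall>x\<in>space M. cmod (f x) \<le> K) \<and>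
     (\<integral>x. cmod (f x) powr r \<partial>M) \<le> 1}"

text \<open>By duality, the norm of the operator with kernel \<open>K\<close> from L^r to L^s',
  where s' is conjugate to \<open>s\<close>. Integrability of \<open>K\<close> is qualitative; only
  \<open>A\<close> is quantitative.\<close>

definition form_bound :: "'a measure \<Rightarrow> real \<Rightarrow> real \<Rightarrow> real \<Rightarrow> ('a \<times> 'a \<Rightarrow> complex) \<Rightarrow> bool" where
  "form_bound M r s A K \<longleftrightarrow> integrable (M \<Otimes>\<^sub>M M) K \<and>
     (\<forall>\<psi>\<in>lball M s. \<forall>f\<in>lball M r. cmod (\<integral>z. K z * (\<psi> (fst z) * f (snd z)) \<partial>(M \<Otimes>\<^sub>M M)) \<le> A)"

text \<open>A Schur multiplier of norm at most \<open>c\<close>. The pointwise bound is recorded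
  alongside because it keeps the product kernel integrable and supplies the majorant for
  limits.\<close>

definition multiplier :: "'a measure \<Rightarrow> real \<Rightarrow> real \<Rightarrow> real \<Rightarrow> ('a \<times> 'a \<Rightarrow> complex) \<Rightarrow> bool" where
  "multiplier M r s c m \<longleftrightarrow> 0 \<le> c \<and> m \<in> borel_measurable (M \<Otimes>\<^sub>M M) \<and>
     (\<forall>z\<in>space (M \<Otimes>\<^sub>M M). cmod (m z) \<le> c) \<and>
     (\<forall>K A. form_bound M r s A K \<longrightarrow> form_bound M r s (c * A) (\<lambda>z. m z * K z))"

lemma integrable_bounded_mult:
  fixes m K :: "'a \<Rightarrow> complex"
  assumes "integrable N K" "m \<in> borel_measurable N" "\<And>z. z \<in> space N \<Longrightarrow> cmod (m z) \<le> c"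
  shows "integrable N (\<lambda>z. m z * K z)"
proof (rule Bochner_Integration.integrable_bound[where f = "\<lambda>z. c * norm (K z)"])
  show "integrable N (\<lambda>z. c * norm (K z))" using assms(1) by simp
  show "(\<lambda>z. m z * K z) \<in> borel_measurable N" using assms(1,2) by simp
  show "AE z in N. norm (m z * K z) \<le> norm (c * norm (K z))"
  proof (rule AE_I2)
    fix z assume "z \<in> space N"
    then have "0 \<le> c" "cmod (m z) \<le> c" using assms(3)[of z] norm_ge_zero[of "m z"] order_trans by blast+
    then show "norm (m z * K z) \<le> norm (c * norm (K z))" by (simp add: norm_mult mult_right_mono)
  qed
qed

lemma lball_bound_pos:
  assumes "f \<in> lball M r"
  obtains K where "0 \<le> K" "\<And>x. x \<in> space M \<Longrightarrow> cmod (f x) \<le> K"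
proof -
  obtain K where "\<forall>x\<in>space M. cmod (f x) \<le> K" using assms by (auto simp: lball_def)
  then show ?thesis by (intro that[of "max 0 K"]) auto
qed

lemma test_pair_measurable:
  assumes "\<psi> \<in> borel_measurable M" "f \<in> borel_measurable M"
  shows "(\<lambda>z. \<psi> (fst z) * f (snd z) :: complex) \<in> borel_measurable (M \<Otimes>\<^sub>M M)"
  using assms by (intro borel_measurable_times measurable_compose[OF measurable_fst] measurable_compose[OF measurable_snd])

lemma test_pair_bounded:
  assumes "\<psi> \<in> lball M s" "f \<in> lball M r"
  obtains C where "\<And>z. z \<in> space (M \<Otimes>\<^sub>M M) \<Longrightarrow> cmod (\<psi> (fst z) * f (snd z)) \<le> C"
proof -
  obtain a b where a: "0 \<le> a" "\<And>x. x \<in> space M \<Longrightarrow> cmod (\<psi> x) \<le> a"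
    and b: "0 \<le> b" "\<And>x. x \<in> space M \<Longrightarrow> cmod (f x) \<le> b"
    using lball_bound_pos[OF assms(1)] lball_bound_pos[OF assms(2)] by metis
  show ?thesis
    by (rule that[of "a * b"]) (auto simp: space_pair_measure norm_mult intro!: mult_mono a b)
qed

lemma integrable_form:
  assumes K: "integrable (M \<Otimes>\<^sub>M M) K" and "\<psi> \<in> lball M s" "f \<in> lball M r"
  shows "integrable (M \<Otimes>\<^sub>M M) (\<lambda>z. K z * (\<psi> (fst z) * f (snd z)))"
proof -
  obtain C where C: "\<And>z. z \<in> space (M \<Otimes>\<^sub>M M) \<Longrightarrow> cmod (\<psi> (fst z) * f (snd z)) \<le> C"
    using test_pair_bounded assms(2,3) by blast
  have "(\<lambda>z. \<psi> (fst z) * f (snd z)) \<in> borel_measurable (M \<Otimes>\<^sub>M M)"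
    using assms(2,3) by (intro test_pair_measurable) (auto simp: lball_def)
  from integrable_bounded_mult[OF K this C] show ?thesis by (simp add: mult_ac)
qed

section \<open>Algebra and limits of multipliers\<close>

lemma lball_zero: "(\<lambda>x. 0) \<in> lball M r"
  by (auto simp: lball_def)

lemma form_bound_nonneg: "form_bound M r s A K \<Longrightarrow> 0 \<le> A"
  unfolding form_bound_def using lball_zero[of M r] lball_zero[of M s] by fastforce

lemma form_bound_mono: "form_bound M r s A K \<Longrightarrow> A \<le> A' \<Longrightarrow> form_bound M r s A' K"
  unfolding form_bound_def by (meson order_trans)

lemma multiplier_mono: "multiplier M r s c m \<Longrightarrow> c \<le> c' \<Longrightarrow> multiplier M r s c' m"
  unfolding multiplier_def
  by (meson form_bound_mono form_bound_nonneg mult_right_mono order_trans)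

lemma multiplierI:
  assumes "0 \<le> c" "m \<in> borel_measurable (M \<Otimes>\<^sub>M M)"
    and "\<And>z. z \<in> space (M \<Otimes>\<^sub>M M) \<Longrightarrow> cmod (m z) \<le> c"
    and "\<And>K A \<psi> f. form_bound M r s A K \<Longrightarrow> \<psi> \<in> lball M s \<Longrightarrow> f \<in> lball M r \<Longrightarrow>
      cmod (\<integral>z. m z * K z * (\<psi> (fst z) * f (snd z)) \<partial>(M \<Otimes>\<^sub>M M)) \<le> c * A"
  shows "multiplier M r s c m"
  unfolding multiplier_def form_bound_def
  using assms(1-3) assms(4)[unfolded form_bound_def]
  by (auto intro!: integrable_bounded_mult[OF _ assms(2,3)])

lemma multiplier_const: "multiplier M r s (cmod a) (\<lambda>_. a)"
  by (rule multiplierI) (auto simp: form_bound_def mult.assoc norm_mult intro!: mult_left_mono)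

lemma multiplier_mult:
  assumes "multiplier M r s c m" "multiplier M r s c' m'"
  shows "multiplier M r s (c * c') (\<lambda>z. m z * m' z)"
  using assms unfolding multiplier_def
  by (auto simp: norm_mult mult.assoc intro!: mult_mono)

lemma multiplier_add:
  assumes m: "multiplier M r s c m" and m': "multiplier M r s c' m'"
  shows "multiplier M r s (c + c') (\<lambda>z. m z + m' z)"
proof (rule multiplierI)
  show "0 \<le> c + c'" "(\<lambda>z. m z + m' z) \<in> borel_measurable (M \<Otimes>\<^sub>M M)"
    using assms by (auto simp: multiplier_def)
  show "cmod (m z + m' z) \<le> c + c'" if "z \<in> space (M \<Otimes>\<^sub>M M)" for z
    using assms that by (auto simp: multiplier_def intro!: norm_triangle_mono)
  fix K A \<psi> f assume K: "form_bound M r s A K" and \<psi>: "\<psi> \<in> lball M s" and f: "f \<in> lball M r"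
  have 1: "form_bound M r s (c * A) (\<lambda>z. m z * K z)" "form_bound M r s (c' * A) (\<lambda>z. m' z * K z)"
    using K m m' by (auto simp: multiplier_def)
  then have i: "integrable (M \<Otimes>\<^sub>M M) (\<lambda>z. m z * K z * (\<psi> (fst z) * f (snd z)))"
    "integrable (M \<Otimes>\<^sub>M M) (\<lambda>z. m' z * K z * (\<psi> (fst z) * f (snd z)))"
    using \<psi> f by (auto simp: form_bound_def intro!: integrable_form)
  have "(\<integral>z. (m z + m' z) * K z * (\<psi> (fst z) * f (snd z)) \<partial>(M \<Otimes>\<^sub>M M)) =
     (\<integral>z. m z * K z * (\<psi> (fst z) * f (snd z)) \<partial>(M \<Otimes>\<^sub>M M)) +
     (\<integral>z. m' z * K z * (\<psi> (fst z) * f (snd z)) \<partial>(M \<Otimes>\<^sub>M M))"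
    by (subst Bochner_Integration.integral_add[OF i, symmetric]) (simp add: algebra_simps)
  moreover have "cmod \<dots> \<le> c * A + c' * A"
    using 1 \<psi> f by (intro norm_triangle_mono) (auto simp: form_bound_def)
  ultimately show "cmod (\<integral>z. (m z + m' z) * K z * (\<psi> (fst z) * f (snd z)) \<partial>(M \<Otimes>\<^sub>M M)) \<le> (c + c') * A"
    by (simp add: distrib_right)
qed

lemma multiplier_sum:
  assumes "finite I" "\<And>i. i \<in> I \<Longrightarrow> multiplier M r s (c i) (m i)"
  shows "multiplier M r s (\<Sum>i\<in>I. c i) (\<lambda>z. \<Sum>i\<in>I. m i z)"
  using assms
proof (induction I rule: finite_induct)
  case empty
  then show ?case using multiplier_const[of M r s 0] by simp
next
  case (insert i I)
  then show ?case using multiplier_add[of M r s "c i" "m i"] by simp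
qed

lemma multiplier_prod:
  assumes "finite I" "\<And>i. i \<in> I \<Longrightarrow> multiplier M r s (c i) (m i)"
  shows "multiplier M r s (\<Prod>i\<in>I. c i) (\<lambda>z. \<Prod>i\<in>I. m i z)"
  using assms
proof (induction I rule: finite_induct)
  case empty
  then show ?case using multiplier_const[of M r s 1] by simp
next
  case (insert i I)
  then show ?case using multiplier_mult[of M r s "c i" "m i"] by simp
qed

lemma multiplier_power:
  assumes "multiplier M r s c m"
  shows "multiplier M r s (c ^ k) (\<lambda>z. m z ^ k)"
  using multiplier_prod[of "{..<k}" M r s "\<lambda>_. c" "\<lambda>_. m"] assms by simp

text \<open>Dominated convergence, with \<open>c\<close> times the modulus of the paired kernel as
  majorant. Gaussians, power series and the endpoint of the binomial series all become multipliers
  through this closure property.\<close>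

lemma multiplier_lim:
  assumes m: "\<And>n. multiplier M r s c (m n)"
    and lim: "\<And>z. z \<in> space (M \<Otimes>\<^sub>M M) \<Longrightarrow> (\<lambda>n. m n z) \<longlonglongrightarrow> m' z"
  shows "multiplier M r s c m'"
proof (rule multiplierI)
  have mm: "m n \<in> borel_measurable (M \<Otimes>\<^sub>M M)" for n using m by (auto simp: multiplier_def)
  show "0 \<le> c" using m by (auto simp: multiplier_def)
  show meas: "m' \<in> borel_measurable (M \<Otimes>\<^sub>M M)"
    by (rule borel_measurable_LIMSEQ_metric[OF mm lim])
  have bd: "cmod (m n z) \<le> c" if "z \<in> space (M \<Otimes>\<^sub>M M)" for n z
    using m that by (auto simp: multiplier_def)
  show "cmod (m' z) \<le> c" if "z \<in> space (M \<Otimes>\<^sub>M M)" for z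
    using tendsto_norm[OF lim[OF that]] bd[OF that] by (intro LIMSEQ_le_const2) auto
  fix K A \<psi> f assume K: "form_bound M r s A K" and \<psi>: "\<psi> \<in> lball M s" and f: "f \<in> lball M r"
  let ?T = "\<lambda>z. K z * (\<psi> (fst z) * f (snd z))"
  have T: "integrable (M \<Otimes>\<^sub>M M) ?T"
    using K \<psi> f by (auto simp: form_bound_def intro!: integrable_form)
  then have Tm: "?T \<in> borel_measurable (M \<Otimes>\<^sub>M M)" by auto
  have "(\<lambda>n. \<integral>z. m n z * ?T z \<partial>(M \<Otimes>\<^sub>M M)) \<longlonglongrightarrow> (\<integral>z. m' z * ?T z \<partial>(M \<Otimes>\<^sub>M M))"
  proof (rule integral_dominated_convergence[where w = "\<lambda>z. c * norm (?T z)"])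
    show "(\<lambda>z. m' z * ?T z) \<in> borel_measurable (M \<Otimes>\<^sub>M M)" using meas Tm by simp
    show "(\<lambda>z. m n z * ?T z) \<in> borel_measurable (M \<Otimes>\<^sub>M M)" for n using mm Tm by simp
    show "integrable (M \<Otimes>\<^sub>M M) (\<lambda>z. c * norm (?T z))" using T by simp
    show "AE z in M \<Otimes>\<^sub>M M. (\<lambda>n. m n z * ?T z) \<longlonglongrightarrow> m' z * ?T z"
      using lim by (intro AE_I2 tendsto_intros)
    show "AE z in M \<Otimes>\<^sub>M M. norm (m n z * ?T z) \<le> c * norm (?T z)" for n
      using bd by (intro AE_I2) (auto simp only: norm_mult intro!: mult_right_mono mult_nonneg_nonneg norm_ge_zero)
  qed
  moreover have "norm (\<integral>z. m n z * ?T z \<partial>(M \<Otimes>\<^sub>M M)) \<le> c * A" for n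
  proof -
    have "form_bound M r s (c * A) (\<lambda>z. m n z * K z)" using m[of n] K by (auto simp: multiplier_def)
    then show ?thesis using \<psi> f unfolding form_bound_def by (simp add: mult.assoc)
  qed
  ultimately have "norm (\<integral>z. m' z * ?T z \<partial>(M \<Otimes>\<^sub>M M)) \<le> c * A"
    by (intro LIMSEQ_le_const2[OF tendsto_norm]) auto
  then show "cmod (\<integral>z. m' z * K z * (\<psi> (fst z) * f (snd z)) \<partial>(M \<Otimes>\<^sub>M M)) \<le> c * A"
    by (simp add: mult.assoc)
qed

lemma multiplier_suminf:
  assumes m: "\<And>k. multiplier M r s (c k) (m k)" and c: "summable c"
    and lim: "\<And>z. z \<in> space (M \<Otimes>\<^sub>M M) \<Longrightarrow> (\<lambda>k. m k z) sums m' z"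
  shows "multiplier M r s (\<Sum>k. c k) m'"
proof (rule multiplier_lim)
  show "multiplier M r s (\<Sum>k. c k) (\<lambda>z. \<Sum>k<n. m k z)" for n
  proof (rule multiplier_mono[OF multiplier_sum])
    show "(\<Sum>k<n. c k) \<le> (\<Sum>k. c k)"
      using m by (intro sum_le_suminf c) (auto simp: multiplier_def)
  qed (auto intro: m)
  show "(\<lambda>n. \<Sum>k<n. m k z) \<longlonglongrightarrow> m' z" if "z \<in> space (M \<Otimes>\<^sub>M M)" for z
    using lim[OF that] by (simp add: sums_def)
qed

lemma lball_mult:
  assumes M: "finite_measure M" and r: "0 \<le> r" and f: "f \<in> lball M r"
    and \<phi>: "\<phi> \<in> borel_measurable M" "\<And>x. x \<in> space M \<Longrightarrow> cmod (\<phi> x) \<le> 1"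
  shows "(\<lambda>x. \<phi> x * f x) \<in> lball M r"
proof -
  obtain K where K: "0 \<le> K" "\<And>x. x \<in> space M \<Longrightarrow> cmod (f x) \<le> K" using lball_bound_pos[OF f] by blast
  have fm: "f \<in> borel_measurable M" using f by (simp add: lball_def)
  have le: "cmod (\<phi> x * f x) \<le> cmod (f x)" if "x \<in> space M" for x
    using \<phi>(2)[OF that] mult_left_le_one_le[of "cmod (f x)" "cmod (\<phi> x)"] by (simp add: norm_mult)
  have i: "integrable M (\<lambda>x. cmod (f x) powr r)"
    using fm by (intro finite_measure.integrable_const_bound[OF M, where B = "K powr r"])
      (auto intro!: AE_I2 powr_mono2 r K)
  have "(\<integral>x. cmod (\<phi> x * f x) powr r \<partial>M) \<le> (\<integral>x. cmod (f x) powr r \<partial>M)"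
    by (intro Bochner_Integration.integral_mono' i powr_mono2 r le) auto
  also have "\<dots> \<le> 1" using f by (simp add: lball_def)
  finally show ?thesis
    using \<phi>(1) fm le K(2) unfolding lball_def by (auto intro!: exI[of _ K] intro: order_trans)
qed

text \<open>The factors are moved onto the test functions, which stay in their unit balls. This is
  the only source of multipliers apart from algebra and limits.\<close>

lemma multiplier_tensor:
  assumes M: "finite_measure M" and r: "0 \<le> r" "0 \<le> s"
    and \<phi>: "\<phi> \<in> borel_measurable M" "\<And>x. x \<in> space M \<Longrightarrow> cmod (\<phi> x) \<le> 1"
    and \<eta>: "\<eta> \<in> borel_measurable M" "\<And>x. x \<in> space M \<Longrightarrow> cmod (\<eta> x) \<le> 1"
  shows "multiplier M r s 1 (\<lambda>z. \<phi> (fst z) * \<eta> (snd z))"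
proof (rule multiplierI)
  show "(\<lambda>z. \<phi> (fst z) * \<eta> (snd z)) \<in> borel_measurable (M \<Otimes>\<^sub>M M)"
    using test_pair_measurable[OF \<phi>(1) \<eta>(1)] .
  show "cmod (\<phi> (fst z) * \<eta> (snd z)) \<le> 1" if "z \<in> space (M \<Otimes>\<^sub>M M)" for z
    using that \<phi>(2) \<eta>(2) by (auto simp: space_pair_measure norm_mult intro!: mult_le_one)
  fix K A \<psi> f assume K: "form_bound M r s A K" and \<psi>: "\<psi> \<in> lball M s" and f: "f \<in> lball M r"
  have a: "(\<lambda>x. \<phi> x * \<psi> x) \<in> lball M s" by (rule lball_mult[OF M r(2) \<psi> \<phi>])
  have b: "(\<lambda>x. \<eta> x * f x) \<in> lball M r" by (rule lball_mult[OF M r(1) f \<eta>])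
  have "cmod (\<integral>z. K z * ((\<phi> (fst z) * \<psi> (fst z)) * (\<eta> (snd z) * f (snd z))) \<partial>(M \<Otimes>\<^sub>M M)) \<le> A"
    using K[unfolded form_bound_def, THEN conjunct2, rule_format, OF a b] .
  then show "cmod (\<integral>z. \<phi> (fst z) * \<eta> (snd z) * K z * (\<psi> (fst z) * f (snd z)) \<partial>(M \<Otimes>\<^sub>M M)) \<le> 1 * A"
    by (simp add: mult_ac)
qed simp

lemma multiplier_power_series:
  fixes u :: "'a \<times> 'a \<Rightarrow> real" and b :: "nat \<Rightarrow> real"
  assumes u: "multiplier M r s c (\<lambda>z. of_real (u z))" and b: "summable (\<lambda>k. \<bar>b k\<bar> * c ^ k)"
    and sums: "\<And>z. z \<in> space (M \<Otimes>\<^sub>M M) \<Longrightarrow> (\<lambda>k. b k * u z ^ k) sums v z"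
  shows "multiplier M r s (\<Sum>k. \<bar>b k\<bar> * c ^ k) (\<lambda>z. of_real (v z))"
proof (rule multiplier_suminf)
  show "multiplier M r s (\<bar>b k\<bar> * c ^ k) (\<lambda>z. of_real (b k * u z ^ k))" for k
    using multiplier_mult[OF multiplier_const[of M r s "of_real (b k)"] multiplier_power[OF u]] by simp
  show "(\<lambda>k. complex_of_real (b k * u z ^ k)) sums of_real (v z)" if "z \<in> space (M \<Otimes>\<^sub>M M)" for z
    using sums[OF that] by (rule sums_of_real)
qed (rule b)

text \<open>The left side is the characteristic function of a normalised sum of n random signs, so
  this is the simplest central limit theorem. It produces Gaussians from cosines without a Fourier
  integral.\<close>

lemma cos_power_tendsto_gaussian:
  fixes t :: real
  shows "(\<lambda>n. cos (t / sqrt (real n)) ^ n) \<longlonglongrightarrow> exp (- (t * t / 2))"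
  by real_asymp

subsection \<open>Powers of the distance as multipliers\<close>

text \<open>The cosine is the mean of two characters, and a character of a difference splits into a
  function of x times a function of y, both of modulus 1. The weights 1/2 keep the norm at
  1.\<close>

lemma multiplier_cos_diff:
  fixes X :: "'a \<Rightarrow> real"
  assumes M: "finite_measure M" and r: "0 \<le> r" "0 \<le> s" and X: "X \<in> borel_measurable M"
  shows "multiplier M r s 1 (\<lambda>z. of_real (cos (a * (X (fst z) - X (snd z)))))"
proof -
  have cismeas: "(\<lambda>x. cis (b * X x)) \<in> borel_measurable M" for b
    unfolding cis_conv_exp using X by measurable
  have 1: "multiplier M r s 1 (\<lambda>z. cis (b * X (fst z)) * cis (- b * X (snd z)))" for b
    by (rule multiplier_tensor[OF M r]) (auto intro: cismeas cismeas[of "-b", simplified])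
  have "multiplier M r s (cmod (1/2) * 1 + cmod (1/2) * 1)
    (\<lambda>z. 1/2 * (cis (a * X (fst z)) * cis (- a * X (snd z))) + 1/2 * (cis (- a * X (fst z)) * cis (- (- a) * X (snd z))))"
    by (intro multiplier_add multiplier_mult multiplier_const 1)
  moreover have "1/2 * (cis (a * x) * cis (- a * y)) + 1/2 * (cis (- a * x) * cis (- (- a) * y)) =
     complex_of_real (cos (a * (x - y)))" for x y
    by (simp add: cis_mult complex_eq_iff cos_diff sin_diff right_diff_distrib) (simp add: field_simps)
  ultimately show ?thesis by simp
qed

lemma multiplier_gaussian:
  fixes X :: "'i \<Rightarrow> 'a \<Rightarrow> real"
  assumes M: "finite_measure M" and r: "0 \<le> r" "0 \<le> s"
    and X: "\<And>i. i \<in> I \<Longrightarrow> X i \<in> borel_measurable M" and I: "finite I" and \<kappa>: "0 \<le> \<kappa>"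
  shows "multiplier M r s 1 (\<lambda>z. of_real (exp (- (\<kappa> * (\<Sum>i\<in>I. (X i (fst z) - X i (snd z))\<^sup>2)))))"
proof -
  \<comment> \<open>Chosen so that b^2 / 2 = \<kappa>, as the limit of the cosine powers
    requires.\<close>
  define b where "b = sqrt (2 * \<kappa>)"
  have b: "b * b = 2 * \<kappa>" using \<kappa> by (simp add: b_def)
  have "multiplier M r s 1 (\<lambda>z. of_real (exp (- (\<kappa> * (X i (fst z) - X i (snd z))\<^sup>2))))" if i: "i \<in> I" for i
  proof (rule multiplier_lim)
    show "multiplier M r s 1 (\<lambda>z. of_real (cos (b / sqrt (real n) * (X i (fst z) - X i (snd z)))) ^ n)" for n
      using multiplier_power[OF multiplier_cos_diff[OF M r X[OF i], of "b / sqrt (real n)"], of n] by simp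
    fix z
    have "(\<lambda>n. cos (b * (X i (fst z) - X i (snd z)) / sqrt (real n)) ^ n) \<longlonglongrightarrow>
       exp (- (b * (X i (fst z) - X i (snd z)) * (b * (X i (fst z) - X i (snd z))) / 2))"
      by (rule cos_power_tendsto_gaussian)
    also have "b * (X i (fst z) - X i (snd z)) * (b * (X i (fst z) - X i (snd z))) / 2 =
       b * b * (X i (fst z) - X i (snd z))\<^sup>2 / 2" by (simp add: power2_eq_square)
    finally have "(\<lambda>n. cos (b * (X i (fst z) - X i (snd z)) / sqrt (real n)) ^ n) \<longlonglongrightarrow>
       exp (- (\<kappa> * (X i (fst z) - X i (snd z))\<^sup>2))" by (simp add: b)
    from tendsto_of_real[OF this] show "(\<lambda>n. complex_of_real (cos (b / sqrt (real n) * (X i (fst z) - X i (snd z)))) ^ n)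
      \<longlonglongrightarrow> complex_of_real (exp (- (\<kappa> * (X i (fst z) - X i (snd z))\<^sup>2)))" by simp
  qed
  from multiplier_prod[OF I this]
  have "multiplier M r s (\<Prod>i\<in>I. 1) (\<lambda>z. \<Prod>i\<in>I. of_real (exp (- (\<kappa> * (X i (fst z) - X i (snd z))\<^sup>2))))" .
  then show ?thesis
    by (simp add: exp_sum[OF I] sum_distrib_left sum_negf[symmetric] del: sum_negf of_real_exp)
qed

text \<open>Expanding the square leaves three tensors, of norms 1, 1 and 2.\<close>

lemma multiplier_square_diff:
  fixes X :: "'a \<Rightarrow> real"
  assumes M: "finite_measure M" and r: "0 \<le> r" "0 \<le> s" and X: "X \<in> borel_measurable M"
    and bd: "\<And>x. x \<in> space M \<Longrightarrow> \<bar>X x\<bar> \<le> 1"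
  shows "multiplier M r s 4 (\<lambda>z. of_real ((X (fst z) - X (snd z))\<^sup>2))"
proof -
  have X1: "(\<lambda>x. complex_of_real (X x)) \<in> borel_measurable M"
    and X2: "(\<lambda>x. complex_of_real ((X x)\<^sup>2)) \<in> borel_measurable M" using X by measurable
  have bd2: "x \<in> space M \<Longrightarrow> (X x)\<^sup>2 \<le> 1" for x using bd[of x] by (simp add: abs_square_le_1)
  have "multiplier M r s (1 + 1 + cmod (-2) * 1)
     (\<lambda>z. of_real ((X (fst z))\<^sup>2) * 1 + 1 * of_real ((X (snd z))\<^sup>2) + (-2) * (of_real (X (fst z)) * of_real (X (snd z))))"
    by (intro multiplier_add multiplier_mult multiplier_const multiplier_tensor[OF M r]
        multiplier_tensor[OF M r, of "\<lambda>x. of_real ((X x)\<^sup>2)" "\<lambda>_. 1"]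
        multiplier_tensor[OF M r, of "\<lambda>_. 1" "\<lambda>x. of_real ((X x)\<^sup>2)"] X1 X2)
      (auto simp: bd bd2 norm_power)
  then show ?thesis by (simp add: power2_eq_square algebra_simps)
qed

section \<open>Binomial series with a multiplier as argument\<close>

lemma gbinomial_Suc_alternating:
  fixes \<sigma> :: real
  shows "(\<sigma> gchoose Suc k) * (-1) ^ Suc k = (\<sigma> gchoose k) * (-1) ^ k * ((real k - \<sigma>) / real (Suc k))"
  by (simp add: gbinomial_prod_rev field_simps)

text \<open>The recursion factor (k - \<sigma>)/(k + 1) is negative at k = 0 and positive
  afterwards, so the sign changes once, right after the leading coefficient 1.\<close>

lemma gbinomial_alternating_nonpos:
  fixes \<sigma> :: real
  assumes "0 < \<sigma>" "\<sigma> < 1"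
  shows "(\<sigma> gchoose Suc k) * (-1) ^ Suc k \<le> 0"
proof (induction k)
  case 0
  then show ?case using assms by simp
next
  case (Suc k)
  show ?case unfolding gbinomial_Suc_alternating[of \<sigma> "Suc k"]
    using assms by (intro mult_nonpos_nonneg[OF Suc]) auto
qed

lemma gbinomial_alternating_nonneg:
  fixes \<sigma> :: real
  assumes "\<sigma> < 0"
  shows "0 \<le> (\<sigma> gchoose k) * (-1) ^ k"
proof (induction k)
  case (Suc k)
  show ?case unfolding gbinomial_Suc_alternating
    using assms by (intro mult_nonneg_nonneg[OF Suc]) auto
qed simp

lemma alternating_binomial_sums:
  fixes \<sigma> :: real
  assumes "\<bar>t\<bar> < 1"
  shows "(\<lambda>k. (\<sigma> gchoose k) * (-1) ^ k * t ^ k) sums (1 - t) powr \<sigma>"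
  using gen_binomial_real[of "-t" \<sigma>] assms by (simp add: power_minus[of t] mult.assoc)

text \<open>Apart from the leading 1, the coefficients of (1 - t)^\<sigma> are nonpositive. Hence
  the series of their moduli sums to 2 - (1 - t)^\<sigma>, which is at most 2 uniformly in t <
  1.\<close>

lemma multiplier_one_minus_powr:
  fixes w :: "'a \<times> 'a \<Rightarrow> real"
  assumes \<sigma>: "0 < \<sigma>" "\<sigma> < 1" and w: "multiplier M r s 1 (\<lambda>z. of_real (w z))"
  shows "multiplier M r s 2 (\<lambda>z. of_real ((1 - w z) powr \<sigma>))"
proof -
  define b where "b k = (\<sigma> gchoose k) * (-1) ^ k" for k
  have w1: "\<bar>w z\<bar> \<le> 1" if "z \<in> space (M \<Otimes>\<^sub>M M)" for z
    using w that by (auto simp: multiplier_def)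
  have abs_sums: "(\<lambda>k. \<bar>b k\<bar> * t ^ k) sums (2 - (1 - t) powr \<sigma>)" if t: "0 \<le> t" "t < 1" for t :: real
  proof -
    have "(\<lambda>k. 2 * (if k = 0 then 1 else 0) - b k * t ^ k) sums (2 * 1 - (1 - t) powr \<sigma>)"
      unfolding b_def using t sums_single[of 0 "\<lambda>_. 1 :: real"]
      by (intro sums_diff sums_mult alternating_binomial_sums) auto
    moreover have "2 * (if k = 0 then 1 else 0) - b k * t ^ k = \<bar>b k\<bar> * t ^ k" for k
      using gbinomial_alternating_nonpos[OF \<sigma>] by (cases k) (auto simp: b_def)
    ultimately show ?thesis by simp
  qed
  \<comment> \<open>Shrinking \<open>w\<close> by a factor below 1 keeps the argument inside the
    disc of convergence; the bound 2 is uniform, so the factor can tend to 1.\<close>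
  define \<theta> where "\<theta> n = 1 - 1 / real (Suc n)" for n
  have \<theta>: "0 \<le> \<theta> n" "\<theta> n < 1" for n by (auto simp: \<theta>_def field_simps)
  have step: "multiplier M r s 2 (\<lambda>z. of_real ((1 - \<theta> n * w z) powr \<sigma>))" for n
  proof (rule multiplier_mono)
    have "multiplier M r s (cmod (of_real (\<theta> n)) * 1) (\<lambda>z. of_real (\<theta> n) * of_real (w z))"
      by (intro multiplier_mult multiplier_const w)
    then have 1: "multiplier M r s (\<theta> n) (\<lambda>z. of_real (\<theta> n * w z))" using \<theta>[of n] by simp
    show "multiplier M r s (\<Sum>k. \<bar>b k\<bar> * \<theta> n ^ k) (\<lambda>z. of_real ((1 - \<theta> n * w z) powr \<sigma>))"
    proof (rule multiplier_power_series[OF 1])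
      show "summable (\<lambda>k. \<bar>b k\<bar> * \<theta> n ^ k)" using abs_sums[OF \<theta>] by (rule sums_summable)
      fix z assume "z \<in> space (M \<Otimes>\<^sub>M M)"
      then have "\<bar>\<theta> n * w z\<bar> < 1"
        using w1[of z] \<theta>[of n] mult_left_le[of "\<bar>w z\<bar>" "\<theta> n"] by (simp add: abs_mult)
      from alternating_binomial_sums[OF this]
      show "(\<lambda>k. b k * (\<theta> n * w z) ^ k) sums (1 - \<theta> n * w z) powr \<sigma>" by (simp add: b_def)
    qed
    show "(\<Sum>k. \<bar>b k\<bar> * \<theta> n ^ k) \<le> 2"
      using sums_unique[OF abs_sums[OF \<theta>, of n]] powr_ge_zero[of "1 - \<theta> n" \<sigma>] by linarith
  qed
  show ?thesis
  proof (rule multiplier_lim[OF step])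
    fix z assume z: "z \<in> space (M \<Otimes>\<^sub>M M)"
    have "\<theta> \<longlonglongrightarrow> 1 - 0"
      unfolding \<theta>_def by (intro tendsto_intros LIMSEQ_Suc[OF lim_1_over_n])
    then have "(\<lambda>n. 1 - \<theta> n * w z) \<longlonglongrightarrow> 1 - (1 - 0) * w z" by (intro tendsto_intros)
    then have "(\<lambda>n. (1 - \<theta> n * w z) powr \<sigma>) \<longlonglongrightarrow> (1 - (1 - 0) * w z) powr \<sigma>"
    \<comment> \<open>If \<open>w z = 1\<close>, the base tends to 0, and continuity of the power
      there relies on \<sigma> > 0 and a nonnegative base.\<close>
    proof (rule tendsto_powr'[OF _ tendsto_const])
      have "0 \<le> 1 - \<theta> n * w z" for n
        using w1[OF z] \<theta>[of n] mult_le_one[of "\<theta> n" "\<bar>w z\<bar>"] mult_left_mono[of "w z" "\<bar>w z\<bar>" "\<theta> n"] by linarith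
      then show "1 - (1 - 0) * w z \<noteq> 0 \<or> 0 < \<sigma> \<and> (\<forall>\<^sub>F n in sequentially. 0 \<le> 1 - \<theta> n * w z)"
        using \<sigma> by simp
    qed
    then show "(\<lambda>n. complex_of_real ((1 - \<theta> n * w z) powr \<sigma>)) \<longlonglongrightarrow> of_real ((1 - w z) powr \<sigma>)"
      using tendsto_of_real by fastforce
  qed
qed

text \<open>Defined by 1 - exp(-u) = u (1 - exp_defect u), with the continuous value 0 at u = 0. Its
  power series has no constant term, so it is small with u and 1 - exp_defect u can be raised to a
  negative power.\<close>

definition exp_defect :: "real \<Rightarrow> real" where
  "exp_defect u = (if u = 0 then 0 else 1 - (1 - exp (- u)) / u)"

lemma exp_defect_sums:
  "(\<lambda>k. (if k = 0 then 0 else - ((-1) ^ k / fact (Suc k))) * u ^ k) sums exp_defect u"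
proof (cases "u = 0")
  case True
  have "(if k = 0 then 0 else - ((-1) ^ k / fact (Suc k))) * u ^ k = (0 :: real)" for k
    using True by (cases k) auto
  then show ?thesis using True by (simp add: exp_defect_def)
next
  case False
  have "(\<lambda>k. (- u) ^ Suc k / fact (Suc k)) sums (exp (- u) - 1)"
    using exp_converges[of "- u"] by (subst sums_Suc_iff) (simp add: divide_inverse mult.commute)
  then have "(\<lambda>k. - ((- u) ^ Suc k / fact (Suc k)) / u) sums (- (exp (- u) - 1) / u)"
    by (intro sums_divide sums_minus)
  then have "(\<lambda>k. (if k = 0 then 1 else 0) - (- ((- u) ^ Suc k / fact (Suc k)) / u)) sums (1 - (- (exp (- u) - 1) / u))"
    using sums_single[of 0 "\<lambda>_. 1 :: real"] by (intro sums_diff) auto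
  moreover have "(if k = 0 then 1 else 0) - (- ((- u) ^ Suc k / fact (Suc k)) / u) =
      (if k = 0 then 0 else - ((-1) ^ k / fact (Suc k))) * u ^ k" for k
    using False by (cases k) (simp_all add: power_minus[of u] del: fact_Suc)
  ultimately show ?thesis using False by (simp add: exp_defect_def)
qed

text \<open>For k \<ge> 1 the coefficient 1/(k+1)! is at most 1/2. At radius 1/2 the series is
  therefore dominated by the geometric series 1/4 + 1/8 + ..., whose sum is again 1/2.\<close>

lemma multiplier_exp_defect:
  assumes u: "multiplier M r s (1/2) (\<lambda>z. of_real (u z))"
  shows "multiplier M r s (1/2) (\<lambda>z. of_real (exp_defect (u z)))"
proof -
  let ?b = "\<lambda>k. (if k = 0 then 0 else - ((-1) ^ k / fact (Suc k))) :: real"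
  have major: "(\<lambda>k. if k = 0 then 0 else (1/2 :: real) ^ Suc k) sums (1/2)"
  proof -
    have "(\<lambda>k. (1/2 :: real) ^ Suc (Suc k)) sums (1/2 - 0)"
      using sums_mult[OF geometric_sums[of "1/2 :: real"], of "1/4"] by simp
    then show ?thesis
      using sums_Suc_iff[of "\<lambda>k. if k = 0 then 0 else (1/2 :: real) ^ Suc k" "1/2"] by simp
  qed
  have le: "\<bar>?b k\<bar> * (1/2) ^ k \<le> (if k = 0 then 0 else (1/2) ^ Suc k)" for k
  proof (cases "k = 0")
    case False
    have "(2::nat) \<le> fact (Suc k)" using False fact_ge_self[of "Suc k"] by linarith
    then have "(2::real) \<le> fact (Suc k)" by (metis of_nat_fact of_nat_le_iff of_nat_numeral)
    then have "1 / fact (Suc k) \<le> (1 / 2 :: real)" by (intro divide_left_mono) auto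
    then have "1 / fact (Suc k) * (1/2) ^ k \<le> 1 / 2 * (1 / 2 :: real) ^ k" by (rule mult_right_mono) simp
    then show ?thesis using False by simp
  qed simp
  have sm: "summable (\<lambda>k. \<bar>?b k\<bar> * (1/2) ^ k)"
    by (rule summable_comparison_test'[OF sums_summable[OF major], of 0]) (use le in auto)
  have "multiplier M r s (\<Sum>k. \<bar>?b k\<bar> * (1/2) ^ k) (\<lambda>z. of_real (exp_defect (u z)))"
    by (rule multiplier_power_series[OF u sm exp_defect_sums])
  moreover have "(\<Sum>k. \<bar>?b k\<bar> * (1/2) ^ k) \<le> 1/2"
    using suminf_le[OF le sm sums_summable[OF major]] sums_unique[OF major] by simp
  ultimately show ?thesis by (rule multiplier_mono)
qed

text \<open>All coefficients of (1 - t)^(-\<sigma>) are nonnegative, so the series of moduli at t =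
  1/2 is the function itself, with value 2^\<sigma> \<le> 2.\<close>

lemma multiplier_one_minus_powr_neg:
  fixes g :: "'a \<times> 'a \<Rightarrow> real"
  assumes \<sigma>: "0 < \<sigma>" "\<sigma> < 1" and g: "multiplier M r s (1/2) (\<lambda>z. of_real (g z))"
  shows "multiplier M r s 2 (\<lambda>z. of_real ((1 - g z) powr (- \<sigma>)))"
proof (rule multiplier_mono)
  have g1: "\<bar>g z\<bar> < 1" if "z \<in> space (M \<Otimes>\<^sub>M M)" for z
    using g that by (force simp: multiplier_def)
  have s: "(\<lambda>k. \<bar>(- \<sigma> gchoose k) * (-1) ^ k\<bar> * (1/2) ^ k) sums (1 - 1/2) powr (- \<sigma>)"
    using alternating_binomial_sums[of "1/2" "- \<sigma>"] gbinomial_alternating_nonneg[of "- \<sigma>"] \<sigma> by simp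
  show "multiplier M r s (\<Sum>k. \<bar>(- \<sigma> gchoose k) * (-1) ^ k\<bar> * (1/2) ^ k) (\<lambda>z. of_real ((1 - g z) powr (- \<sigma>)))"
    by (rule multiplier_power_series[OF g sums_summable[OF s] alternating_binomial_sums]) (rule g1)
  have "(1 - 1/2 :: real) powr (- \<sigma>) = 2 powr \<sigma>" by (simp add: powr_minus powr_divide)
  also have "\<dots> \<le> 2 powr 1" using \<sigma> by (intro powr_mono) auto
  finally show "(\<Sum>k. \<bar>(- \<sigma> gchoose k) * (-1) ^ k\<bar> * (1/2) ^ k) \<le> 2"
    using sums_unique[OF s] by simp
qed

text \<open>
  \<open>u = (1 - exp (- u)) / (1 - exp_defect u)\<close>: the first factor is one minus a contractive multiplier,
  the second is invertible by a convergent binomial series.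
\<close>

lemma multiplier_powr_fractional:
  fixes u :: "'a \<times> 'a \<Rightarrow> real"
  assumes \<sigma>: "0 < \<sigma>" "\<sigma> < 1" and u0: "\<And>z. 0 \<le> u z"
    and e: "multiplier M r s 1 (\<lambda>z. of_real (exp (- u z)))"
    and u: "multiplier M r s (1/2) (\<lambda>z. of_real (u z))"
  shows "multiplier M r s 4 (\<lambda>z. of_real (u z powr \<sigma>))"
proof -
  have "multiplier M r s (2 * 2)
      (\<lambda>z. of_real ((1 - exp (- u z)) powr \<sigma>) * of_real ((1 - exp_defect (u z)) powr (- \<sigma>)))"
    by (intro multiplier_mult multiplier_one_minus_powr multiplier_one_minus_powr_neg \<sigma> e multiplier_exp_defect u)
  moreover have "complex_of_real ((1 - exp (- u z)) powr \<sigma>) * of_real ((1 - exp_defect (u z)) powr (- \<sigma>)) =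
      of_real (u z powr \<sigma>)" for z
  proof (cases "u z = 0")
    case False
    then have pos: "0 < u z" using u0[of z] by simp
    then have "0 < (1 - exp (- u z)) / u z" by simp
    moreover have "1 - exp_defect (u z) = (1 - exp (- u z)) / u z" using False by (simp add: exp_defect_def)
    ultimately have d: "0 < 1 - exp_defect (u z)" "u z = (1 - exp (- u z)) / (1 - exp_defect (u z))"
      using pos by simp_all
    have "u z powr \<sigma> = ((1 - exp (- u z)) / (1 - exp_defect (u z))) powr \<sigma>" by (simp only: d(2)[symmetric])
    also have "\<dots> = (1 - exp (- u z)) powr \<sigma> * (1 - exp_defect (u z)) powr (- \<sigma>)"
      using pos d(1) by (simp add: powr_divide powr_minus_divide)
    finally have "(1 - exp (- u z)) powr \<sigma> * (1 - exp_defect (u z)) powr (- \<sigma>) = u z powr \<sigma>" by simp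
    then show ?thesis by (metis of_real_mult)
  qed (simp add: exp_defect_def)
  ultimately show ?thesis by simp
qed

text \<open>With N one more than the ceiling of t, the quotient t/N lies strictly below 1 even for
  integral t, and u^t is the N-th power of the fractional power u^(t/N), which has norm at most
  4.\<close>

definition powr_multiplier_const :: "real \<Rightarrow> real" where
  "powr_multiplier_const t = 4 ^ Suc (nat \<lceil>t\<rceil>)"

lemma multiplier_powr:
  fixes u :: "'a \<times> 'a \<Rightarrow> real"
  assumes t: "0 < t" and u0: "\<And>z. 0 \<le> u z"
    and e: "multiplier M r s 1 (\<lambda>z. of_real (exp (- u z)))"
    and u: "multiplier M r s (1/2) (\<lambda>z. of_real (u z))"
  shows "multiplier M r s (powr_multiplier_const t) (\<lambda>z. of_real (u z powr t))"
proof -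
  define N where "N = Suc (nat \<lceil>t\<rceil>)"
  have N: "t < real N" unfolding N_def by linarith
  have "multiplier M r s (4 ^ N) (\<lambda>z. of_real (u z powr (t / real N)) ^ N)"
    using t N by (intro multiplier_power multiplier_powr_fractional u0 e u) auto
  moreover have "(u z powr (t / real N)) ^ N = u z powr t" for z
    using N t by (cases "u z = 0") (auto simp: powr_power)
  then have "complex_of_real (u z powr (t / real N)) ^ N = of_real (u z powr t)" for z
    by (metis of_real_power)
  ultimately show ?thesis by (simp add: powr_multiplier_const_def N_def)
qed

text \<open>Origin of the 8: each squared difference has norm at most 4, so the sum has norm at most
  4 card I, and division by 8 card I leaves the 1/2 on which the power series for
  \<open>exp_defect\<close> depends.\<close>

lemma multiplier_distance_powr:
  fixes X :: "'i \<Rightarrow> 'a \<Rightarrow> real"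
  assumes M: "finite_measure M" and r: "0 \<le> r" "0 \<le> s" and t: "0 < t"
    and I: "finite I" "I \<noteq> {}"
    and X: "\<And>i. i \<in> I \<Longrightarrow> X i \<in> borel_measurable M"
    and bd: "\<And>i x. i \<in> I \<Longrightarrow> x \<in> space M \<Longrightarrow> \<bar>X i x\<bar> \<le> 1"
  shows "multiplier M r s (powr_multiplier_const t)
    (\<lambda>z. of_real ((1 / (8 * real (card I)) * (\<Sum>i\<in>I. (X i (fst z) - X i (snd z))\<^sup>2)) powr t))"
proof (rule multiplier_powr[OF t])
  let ?\<kappa> = "1 / (8 * real (card I))"
  show "0 \<le> ?\<kappa> * (\<Sum>i\<in>I. (X i (fst z) - X i (snd z))\<^sup>2)" for z
    by (intro mult_nonneg_nonneg sum_nonneg) auto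
  show "multiplier M r s 1 (\<lambda>z. of_real (exp (- (?\<kappa> * (\<Sum>i\<in>I. (X i (fst z) - X i (snd z))\<^sup>2)))))"
    by (intro multiplier_gaussian[OF M r] X I) auto
  have "multiplier M r s (cmod (of_real ?\<kappa>) * (\<Sum>i\<in>I. 4))
      (\<lambda>z. of_real ?\<kappa> * (\<Sum>i\<in>I. of_real ((X i (fst z) - X i (snd z))\<^sup>2)))"
    by (intro multiplier_mult multiplier_const multiplier_sum multiplier_square_diff[OF M r] X bd I)
  moreover have "cmod (of_real ?\<kappa>) * (\<Sum>i\<in>I. 4) = 1 / 2"
    using I by (simp add: norm_divide card_gt_0_iff)
  ultimately have "multiplier M r s (1 / 2)
      (\<lambda>z. of_real ?\<kappa> * (\<Sum>i\<in>I. of_real ((X i (fst z) - X i (snd z))\<^sup>2)))" by (simp only:)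
  then show "multiplier M r s (1 / 2) (\<lambda>z. of_real (?\<kappa> * (\<Sum>i\<in>I. (X i (fst z) - X i (snd z))\<^sup>2)))"
    by simp
qed

subsection \<open>Mixed norms of kernels of finite rank\<close>

definition bounded_fun :: "'a measure \<Rightarrow> ('a \<Rightarrow> complex) \<Rightarrow> bool" where
  "bounded_fun M f \<longleftrightarrow> f \<in> borel_measurable M \<and> (\<exists>K. \<forall>x\<in>space M. cmod (f x) \<le> K)"

lemma lball_iff: "f \<in> lball M r \<longleftrightarrow> bounded_fun M f \<and> (\<integral>x. cmod (f x) powr r \<partial>M) \<le> 1"
  by (auto simp: lball_def bounded_fun_def)

lemma bounded_fun_measurable: "bounded_fun M f \<Longrightarrow> f \<in> borel_measurable M"
  by (simp add: bounded_fun_def)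

lemma bounded_fun_const: "bounded_fun M (\<lambda>_. c)"
  by (auto simp: bounded_fun_def)

lemma bounded_fun_mult:
  assumes "bounded_fun M f" "bounded_fun M g"
  shows "bounded_fun M (\<lambda>x. f x * g x)"
proof -
  obtain a b where a: "\<And>x. x \<in> space M \<Longrightarrow> cmod (f x) \<le> a" and b: "\<And>x. x \<in> space M \<Longrightarrow> cmod (g x) \<le> b"
    using assms unfolding bounded_fun_def by blast
  have "cmod (f x * g x) \<le> max 0 a * max 0 b" if "x \<in> space M" for x
    using a[OF that] b[OF that] by (auto simp: norm_mult intro!: mult_mono)
  then show ?thesis using assms unfolding bounded_fun_def by auto
qed

lemma bounded_fun_add:
  assumes "bounded_fun M f" "bounded_fun M g"
  shows "bounded_fun M (\<lambda>x. f x + g x)"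
proof -
  obtain a b where "\<And>x. x \<in> space M \<Longrightarrow> cmod (f x) \<le> a" "\<And>x. x \<in> space M \<Longrightarrow> cmod (g x) \<le> b"
    using assms unfolding bounded_fun_def by blast
  then have "cmod (f x + g x) \<le> a + b" if "x \<in> space M" for x
    using that by (intro norm_triangle_mono) auto
  then show ?thesis using assms unfolding bounded_fun_def by auto
qed

lemma bounded_fun_sum:
  assumes "\<And>i. i \<in> I \<Longrightarrow> bounded_fun M (f i)"
  shows "bounded_fun M (\<lambda>x. \<Sum>i\<in>I. f i x)"
  using assms
  by (induction I rule: infinite_finite_induct) (auto intro: bounded_fun_const bounded_fun_add)

lemma bounded_fun_cmult: "bounded_fun M f \<Longrightarrow> bounded_fun M (\<lambda>x. c * f x)"
  by (rule bounded_fun_mult[OF bounded_fun_const])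

lemma bounded_fun_diff:
  assumes "bounded_fun M f" "bounded_fun M g"
  shows "bounded_fun M (\<lambda>x. f x - g x)"
  using bounded_fun_add[OF assms(1) bounded_fun_cmult[OF assms(2), of "-1"]] by simp

lemma bounded_fun_integrable:
  assumes "finite_measure M" "bounded_fun M f"
  shows "integrable M f"
proof -
  obtain K where "\<forall>x\<in>space M. cmod (f x) \<le> K" using assms(2) by (auto simp: bounded_fun_def)
  then show ?thesis using assms
    by (intro finite_measure.integrable_const_bound[OF assms(1), where B = K]) (auto simp: bounded_fun_def)
qed

lemma bounded_fun_powr_integrable:
  assumes "finite_measure M" "bounded_fun M f" "0 \<le> r"
  shows "integrable M (\<lambda>x. cmod (f x) powr r)"
proof -
  obtain K where "\<forall>x\<in>space M. cmod (f x) \<le> K" using assms(2) by (auto simp: bounded_fun_def)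
  then show ?thesis using assms
    by (intro finite_measure.integrable_const_bound[OF assms(1), where B = "K powr r"])
      (auto simp: bounded_fun_def intro!: powr_mono2)
qed

text \<open>The constant 2 replaces 1 because only Young's inequality is used.\<close>

lemma lball_pairing_le:
  assumes r: "1 < r" "1 < r'" "1 / r + 1 / r' = 1" and f: "f \<in> lball M r" and M: "finite_measure M"
    and h: "h \<in> borel_measurable M" "integrable M (\<lambda>x. cmod (h x) powr r')"
    and T: "0 < T" "(\<integral>x. cmod (h x) powr r' \<partial>M) \<le> T powr r'"
  shows "cmod (\<integral>x. h x * f x \<partial>M) \<le> 2 * T"
proof -
  have fi: "integrable M (\<lambda>x. cmod (f x) powr r)"
    using f r M by (auto simp: lball_iff intro: bounded_fun_powr_integrable)
  have T': "0 < T powr r'" using T by simp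
  have le: "norm (h x * f x) \<le> T * (cmod (h x) powr r' / T powr r' + cmod (f x) powr r)" for x
  proof -
    have "cmod (h x) / T * cmod (f x) \<le> (cmod (h x) / T) powr r' / r' + cmod (f x) powr r / r"
      using Youngs_inequality[of r' r "cmod (h x) / T" "cmod (f x)"] r T by (simp add: add.commute)
    also have "\<dots> \<le> (cmod (h x) / T) powr r' / 1 + cmod (f x) powr r / 1"
      using r by (intro add_mono divide_left_mono) auto
    finally have "T * (cmod (h x) / T * cmod (f x)) \<le> T * (cmod (h x) powr r' / T powr r' + cmod (f x) powr r)"
      using T by (intro mult_left_mono) (auto simp: powr_divide)
    then show ?thesis using T by (simp add: norm_mult)
  qed
  have gi: "integrable M (\<lambda>x. T * (cmod (h x) powr r' / T powr r' + cmod (f x) powr r))"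
    using fi h by simp
  have hf: "integrable M (\<lambda>x. h x * f x)"
  proof (rule Bochner_Integration.integrable_bound[OF gi])
    show "(\<lambda>x. h x * f x) \<in> borel_measurable M" using f h by (auto simp: lball_def)
    show "AE x in M. norm (h x * f x) \<le> norm (T * (cmod (h x) powr r' / T powr r' + cmod (f x) powr r))"
      using le abs_ge_self order_trans unfolding real_norm_def by (intro AE_I2) blast
  qed
  have "cmod (\<integral>x. h x * f x \<partial>M) \<le> (\<integral>x. T * (cmod (h x) powr r' / T powr r' + cmod (f x) powr r) \<partial>M)"
  proof (rule order_trans[OF integral_norm_bound])
    show "(\<integral>x. norm (h x * f x) \<partial>M) \<le> (\<integral>x. T * (cmod (h x) powr r' / T powr r' + cmod (f x) powr r) \<partial>M)"
      by (rule Bochner_Integration.integral_mono[OF integrable_norm[OF hf] gi]) (rule le)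
  qed
  also have "\<dots> = T * ((\<integral>x. cmod (h x) powr r' \<partial>M) / T powr r' + (\<integral>x. cmod (f x) powr r \<partial>M))"
    using fi h by simp
  also have "\<dots> \<le> T * (1 + 1)"
    using T f T' by (intro mult_left_mono add_mono) (auto simp: lball_def)
  finally show ?thesis by simp
qed

lemma lball_pairing_le':
  assumes r: "1 < r" "1 < r'" "1 / r + 1 / r' = 1" and f: "f \<in> lball M r" and M: "finite_measure M"
    and h: "bounded_fun M h"
  shows "cmod (\<integral>x. h x * f x \<partial>M) \<le> 2 * (\<integral>x. cmod (h x) powr r' \<partial>M) powr (1 / r')"
proof (rule field_le_epsilon)
  fix e :: real assume e: "0 < e"
  define S where "S = (\<integral>x. cmod (h x) powr r' \<partial>M)"
  have S0: "0 \<le> S" unfolding S_def by (rule Bochner_Integration.integral_nonneg) simp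
  \<comment> \<open>The preceding bound needs a positive \<open>T\<close>, whereas the root of
    \<open>S\<close> may vanish; the summand e/2 covers that case.\<close>
  have "cmod (\<integral>x. h x * f x \<partial>M) \<le> 2 * (S powr (1 / r') + e / 2)"
  proof (rule lball_pairing_le[OF r f M])
    show "h \<in> borel_measurable M" using h by (rule bounded_fun_measurable)
    show "integrable M (\<lambda>x. cmod (h x) powr r')" using h r M by (intro bounded_fun_powr_integrable) auto
    show "0 < S powr (1 / r') + e / 2" using e by (intro add_nonneg_pos) auto
    have "S = (S powr (1 / r')) powr r'" using r S0 by (simp add: powr_powr)
    also have "\<dots> \<le> (S powr (1 / r') + e / 2) powr r'" using e r by (intro powr_mono2) auto
    finally show "(\<integral>x. cmod (h x) powr r' \<partial>M) \<le> (S powr (1 / r') + e / 2) powr r'" by (simp add: S_def)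
  qed
  then show "cmod (\<integral>x. h x * f x \<partial>M) \<le> 2 * (\<integral>x. cmod (h x) powr r' \<partial>M) powr (1 / r') + e"
    by (simp add: S_def)
qed

text \<open>The equality case of Hoelder's inequality: the conjugate phase of \<open>h\<close> times
  |h|^(r'-1), where (r'-1) r = r'. The pairing carries no conjugation, so the phase is conjugated
  here. Scaling by S^(-1/r) puts the function on the unit sphere.\<close>

lemma norming_function:
  assumes r: "1 < r" "1 < r'" "1 / r + 1 / r' = 1" and M: "finite_measure M" and h: "bounded_fun M h"
  shows "\<exists>f\<in>lball M r. (\<integral>x. h x * f x \<partial>M) = of_real ((\<integral>x. cmod (h x) powr r' \<partial>M) powr (1 / r'))"
proof -
  define S where "S = (\<integral>x. cmod (h x) powr r' \<partial>M)"
  have S0: "0 \<le> S" unfolding S_def by (rule Bochner_Integration.integral_nonneg) simp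
  show ?thesis
  proof (cases "S = 0")
    case True
    have "(\<integral>x. h x * 0 \<partial>M) = of_real (S powr (1 / r'))" using True by simp
    then show ?thesis using lball_zero[of M r] by (auto simp: S_def intro!: bexI[of _ "\<lambda>x. 0"])
  next
    case False
    then have S: "0 < S" using S0 by simp
    define c where "c = S powr (- (1 / r))"
    define f where "f x = of_real c * (cnj (sgn (h x)) * of_real (cmod (h x) powr (r' - 1)))" for x
    have hm: "h \<in> borel_measurable M" using h by (rule bounded_fun_measurable)
    have r'r: "(r' - 1) * r = r'" using r by (simp add: field_simps)
    have cf: "cmod (f x) = c * cmod (h x) powr (r' - 1)" for x
      using r by (cases "h x = 0") (auto simp: f_def norm_mult norm_sgn c_def)
    obtain K where K: "\<And>x. x \<in> space M \<Longrightarrow> cmod (h x) \<le> K" using h by (auto simp: bounded_fun_def)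
    have fm: "f \<in> borel_measurable M"
    proof -
      have "cnj \<in> borel_measurable borel" by (intro borel_measurable_continuous_onI continuous_intros)
      then have "(\<lambda>x. cnj (sgn (h x))) \<in> borel_measurable M" using hm by measurable
      then show ?thesis unfolding f_def using hm by measurable
    qed
    have fb: "bounded_fun M f"
      unfolding bounded_fun_def using fm K r
      by (auto simp: cf c_def intro!: exI[of _ "c * K powr (r' - 1)"] mult_left_mono powr_mono2)
    have "cmod (f x) powr r = (1 / S) * cmod (h x) powr r'" for x
    proof -
      have "cmod (f x) powr r = c powr r * (cmod (h x) powr (r' - 1)) powr r"
        unfolding cf by (rule powr_mult)
      moreover have "c powr r = 1 / S"
      proof -
        have "- (1 / r) * r = -1" using r by simp
        then show ?thesis using S unfolding c_def powr_powr by (simp only:) (simp add: powr_minus_divide)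
      qed
      ultimately show ?thesis using r'r by (simp add: powr_powr)
    qed
    then have "(\<integral>x. cmod (f x) powr r \<partial>M) = 1" using S by (simp add: S_def)
    then have fl: "f \<in> lball M r" using fb by (simp add: lball_iff)
    have "h x * f x = of_real (c * cmod (h x) powr r')" for x
    proof (cases "h x = 0")
      case False
      have "h x * cnj (sgn (h x)) = of_real (cmod (h x))"
        using False complex_norm_square[of "h x"]
        by (simp add: sgn_div_norm scaleR_conv_of_real field_simps power2_eq_square)
      then have "h x * f x = of_real (c * (cmod (h x) * cmod (h x) powr (r' - 1)))"
        by (simp add: f_def algebra_simps)
      also have "cmod (h x) * cmod (h x) powr (r' - 1) = cmod (h x) powr r'"
        using False by (simp add: powr_mult_base)
      finally show ?thesis .
    qed (simp add: f_def)
    then have "(\<integral>x. h x * f x \<partial>M) = of_real (c * S)" by (simp add: S_def)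
    also have "c * S = S powr (1 / r')"
    proof -
      have "c * S = S powr (- (1 / r)) * S powr 1" using S by (simp add: c_def)
      also have "\<dots> = S powr (- (1 / r) + 1)" by (rule powr_add[symmetric])
      also have "- (1 / r) + 1 = 1 / r'" using r by linarith
      finally show ?thesis .
    qed
    finally show ?thesis using fl by (auto simp: S_def)
  qed
qed

lemma powr_add_le:
  fixes a b :: real
  assumes "0 \<le> a" "0 \<le> b" "0 \<le> r"
  shows "(a + b) powr r \<le> 2 powr r * (a powr r + b powr r)"
proof -
  have "(a + b) powr r \<le> (2 * max a b) powr r" using assms by (intro powr_mono2) auto
  also have "\<dots> = 2 powr r * (max a b) powr r" using assms by (simp add: powr_mult)
  also have "(max a b) powr r \<le> a powr r + b powr r" by (auto simp: max_def)
  finally show ?thesis by (simp add: mult_left_mono)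
qed

lemma norm_add_powr_le:
  assumes "0 \<le> r"
  shows "cmod (a + b) powr r \<le> 2 powr r * (cmod a powr r + cmod b powr r)"
  using powr_add_le[of "cmod a" "cmod b" r] powr_mono2[OF assms norm_ge_zero norm_triangle_ineq[of a b]] assms
  by simp

text \<open>A sum is at most its number of terms times its maximum. This crude form holds on both
  sides of t = 1, which matters since it is applied with quotients of exponents such as
  q/p'.\<close>

lemma powr_sum_le:
  fixes a :: "'i \<Rightarrow> real"
  assumes I: "finite I" and a: "\<And>i. i \<in> I \<Longrightarrow> 0 \<le> a i" and t: "0 < t"
  shows "(\<Sum>i\<in>I. a i) powr t \<le> real (card I) powr t * (\<Sum>i\<in>I. a i powr t)"
proof (cases "I = {}")
  case False
  define m where "m = Max (a ` I)"
  have "m \<in> a ` I" using I False unfolding m_def by (intro Max_in) auto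
  then obtain k where k: "k \<in> I" "m = a k" by auto
  have "(\<Sum>i\<in>I. a i) \<le> (\<Sum>i\<in>I. m)" using I by (intro sum_mono) (auto simp: m_def)
  then have "(\<Sum>i\<in>I. a i) powr t \<le> (card I * m) powr t" using t a by (intro powr_mono2 sum_nonneg) auto
  also have "\<dots> = card I powr t * m powr t" using k a by (simp add: powr_mult)
  also have "m powr t \<le> (\<Sum>i\<in>I. a i powr t)"
    unfolding k(2) by (rule member_le_sum[of k I "\<lambda>i. a i powr t"]) (use k I in auto)
  finally show ?thesis by (simp add: mult_left_mono)
qed simp

text \<open>The recursion records what one induction step of
  \<open>norming_functions_of_span\<close> costs: quasi-triangle inequalities give powers of 2, and
  4^r combines one of them with the factor 2 in the pairing bound.\<close>

primrec span_const :: "real \<Rightarrow> nat \<Rightarrow> real" where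
  "span_const r 0 = 0"
| "span_const r (Suc n) = 2 powr r * (1 + span_const r n * (1 + real n) * 4 powr r)"

lemma span_const_nonneg: "0 \<le> span_const r n"
  by (induction n) auto

text \<open>
  Induction on the number of spanning functions: subtracting multiples of one spanning function moves
  the others into the kernel of its norming functional.
\<close>

lemma norming_functions_of_span:
  fixes h :: "'i \<Rightarrow> 'a \<Rightarrow> complex"
  assumes r: "1 < r" "1 < r'" "1 / r + 1 / r' = 1" and M: "finite_measure M"
    and I: "finite I" and h: "\<And>i. i \<in> I \<Longrightarrow> bounded_fun M (h i)"
  shows "\<exists>f. (\<forall>i\<in>I. f i \<in> lball M r) \<and>
    (\<forall>c. (\<integral>x. cmod (\<Sum>i\<in>I. c i * h i x) powr r' \<partial>M) \<le>
      span_const r' (card I) * (\<Sum>i\<in>I. cmod (\<integral>x. (\<Sum>j\<in>I. c j * h j x) * f i x \<partial>M) powr r'))"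
  using I h
proof (induction I arbitrary: h rule: finite_induct)
  case empty
  then show ?case by simp
next
  case (insert k I)
  define S where "S = (\<integral>x. cmod (h k x) powr r' \<partial>M)"
  define T where "T = S powr (1 / r')"
  have S0: "0 \<le> S" unfolding S_def by (rule Bochner_Integration.integral_nonneg) simp
  have T0: "0 \<le> T" and TS: "T powr r' = S" using S0 r by (auto simp: T_def powr_powr)
  have hb: "bounded_fun M (h i)" if "i \<in> insert k I" for i using insert.prems that .
  obtain f1 where f1: "f1 \<in> lball M r" "(\<integral>x. h k x * f1 x \<partial>M) = of_real T"
    using norming_function[OF r M hb[of k]] by (auto simp: T_def S_def)
  have int: "integrable M (\<lambda>x. g x * f x)" if "bounded_fun M g" "f \<in> lball M r" for g f
    using that M by (auto simp: lball_iff intro!: bounded_fun_integrable bounded_fun_mult)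
  \<comment> \<open>With this coefficient \<open>f1\<close> annihilates \<open>h' j\<close>. If
    \<open>T = 0\<close>, division by zero gives 0; then the only consequence drawn, |\<beta>| T
    \<le> a, is trivial.\<close>
  define \<alpha> where "\<alpha> j = (\<integral>x. h j x * f1 x \<partial>M) / of_real T" for j
  define h' where "h' j x = h j x - \<alpha> j * h k x" for j x
  have h'b: "bounded_fun M (h' j)" if "j \<in> I" for j
    unfolding h'_def using that by (intro bounded_fun_diff bounded_fun_cmult hb) auto
  obtain f where f: "\<And>i. i \<in> I \<Longrightarrow> f i \<in> lball M r"
    and fle: "\<And>c. (\<integral>x. cmod (\<Sum>i\<in>I. c i * h' i x) powr r' \<partial>M) \<le>
      span_const r' (card I) * (\<Sum>i\<in>I. cmod (\<integral>x. (\<Sum>j\<in>I. c j * h' j x) * f i x \<partial>M) powr r')"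
    using insert.IH[of h'] h'b by blast
  define F where "F i = (if i = k then f1 else f i)" for i
  have FI: "F i = f i" if "i \<in> I" for i using that insert.hyps by (auto simp: F_def)
  show ?case
  proof (intro exI conjI ballI allI)
    show "F i \<in> lball M r" if "i \<in> insert k I" for i using that f f1 by (auto simp: F_def)
    fix c :: "'i \<Rightarrow> complex"
    define g where "g x = (\<Sum>j\<in>insert k I. c j * h j x)" for x
    define g' where "g' x = (\<Sum>j\<in>I. c j * h' j x)" for x
    \<comment> \<open>The coefficient of \<open>h k\<close> once the combination is rewritten in
      terms of the corrected functions \<open>h' j\<close>.\<close>
    define \<beta> where "\<beta> = c k + (\<Sum>j\<in>I. c j * \<alpha> j)"
    have geq: "g x = \<beta> * h k x + g' x" for x
    proof -
      have "g' x = (\<Sum>j\<in>I. c j * h j x) - (\<Sum>j\<in>I. c j * \<alpha> j) * h k x"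
        by (simp add: g'_def h'_def right_diff_distrib sum_subtractf sum_distrib_right mult.assoc)
      then show ?thesis using insert.hyps by (simp add: g_def \<beta>_def algebra_simps)
    qed
    have gb: "bounded_fun M g" unfolding g_def by (intro bounded_fun_sum bounded_fun_cmult hb)
    have g'b: "bounded_fun M g'" unfolding g'_def by (intro bounded_fun_sum bounded_fun_cmult h'b)
    have pair: "(\<integral>x. g x * \<phi> x \<partial>M) = \<beta> * (\<integral>x. h k x * \<phi> x \<partial>M) + (\<integral>x. g' x * \<phi> x \<partial>M)"
      if "\<phi> \<in> lball M r" for \<phi>
      using int[OF hb that] int[OF g'b that] by (simp add: geq distrib_right mult.assoc)
    define a where "a = cmod (\<integral>x. g x * f1 x \<partial>M)"
    have \<beta>T: "cmod \<beta> * T \<le> a"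
    proof (cases "T = 0")
      case False
      have "(\<integral>x. h' j x * f1 x \<partial>M) = 0" if "j \<in> I" for j
        using int[OF hb f1(1), of j] int[OF hb f1(1), of k] that False
        by (simp add: h'_def left_diff_distrib mult.assoc f1(2) \<alpha>_def)
      moreover have "(\<integral>x. g' x * f1 x \<partial>M) = (\<Sum>j\<in>I. c j * (\<integral>x. h' j x * f1 x \<partial>M))"
        using int[OF h'b f1(1)] by (simp add: g'_def sum_distrib_right mult.assoc)
      ultimately have "(\<integral>x. g x * f1 x \<partial>M) = \<beta> * of_real T"
        using pair[OF f1(1)] f1(2) by simp
      then show ?thesis using T0 by (simp add: a_def norm_mult)
    qed (simp add: a_def)
    \<comment> \<open>Pairing with \<open>f i\<close> sees g' only through g - \<beta>
      \<open>h k\<close>. The error is at most 2 |\<beta>| T by the pairing bound, and |\<beta>| T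
      is at most \<open>a\<close>, the pairing of g with \<open>f1\<close>.\<close>
    have 1: "cmod (\<integral>x. g' x * f i x \<partial>M) powr r' \<le> 2 powr r' * (cmod (\<integral>x. g x * f i x \<partial>M) powr r' + (2 * a) powr r')"
      if i: "i \<in> I" for i
    proof -
      have "cmod (\<beta> * (\<integral>x. h k x * f i x \<partial>M)) \<le> cmod \<beta> * (2 * T)"
        using lball_pairing_le'[OF r f[OF i] M hb[of k]] by (auto simp: norm_mult T_def S_def intro!: mult_left_mono)
      also have "\<dots> \<le> 2 * a" using \<beta>T by simp
      finally have 2: "cmod (\<beta> * (\<integral>x. h k x * f i x \<partial>M)) \<le> 2 * a" .
      have "(\<integral>x. g' x * f i x \<partial>M) = (\<integral>x. g x * f i x \<partial>M) + - (\<beta> * (\<integral>x. h k x * f i x \<partial>M))"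
        using pair[OF f[OF i]] by simp
      then have "cmod (\<integral>x. g' x * f i x \<partial>M) powr r' \<le>
          2 powr r' * (cmod (\<integral>x. g x * f i x \<partial>M) powr r' + cmod (- (\<beta> * (\<integral>x. h k x * f i x \<partial>M))) powr r')"
        using norm_add_powr_le[of r' "\<integral>x. g x * f i x \<partial>M" "- (\<beta> * (\<integral>x. h k x * f i x \<partial>M))"] r
        by (simp del: norm_minus_cancel)
      also have "\<dots> \<le> 2 powr r' * (cmod (\<integral>x. g x * f i x \<partial>M) powr r' + (2 * a) powr r')"
        using 2 r by (intro mult_left_mono add_left_mono powr_mono2) auto
      finally show ?thesis .
    qed
    define C where "C = span_const r' (card I)"
    have C0: "0 \<le> C" unfolding C_def by (rule span_const_nonneg)
    have "(\<integral>x. cmod (g x) powr r' \<partial>M) \<le> (\<integral>x. 2 powr r' * (cmod \<beta> powr r' * cmod (h k x) powr r' + cmod (g' x) powr r') \<partial>M)"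
    proof (rule Bochner_Integration.integral_mono)
      show "integrable M (\<lambda>x. cmod (g x) powr r')" using r by (intro bounded_fun_powr_integrable M gb) auto
      show "integrable M (\<lambda>x. 2 powr r' * (cmod \<beta> powr r' * cmod (h k x) powr r' + cmod (g' x) powr r'))"
        using bounded_fun_powr_integrable[OF M g'b, of r'] bounded_fun_powr_integrable[OF M hb[of k], of r'] r by simp
      show "cmod (g x) powr r' \<le> 2 powr r' * (cmod \<beta> powr r' * cmod (h k x) powr r' + cmod (g' x) powr r')" for x
        using norm_add_powr_le[of r' "\<beta> * h k x" "g' x"] r by (simp add: geq norm_mult powr_mult)
    qed
    also have "\<dots> = 2 powr r' * (cmod \<beta> powr r' * S + (\<integral>x. cmod (g' x) powr r' \<partial>M))"
      using bounded_fun_powr_integrable[OF M g'b, of r'] bounded_fun_powr_integrable[OF M hb[of k], of r'] r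
      by (simp add: S_def)
    also have "cmod \<beta> powr r' * S = (cmod \<beta> * T) powr r'"
      using T0 by (simp add: powr_mult TS)
    also have "(\<integral>x. cmod (g' x) powr r' \<partial>M) \<le> C * (\<Sum>i\<in>I. cmod (\<integral>x. g' x * f i x \<partial>M) powr r')"
      using fle[of c] by (simp add: g'_def C_def)
    also have "\<dots> \<le> C * (\<Sum>i\<in>I. 2 powr r' * (cmod (\<integral>x. g x * f i x \<partial>M) powr r' + (2 * a) powr r'))"
      by (intro mult_left_mono sum_mono 1 C0)
    also have "(cmod \<beta> * T) powr r' \<le> a powr r'"
      using \<beta>T T0 r by (intro powr_mono2) auto
    finally have "(\<integral>x. cmod (g x) powr r' \<partial>M) \<le>
       2 powr r' * (a powr r' + C * (\<Sum>i\<in>I. 2 powr r' * (cmod (\<integral>x. g x * f i x \<partial>M) powr r' + (2 * a) powr r')))"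
      by (simp add: mult_left_mono)
    also have "\<dots> = 2 powr r' * (1 + C * real (card I) * 4 powr r') * a powr r' +
        2 powr r' * (C * 2 powr r') * (\<Sum>i\<in>I. cmod (\<integral>x. g x * f i x \<partial>M) powr r')"
    proof -
      have "(4::real) powr r' = 2 powr r' * 2 powr r'" by (simp add: powr_mult[symmetric])
      moreover have "(2 * a) powr r' = 2 powr r' * a powr r'" by (simp add: powr_mult a_def)
      ultimately show ?thesis
        by (simp add: sum_distrib_left[symmetric] sum.distrib) (simp add: algebra_simps)
    qed
    also have "\<dots> \<le> span_const r' (Suc (card I)) * a powr r' + span_const r' (Suc (card I)) * (\<Sum>i\<in>I. cmod (\<integral>x. g x * f i x \<partial>M) powr r')"
    proof (intro add_mono mult_right_mono)
      show "2 powr r' * (1 + C * real (card I) * 4 powr r') \<le> span_const r' (Suc (card I))"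
        using C0 by (simp add: C_def[symmetric] algebra_simps)
      have "C * 2 powr r' \<le> C * ((1 + real (card I)) * 4 powr r')"
      proof (rule mult_left_mono[OF _ C0])
        have "(2::real) powr r' \<le> 4 powr r'" using r by (intro powr_mono2) auto
        also have "\<dots> \<le> (1 + real (card I)) * 4 powr r'" by simp
        finally show "2 powr r' \<le> (1 + real (card I)) * 4 powr r'" .
      qed
      then show "2 powr r' * (C * 2 powr r') \<le> span_const r' (Suc (card I))"
        by (simp add: C_def[symmetric] mult.assoc)
    qed (auto intro: sum_nonneg)
    also have "\<dots> = span_const r' (card (insert k I)) * (\<Sum>i\<in>insert k I. cmod (\<integral>x. g x * F i x \<partial>M) powr r')"
    proof -
      have "(\<Sum>i\<in>insert k I. cmod (\<integral>x. g x * F i x \<partial>M) powr r') =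
         a powr r' + (\<Sum>i\<in>I. cmod (\<integral>x. g x * f i x \<partial>M) powr r')"
        using insert.hyps FI by (simp add: a_def F_def[of k])
      then show ?thesis using insert.hyps by (simp add: distrib_left del: span_const.simps)
    qed
    finally show "(\<integral>x. cmod (\<Sum>i\<in>insert k I. c i * h i x) powr r' \<partial>M) \<le>
      span_const r' (card (insert k I)) * (\<Sum>i\<in>insert k I. cmod (\<integral>x. (\<Sum>j\<in>insert k I. c j * h j x) * F i x \<partial>M) powr r')"
      by (simp add: g_def)
  qed
qed

lemma ennreal_powr_ennreal: "0 \<le> a \<Longrightarrow> ennreal_powr (ennreal a) t = ennreal (a powr t)"
  by (simp add: ennreal_powr_def)

text \<open>The power t/r converts the spanning estimate from exponent r to exponent t and includes
  the loss for the power of a sum; the last factor n counts the norming functions.\<close>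

definition mixed_norm_const :: "nat \<Rightarrow> real \<Rightarrow> real \<Rightarrow> real" where
  "mixed_norm_const n r t = (span_const r n * real n) powr (t / r) * real n"

text \<open>For each x the slice \<open>K (x, \<cdot>)\<close> lies in the span of the
  \<open>h i\<close>, with coefficients \<open>g i x\<close>. The norming functions serve all
  coefficients at once, so they do not depend on x: the inner norm is controlled by finitely many
  functions \<phi> i, the images of fixed test functions. Each has L^s' norm at most A, as one sees
  by norming it with some \<psi>.\<close>

lemma finite_rank_mixed_norm:
  fixes g h :: "'i \<Rightarrow> 'a \<Rightarrow> complex"
  assumes r: "1 < r" "1 < r'" "1 / r + 1 / r' = 1" and s: "1 < s" "1 < s'" "1 / s + 1 / s' = 1"
    and M: "finite_measure M" and I: "finite I"
    and g: "\<And>i. i \<in> I \<Longrightarrow> bounded_fun M (g i)" and h: "\<And>i. i \<in> I \<Longrightarrow> bounded_fun M (h i)"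
    and K: "\<And>x y. K (x, y) = (\<Sum>i\<in>I. g i x * h i y)"
    and bound: "form_bound M r s A K"
  shows "(\<integral>\<^sup>+x. ennreal_powr (\<integral>\<^sup>+y. ennreal (cmod (K (x, y)) powr r') \<partial>M) (s' / r') \<partial>M)
    \<le> ennreal (mixed_norm_const (card I) r' s' * A powr s')"
proof -
  interpret M: finite_measure M by (rule M)
  interpret MM: pair_sigma_finite M M ..
  obtain f where f: "\<And>i. i \<in> I \<Longrightarrow> f i \<in> lball M r"
    and fle: "\<And>c. (\<integral>x. cmod (\<Sum>i\<in>I. c i * h i x) powr r' \<partial>M) \<le>
      span_const r' (card I) * (\<Sum>i\<in>I. cmod (\<integral>x. (\<Sum>j\<in>I. c j * h j x) * f i x \<partial>M) powr r')"
    using norming_functions_of_span[OF r M I, of h] h by blast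
  define \<phi> where "\<phi> i x = (\<integral>y. K (x, y) * f i y \<partial>M)" for i x
  have int: "integrable M (\<lambda>x. h j x * f i x)" if "i \<in> I" "j \<in> I" for i j
    using that h f M by (auto simp: lball_iff intro!: bounded_fun_integrable bounded_fun_mult)
  have \<phi>b: "bounded_fun M (\<phi> i)" if i: "i \<in> I" for i
  proof -
    have "\<phi> i x = (\<Sum>j\<in>I. (\<integral>y. h j y * f i y \<partial>M) * g j x)" for x
      using int[OF i] by (simp add: \<phi>_def K sum_distrib_right mult.assoc mult.commute[of "g _ x"])
         (simp add: mult.assoc[symmetric])
    then have "\<phi> i = (\<lambda>x. \<Sum>j\<in>I. (\<integral>y. h j y * f i y \<partial>M) * g j x)" by blast
    then show ?thesis using g by (simp add: bounded_fun_sum bounded_fun_cmult)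
  qed
  have \<phi>A: "(\<integral>x. cmod (\<phi> i x) powr s' \<partial>M) \<le> A powr s'" if i: "i \<in> I" for i
  proof -
    define S where "S = (\<integral>x. cmod (\<phi> i x) powr s' \<partial>M)"
    have S0: "0 \<le> S" unfolding S_def by (rule Bochner_Integration.integral_nonneg) simp
    obtain \<psi> where \<psi>: "\<psi> \<in> lball M s" "(\<integral>x. \<phi> i x * \<psi> x \<partial>M) = of_real (S powr (1 / s'))"
      using norming_function[OF s M \<phi>b[OF i]] by (auto simp: S_def)
    have "integrable (M \<Otimes>\<^sub>M M) (\<lambda>z. K z * (\<psi> (fst z) * f i (snd z)))"
      using bound \<psi>(1) f[OF i] by (auto simp: form_bound_def intro: integrable_form)
    then have "(\<integral>x. (\<integral>y. K (x, y) * (\<psi> x * f i y) \<partial>M) \<partial>M) = (\<integral>z. K z * (\<psi> (fst z) * f i (snd z)) \<partial>(M \<Otimes>\<^sub>M M))"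
      using MM.integral_fst'[of "\<lambda>z. K z * (\<psi> (fst z) * f i (snd z))"] by simp
    moreover have "(\<integral>y. K (x, y) * (\<psi> x * f i y) \<partial>M) = \<phi> i x * \<psi> x" for x
    proof -
      have "(\<lambda>y. K (x, y) * (\<psi> x * f i y)) = (\<lambda>y. (K (x, y) * f i y) * \<psi> x)" by (simp add: mult_ac)
      then show ?thesis by (simp add: \<phi>_def)
    qed
    ultimately have "of_real (S powr (1 / s')) = (\<integral>z. K z * (\<psi> (fst z) * f i (snd z)) \<partial>(M \<Otimes>\<^sub>M M))"
      using \<psi>(2) by simp
    then have "cmod (of_real (S powr (1 / s'))) \<le> A"
      using bound \<psi>(1) f[OF i] by (simp add: form_bound_def)
    then have "(S powr (1 / s')) powr s' \<le> A powr s'" using s by (intro powr_mono2) auto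
    then show ?thesis using s S0 by (simp add: powr_powr S_def)
  qed
  define C where "C = (span_const r' (card I) * real (card I)) powr (s' / r')"
  have inner: "ennreal_powr (\<integral>\<^sup>+y. ennreal (cmod (K (x, y)) powr r') \<partial>M) (s' / r') \<le>
      ennreal (C * (\<Sum>i\<in>I. cmod (\<phi> i x) powr s'))" for x
  proof -
    have Kb: "bounded_fun M (\<lambda>y. K (x, y))" unfolding K by (intro bounded_fun_sum bounded_fun_cmult h)
    define N where "N = (\<integral>y. cmod (K (x, y)) powr r' \<partial>M)"
    have N0: "0 \<le> N" unfolding N_def by (rule Bochner_Integration.integral_nonneg) simp
    have 1: "(\<integral>\<^sup>+y. ennreal (cmod (K (x, y)) powr r') \<partial>M) = ennreal N"
      unfolding N_def using r by (intro nn_integral_eq_integral bounded_fun_powr_integrable M Kb) auto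
    have "N \<le> span_const r' (card I) * (\<Sum>i\<in>I. cmod (\<phi> i x) powr r')"
      using fle[of "\<lambda>i. g i x"] by (simp add: N_def \<phi>_def K)
    then have "N powr (s' / r') \<le> (span_const r' (card I) * (\<Sum>i\<in>I. cmod (\<phi> i x) powr r')) powr (s' / r')"
      using N0 r s by (intro powr_mono2) auto
    also have "\<dots> = span_const r' (card I) powr (s' / r') * (\<Sum>i\<in>I. cmod (\<phi> i x) powr r') powr (s' / r')"
      by (rule powr_mult)
    also have "\<dots> \<le> span_const r' (card I) powr (s' / r') *
        (real (card I) powr (s' / r') * (\<Sum>i\<in>I. (cmod (\<phi> i x) powr r') powr (s' / r')))"
      using r s by (intro mult_left_mono powr_sum_le I) auto
    also have "\<dots> = C * (\<Sum>i\<in>I. cmod (\<phi> i x) powr s')"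
      using r by (simp add: C_def powr_mult span_const_nonneg powr_powr)
    finally have "N powr (s' / r') \<le> C * (\<Sum>i\<in>I. cmod (\<phi> i x) powr s')" .
    then show ?thesis using N0 by (simp add: 1 ennreal_powr_ennreal ennreal_leI)
  qed
  have "(\<integral>\<^sup>+x. ennreal_powr (\<integral>\<^sup>+y. ennreal (cmod (K (x, y)) powr r') \<partial>M) (s' / r') \<partial>M) \<le>
      (\<integral>\<^sup>+x. ennreal (C * (\<Sum>i\<in>I. cmod (\<phi> i x) powr s')) \<partial>M)"
    by (intro nn_integral_mono inner)
  also have "\<dots> = ennreal (\<integral>x. C * (\<Sum>i\<in>I. cmod (\<phi> i x) powr s') \<partial>M)"
    using s by (intro nn_integral_eq_integral)
      (auto intro!: bounded_fun_powr_integrable M \<phi>b mult_nonneg_nonneg sum_nonneg simp: C_def)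
  also have "(\<integral>x. C * (\<Sum>i\<in>I. cmod (\<phi> i x) powr s') \<partial>M) = C * (\<Sum>i\<in>I. \<integral>x. cmod (\<phi> i x) powr s' \<partial>M)"
    using s by (subst Bochner_Integration.integral_sum[symmetric])
      (auto intro!: bounded_fun_powr_integrable M \<phi>b)
  also have "\<dots> \<le> C * (\<Sum>i\<in>I. A powr s')"
    by (intro mult_left_mono sum_mono \<phi>A) (auto simp: C_def)
  finally show ?thesis
    by (simp add: mixed_norm_const_def C_def ennreal_leI mult.assoc)
qed

subsection \<open>Local integrability of the Riesz kernel and iterated integrals\<close>

lemma emeasure_lebesgue_ball:
  "0 \<le> r \<Longrightarrow> emeasure lebesgue (ball c r :: 'a::euclidean_space set) = ennreal (unit_ball_vol (real DIM('a)) * r ^ DIM('a))"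
  by (simp add: emeasure_ball)

lemma dyadic_scale:
  assumes "0 < t" "t < (1::real)"
  shows "\<exists>j. (1/2) ^ Suc j \<le> t \<and> t < (1/2) ^ j"
proof -
  obtain n where n: "(1/2 :: real) ^ n < t" using assms real_arch_pow_inv[of t "1/2"] by auto
  define m where "m = (LEAST n. (1/2 :: real) ^ n \<le> t)"
  have m: "(1/2 :: real) ^ m \<le> t" unfolding m_def by (rule LeastI[of _ n]) (use n in simp)
  then have "m \<noteq> 0" using assms by (cases m) auto
  then obtain j where j: "m = Suc j" using not0_implies_Suc by blast
  have "\<not> (1/2 :: real) ^ j \<le> t" using not_less_Least[of j "\<lambda>n. (1/2 :: real) ^ n \<le> t"] by (auto simp: m_def[symmetric] j)
  then show ?thesis using m j by auto
qed

text \<open>On the dyadic shell of radius about R 2^(-j) the kernel is at most \<open>c j\<close>,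
  and it is dominated by the sum of \<open>c j\<close> times indicators of shrinking balls. The
  integrals of these form a geometric series with ratio 2^(\<beta>-d) < 1. The bound is uniform in
  x.\<close>

lemma riesz_kernel_locally_integrable:
  fixes \<beta> R :: real
  assumes \<beta>: "0 < \<beta>" "\<beta> < real CARD('d::finite)" and R: "0 < R"
  shows "\<exists>C::real. \<forall>x::real^'d. (\<integral>\<^sup>+y. ennreal (1 / norm (x - y) powr \<beta>) * indicator (ball x R) y \<partial>lebesgue) \<le> ennreal C"
proof -
  define c where "c j = (2 ^ Suc j / R) powr \<beta>" for j :: nat
  define v where "v j = unit_ball_vol (real CARD('d)) * (R * (1/2) ^ j) ^ CARD('d)" for j :: nat
  define \<rho> where "\<rho> = 2 powr \<beta> * (1/2 :: real) ^ CARD('d)"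
  define D where "D = (2 / R) powr \<beta> * (unit_ball_vol (real CARD('d)) * R ^ CARD('d))"
  have v0: "0 \<le> v j" for j using R by (simp add: v_def)
  have cv: "c j * v j = D * \<rho> ^ j" for j
  proof -
    have "c j = (2 / R) powr \<beta> * (2 powr \<beta>) ^ j"
    proof -
      have "c j = ((2 / R) * 2 ^ j) powr \<beta>" by (simp add: c_def)
      moreover have "(2 ^ j :: real) powr \<beta> = (2 powr \<beta>) ^ j"
        by (simp add: powr_realpow[symmetric] powr_powr mult.commute)
      ultimately show ?thesis by (simp only: powr_mult)
    qed
    moreover have "((1/2 :: real) ^ j) ^ CARD('d) = ((1/2) ^ CARD('d)) ^ j"
      by (metis power_mult mult.commute)
    ultimately show ?thesis
      unfolding v_def D_def \<rho>_def power_mult_distrib by (simp only: mult_ac)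
  qed
  have \<rho>: "0 < \<rho>" "\<rho> < 1"
  proof -
    have "(2 :: real) powr \<beta> < 2 powr real CARD('d)" using \<beta> by simp
    then show "\<rho> < 1" by (simp add: \<rho>_def powr_realpow power_divide)
  qed (simp add: \<rho>_def)
  have "(\<integral>\<^sup>+y. ennreal (1 / norm (x - y) powr \<beta>) * indicator (ball x R) y \<partial>lebesgue) \<le> ennreal (D * (1 / (1 - \<rho>)))" for x :: "real^'d"
  proof -
    have pt: "ennreal (1 / norm (x - y) powr \<beta>) * indicator (ball x R) y \<le>
        (\<Sum>j. ennreal (c j) * indicator (ball x (R * (1/2) ^ j)) y)" for y
    \<comment> \<open>At y = x the kernel has the default value 1/0 = 0, so the singular point falls
      into the trivial case.\<close>
    proof (cases "y \<noteq> x \<and> y \<in> ball x R")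
      case True
      define t where "t = norm (x - y) / R"
      have t: "0 < t" "t < 1" using True R by (auto simp: t_def dist_norm)
      obtain j where j: "(1/2) ^ Suc j \<le> t" "t < (1/2) ^ j" using dyadic_scale[OF t] by blast
      have n0: "0 < norm (x - y)" using True by auto
      have "1 / norm (x - y) \<le> 2 ^ Suc j / R"
        using j(1) R n0 by (simp add: t_def field_simps power_divide)
      then have "(1 / norm (x - y)) powr \<beta> \<le> c j" unfolding c_def using \<beta> by (intro powr_mono2) auto
      then have "1 / norm (x - y) powr \<beta> \<le> c j" by (simp add: powr_divide)
      moreover have "y \<in> ball x (R * (1/2) ^ j)" using j(2) R by (simp add: t_def dist_norm field_simps)
      ultimately have "ennreal (1 / norm (x - y) powr \<beta>) * indicator (ball x R) y \<le>
          ennreal (c j) * indicator (ball x (R * (1/2) ^ j)) y"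
        using True by (simp add: ennreal_leI)
      also have "\<dots> \<le> (\<Sum>j. ennreal (c j) * indicator (ball x (R * (1/2) ^ j)) y)"
      proof -
        have "g j \<le> (\<Sum>j. g j)" for g :: "nat \<Rightarrow> ennreal"
          using sum_le_suminf[OF summableI, of "{j}" g] by simp
        then show ?thesis .
      qed
      finally show ?thesis .
    qed (use \<beta> in auto)
    have "(\<integral>\<^sup>+y. ennreal (1 / norm (x - y) powr \<beta>) * indicator (ball x R) y \<partial>lebesgue) \<le>
        (\<integral>\<^sup>+y. (\<Sum>j. ennreal (c j) * indicator (ball x (R * (1/2) ^ j)) y) \<partial>lebesgue)"
      by (intro nn_integral_mono pt)
    also have "\<dots> = (\<Sum>j. \<integral>\<^sup>+y. ennreal (c j) * indicator (ball x (R * (1/2) ^ j)) y \<partial>lebesgue)"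
      by (intro nn_integral_suminf borel_measurable_times_ennreal borel_measurable_indicator) auto
    also have "\<dots> = (\<Sum>j. ennreal (D * \<rho> ^ j))"
    proof (rule suminf_cong)
      fix j
      have "(\<integral>\<^sup>+y. ennreal (c j) * indicator (ball x (R * (1/2) ^ j)) y \<partial>lebesgue) = ennreal (c j) * emeasure lebesgue (ball x (R * (1/2) ^ j))"
        by (intro nn_integral_cmult_indicator) auto
      also have "\<dots> = ennreal (c j) * ennreal (v j)"
        using R by (subst emeasure_lebesgue_ball) (auto simp: v_def)
      also have "\<dots> = ennreal (D * \<rho> ^ j)"
        by (simp add: ennreal_mult'[symmetric] v0 cv[symmetric] ennreal_mult''[symmetric])
      finally show "(\<integral>\<^sup>+y. ennreal (c j) * indicator (ball x (R * (1/2) ^ j)) y \<partial>lebesgue) = ennreal (D * \<rho> ^ j)" .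
    qed
    also have "\<dots> = ennreal (\<Sum>j. D * \<rho> ^ j)"
      using \<rho> R by (intro suminf_ennreal2) (auto simp: D_def intro!: mult_nonneg_nonneg summable_mult summable_geometric)
    also have "(\<Sum>j. D * \<rho> ^ j) = D * (1 / (1 - \<rho>))"
      using \<rho> by (subst suminf_mult) (auto simp: suminf_geometric summable_geometric)
    finally show ?thesis .
  qed
  then show ?thesis by blast
qed

lemma riesz_kernel_measurable: "(\<lambda>y. 1 / norm (x - y) powr \<beta>) \<in> borel_measurable (lebesgue :: (real^'d) measure)"
proof (rule measurable_completion)
  show "(\<lambda>y. 1 / norm (x - y) powr \<beta>) \<in> borel_measurable (lborel :: (real^'d) measure)" by measurable
qed

lemma riesz_integrand_integrable:
  fixes G :: "real^'d \<Rightarrow> complex^'m"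
  assumes \<alpha>: "0 < \<alpha>" "\<alpha> < real CARD('d)" and E: "bounded E"
    and G: "G \<in> borel_measurable lebesgue" "\<And>y. y \<notin> E \<Longrightarrow> G y = 0" "\<And>y. norm (G y) \<le> c"
  shows "integrable lebesgue (riesz_integrand \<alpha> G x)"
proof -
  obtain r where r: "\<And>y. y \<in> E \<Longrightarrow> norm y \<le> r" using E by (auto simp: bounded_iff)
  define R where "R = max 0 r + norm x + 1"
  have R: "0 < R" by (auto simp: R_def intro!: add_nonneg_pos)
  have EB: "y \<in> ball x R" if "y \<in> E" for y
    using r[OF that] norm_triangle_ineq4[of x y] by (simp add: dist_norm R_def)
  have c0: "0 \<le> c" using G(3)[of 0] norm_ge_zero order_trans by blast
  obtain C where C: "(\<integral>\<^sup>+y. ennreal (1 / norm (x - y) powr (real CARD('d) - \<alpha>)) * indicator (ball x R) y \<partial>lebesgue) \<le> ennreal C"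
    using riesz_kernel_locally_integrable[of "real CARD('d) - \<alpha>" R, where 'd='d] \<alpha> R by auto
  show ?thesis
  proof (rule integrableI_bounded)
    show "riesz_integrand \<alpha> G x \<in> borel_measurable lebesgue"
      unfolding riesz_integrand_def[abs_def]
      using riesz_kernel_measurable[of x "real CARD('d) - \<alpha>"] G(1) by (rule borel_measurable_scaleR)
    have "(\<integral>\<^sup>+y. ennreal (norm (riesz_integrand \<alpha> G x y)) \<partial>lebesgue) \<le>
      (\<integral>\<^sup>+y. ennreal c * (ennreal (1 / norm (x - y) powr (real CARD('d) - \<alpha>)) * indicator (ball x R) y) \<partial>lebesgue)"
    proof (rule nn_integral_mono)
      fix y
      show "ennreal (norm (riesz_integrand \<alpha> G x y)) \<le> ennreal c * (ennreal (1 / norm (x - y) powr (real CARD('d) - \<alpha>)) * indicator (ball x R) y)"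
      proof (cases "y \<in> E")
        case True
        have "norm (riesz_integrand \<alpha> G x y) \<le> c * (1 / norm (x - y) powr (real CARD('d) - \<alpha>))"
          using G(3)[of y] by (simp add: riesz_integrand_def divide_right_mono)
        then show ?thesis using EB[OF True] c0 by (simp add: ennreal_mult'[symmetric] ennreal_leI)
      qed (simp add: riesz_integrand_def G(2))
    qed
    also have "\<dots> = ennreal c * (\<integral>\<^sup>+y. ennreal (1 / norm (x - y) powr (real CARD('d) - \<alpha>)) * indicator (ball x R) y \<partial>lebesgue)"
      by (intro nn_integral_cmult borel_measurable_times_ennreal borel_measurable_indicator
          measurable_compose[OF riesz_kernel_measurable measurable_ennreal]) auto
    also have "\<dots> \<le> ennreal c * ennreal C" using C by (intro mult_left_mono) auto
    also have "\<dots> < \<infinity>" by (simp add: ennreal_mult_less_top)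
    finally show "(\<integral>\<^sup>+y. ennreal (norm (riesz_integrand \<alpha> G x y)) \<partial>lebesgue) < \<infinity>" .
  qed
qed

section \<open>Powers and iterated integrals with values in [0,\<infinity>]\<close>

lemma ennreal_powr_mono: "a \<le> b \<Longrightarrow> 0 \<le> t \<Longrightarrow> ennreal_powr a t \<le> ennreal_powr b t"
  by (auto simp: ennreal_powr_def top_unique enn2real_mono less_top intro!: ennreal_leI powr_mono2)

lemma ennreal_powr_powr:
  assumes "0 < s" "0 < t"
  shows "ennreal_powr (ennreal_powr a s) t = ennreal_powr a (s * t)"
  by (simp add: ennreal_powr_def powr_powr)

lemma ennreal_powr_one: "ennreal_powr a 1 = a"
  by (cases a) (auto simp: ennreal_powr_def)

lemma ennreal_powr_le_iff:
  assumes "0 < t"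
  shows "ennreal_powr a t \<le> b \<longleftrightarrow> a \<le> ennreal_powr b (1 / t)"
proof
  assume "ennreal_powr a t \<le> b"
  then have "ennreal_powr (ennreal_powr a t) (1 / t) \<le> ennreal_powr b (1 / t)"
    using assms by (intro ennreal_powr_mono) auto
  then show "a \<le> ennreal_powr b (1 / t)" using assms by (simp add: ennreal_powr_powr ennreal_powr_one)
next
  assume "a \<le> ennreal_powr b (1 / t)"
  then have "ennreal_powr a t \<le> ennreal_powr (ennreal_powr b (1 / t)) t"
    using assms by (intro ennreal_powr_mono) auto
  then show "ennreal_powr a t \<le> b" using assms by (simp add: ennreal_powr_powr ennreal_powr_one)
qed

lemma ennreal_powr_measurable [measurable]: "(\<lambda>a. ennreal_powr a t) \<in> borel_measurable borel"
  unfolding ennreal_powr_def by measurable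

lemma ennreal_powr_mult:
  assumes "0 \<le> c" "0 < t"
  shows "ennreal_powr (ennreal c * a) t = ennreal (c powr t) * ennreal_powr a t"
proof (cases a)
  case (real x)
  then show ?thesis using assms
    by (simp add: ennreal_mult'[symmetric] ennreal_powr_ennreal powr_mult)
next
  case top
  then show ?thesis using assms
    by (cases "c = 0") (auto simp: ennreal_powr_def ennreal_mult_top)
qed

lemma ennreal_powr_sum_le:
  fixes a :: "'i \<Rightarrow> ennreal"
  assumes I: "finite I" and t: "0 < t"
  shows "ennreal_powr (\<Sum>i\<in>I. a i) t \<le> ennreal (real (card I) powr t) * (\<Sum>i\<in>I. ennreal_powr (a i) t)"
proof (cases "\<exists>i\<in>I. a i = top")
  case True
  then obtain i where i: "i \<in> I" "a i = top" by blast
  have "ennreal_powr (a i) t \<le> (\<Sum>i\<in>I. ennreal_powr (a i) t)"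
    by (rule member_le_sum) (use i I in auto)
  then have "(\<Sum>i\<in>I. ennreal_powr (a i) t) = top" using i by (simp add: ennreal_powr_def top_unique)
  moreover have "0 < real (card I) powr t" using i I by (auto simp: card_gt_0_iff)
  ultimately show ?thesis by (simp add: ennreal_mult_top)
next
  case False
  define b where "b i = enn2real (a i)" for i
  have b: "a i = ennreal (b i)" if "i \<in> I" for i using False that by (auto simp: b_def less_top)
  have b0: "0 \<le> b i" for i by (simp add: b_def)
  have "(\<Sum>i\<in>I. a i) = (\<Sum>i\<in>I. ennreal (b i))" by (intro sum.cong b refl)
  also have "\<dots> = ennreal (\<Sum>i\<in>I. b i)" by (rule sum_ennreal) (rule b0)
  finally have "ennreal_powr (\<Sum>i\<in>I. a i) t = ennreal ((\<Sum>i\<in>I. b i) powr t)"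
    by (simp add: ennreal_powr_ennreal sum_nonneg b0)
  also have "\<dots> \<le> ennreal (real (card I) powr t * (\<Sum>i\<in>I. b i powr t))"
    by (intro ennreal_leI powr_sum_le I b0 t)
  also have "\<dots> = ennreal (real (card I) powr t) * (\<Sum>i\<in>I. ennreal_powr (a i) t)"
  proof -
    have "(\<Sum>i\<in>I. ennreal_powr (a i) t) = (\<Sum>i\<in>I. ennreal (b i powr t))"
      by (intro sum.cong refl) (simp add: b ennreal_powr_ennreal b0)
    also have "\<dots> = ennreal (\<Sum>i\<in>I. b i powr t)" by (rule sum_ennreal) simp
    finally show ?thesis by (simp add: ennreal_mult' sum_nonneg)
  qed
  finally show ?thesis .
qed

text \<open>
  Pulling the power out of the supremum avoids any continuity argument: powers are order isomorphisms
  of \<open>[0,\<infinity>]\<close>.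
\<close>

lemma iterated_integral_exhaustion:
  fixes G :: "'a \<Rightarrow> 'a \<Rightarrow> ennreal"
  assumes N: "sigma_finite_measure N" and G: "case_prod G \<in> borel_measurable (N \<Otimes>\<^sub>M N)"
    and E: "\<And>n. E n \<in> sets N" "incseq E" and ae: "AE x in N. \<exists>n. x \<in> E n" and t: "0 < t"
    and bound: "\<And>n. (\<integral>\<^sup>+x. ennreal_powr (\<integral>\<^sup>+y. G x y * indicator (E n) y \<partial>N) t * indicator (E n) x \<partial>N) \<le> D"
  shows "(\<integral>\<^sup>+x. ennreal_powr (\<integral>\<^sup>+y. G x y \<partial>N) t \<partial>N) \<le> D"
proof -
  interpret sigma_finite_measure N by (rule N)
  define J where "J n x = (\<integral>\<^sup>+y. G x y * indicator (E n) y \<partial>N)" for n x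
  define P where "P n x = ennreal_powr (J n x) t * indicator (E n) x" for n x
  have Em: "E n \<in> sets N" for n by (rule E)
  have ind: "(indicator (E n) y :: ennreal) \<le> indicator (E m) y" if "n \<le> m" for n m y
    using E(2) that by (auto simp: incseq_def indicator_def)
  have Jm: "J n \<in> borel_measurable N" for n
    unfolding J_def using G Em by measurable
  have Pm: "P n \<in> borel_measurable N" for n
    unfolding P_def using Jm Em by measurable
  have Jmono: "J n x \<le> J m x" if "n \<le> m" for n m x
    unfolding J_def using ind[OF that] by (intro nn_integral_mono mult_left_mono) auto
  have Pmono: "P n x \<le> P m x" if "n \<le> m" for n m x
    unfolding P_def using Jmono[OF that] ind[OF that] t by (intro mult_mono ennreal_powr_mono) auto
  have J_SUP: "(\<integral>\<^sup>+y. G x y \<partial>N) \<le> (SUP n. J n x)" if x: "x \<in> space N" for x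
  proof -
    have Gx: "(\<lambda>y. G x y) \<in> borel_measurable N" using G x by measurable
    have "(\<integral>\<^sup>+y. G x y \<partial>N) \<le> (\<integral>\<^sup>+y. (SUP n. G x y * indicator (E n) y) \<partial>N)"
    proof (rule nn_integral_mono_AE, use ae in eventually_elim)
      fix y assume "\<exists>n. y \<in> E n"
      then obtain n where "y \<in> E n" by blast
      then show "G x y \<le> (SUP n. G x y * indicator (E n) y)"
        using SUP_upper[of n UNIV "\<lambda>n. G x y * indicator (E n) y"] by simp
    qed
    also have "\<dots> = (SUP n. J n x)" unfolding J_def
      using Gx Em ind by (intro nn_integral_monotone_convergence_SUP) (auto simp: incseq_def le_fun_def intro!: mult_left_mono)
    finally show ?thesis .
  qed
  have "(\<integral>\<^sup>+x. ennreal_powr (\<integral>\<^sup>+y. G x y \<partial>N) t \<partial>N) \<le> (\<integral>\<^sup>+x. (SUP n. P n x) \<partial>N)"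
  proof (rule nn_integral_mono_AE, use ae AE_space in eventually_elim)
    fix x assume "\<exists>n. x \<in> E n" and x: "x \<in> space N"
    then obtain k where k: "x \<in> E k" by blast
    have "J n x \<le> ennreal_powr (SUP n. P n x) (1 / t)" for n
    proof -
      \<comment> \<open>Both variables are cut off by the same set, so the index is raised until x
        belongs to it and the outer indicator equals 1.\<close>
      have "J n x \<le> J (max n k) x" by (rule Jmono) simp
      also have "J (max n k) x \<le> ennreal_powr (SUP n. P n x) (1 / t)"
      proof (subst ennreal_powr_le_iff[OF t, symmetric])
        have "x \<in> E (max n k)" using k E(2) by (metis incseqD max.cobounded2 subsetD)
        then have "ennreal_powr (J (max n k) x) t = P (max n k) x" by (simp add: P_def)
        then show "ennreal_powr (J (max n k) x) t \<le> (SUP n. P n x)" by (metis SUP_upper UNIV_I)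
      qed
      finally show ?thesis .
    qed
    then have "(SUP n. J n x) \<le> ennreal_powr (SUP n. P n x) (1 / t)" by (rule SUP_least)
    then show "ennreal_powr (\<integral>\<^sup>+y. G x y \<partial>N) t \<le> (SUP n. P n x)"
      using J_SUP[OF x] by (subst ennreal_powr_le_iff[OF t]) (rule order_trans)
  qed
  also have "\<dots> = (SUP n. \<integral>\<^sup>+x. P n x \<partial>N)"
    using Pm Pmono by (intro nn_integral_monotone_convergence_SUP) (auto simp: incseq_def le_fun_def)
  also have "\<dots> \<le> D" using bound by (intro SUP_least) (simp add: P_def J_def)
  finally show ?thesis .
qed

text \<open>The form is symmetric in its two arguments up to exchanging the exponents. The estimate
  with the reversed order of integration thus needs no second study of the operator.\<close>

lemma form_bound_swap:
  assumes M: "finite_measure M" and K: "form_bound M r s A K"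
  shows "form_bound M s r A (\<lambda>z. K (snd z, fst z))"
proof -
  interpret finite_measure M by (rule M)
  interpret MM: pair_sigma_finite M M ..
  have i: "integrable (M \<Otimes>\<^sub>M M) K" using K by (simp add: form_bound_def)
  have "integrable (M \<Otimes>\<^sub>M M) (\<lambda>z. K (snd z, fst z))"
    using MM.integrable_product_swap[OF i] by (simp add: case_prod_beta')
  moreover have "cmod (\<integral>z. K (snd z, fst z) * (\<psi> (fst z) * f (snd z)) \<partial>(M \<Otimes>\<^sub>M M)) \<le> A"
    if \<psi>: "\<psi> \<in> lball M r" and f: "f \<in> lball M s" for \<psi> f
  proof -
    let ?H = "\<lambda>z. K z * (f (fst z) * \<psi> (snd z))"
    have "integrable (M \<Otimes>\<^sub>M M) ?H" by (rule integrable_form[OF i f \<psi>])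
    then have "(\<integral>z. ?H (snd z, fst z) \<partial>(M \<Otimes>\<^sub>M M)) = (\<integral>z. ?H z \<partial>(M \<Otimes>\<^sub>M M))"
      using MM.integral_product_swap[of ?H] by (simp add: case_prod_beta')
    moreover have "cmod (\<integral>z. ?H z \<partial>(M \<Otimes>\<^sub>M M)) \<le> A" using K \<psi> f by (simp add: form_bound_def)
    ultimately show ?thesis by (simp add: mult_ac)
  qed
  ultimately show ?thesis by (simp add: form_bound_def)
qed

subsection \<open>The commutator on a set where all data are bounded\<close>

lemma borel_measurable_entry:
  fixes f :: "'a \<Rightarrow> complex^'n^'m"
  assumes "f \<in> borel_measurable N"
  shows "(\<lambda>x. f x $ i $ j) \<in> borel_measurable N"
proof -
  have "(\<lambda>A :: complex^'n^'m. A $ i $ j) \<in> borel_measurable borel"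
    by (intro borel_measurable_continuous_onI continuous_intros)
  from measurable_compose[OF assms this] show ?thesis .
qed

lemma norm_vec_le_sum: "norm (v :: 'a::real_normed_vector^'n) \<le> (\<Sum>i\<in>UNIV. norm (v $ i))"
  unfolding norm_vec_def by (intro L2_set_le_sum) auto

lemma norm_mult_le_abs: "cmod x \<le> c \<Longrightarrow> cmod y \<le> d \<Longrightarrow> cmod (x * y) \<le> \<bar>c\<bar> * \<bar>d\<bar>"
  unfolding norm_mult by (intro mult_mono) auto

lemma matrix_vector_mult_axis: "(X *v axis b t) $ a = X $ a $ b * (t :: complex)"
proof -
  have "(X *v axis b t) $ a = (\<Sum>j\<in>UNIV. if j = b then X $ a $ b * t else 0)"
    unfolding matrix_vector_mult_def axis_def vec_lambda_beta by (intro sum.cong) auto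
  then show ?thesis by simp
qed

lemma norm_axis: "norm (axis b t :: 'a::real_normed_vector^'n) = norm t"
proof -
  have "(\<Sum>i\<in>UNIV. (norm ((axis b t :: 'a^'n) $ i))\<^sup>2) = (\<Sum>i\<in>UNIV. if i = b then (norm t)\<^sup>2 else 0)"
    by (intro sum.cong) (auto simp: axis_def)
  then show ?thesis by (simp add: norm_vec_def L2_set_def)
qed

lemma matrix_triple_nth:
  "(X ** Y ** Z) $ a $ b = (\<Sum>d\<in>UNIV. (\<Sum>c\<in>UNIV. X $ a $ c * Y $ c $ d) * Z $ d $ b)"
  by (simp add: matrix_matrix_mult_def)

lemma bounded_linear_matrix_entry: "bounded_linear (\<lambda>u :: complex^'n. (X *v u) $ a)"
  by (intro linear_conv_bounded_linear[THEN iffD1] linearI)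
     (simp_all add: matrix_vector_right_distrib matrix_vector_mult_scaleR)

text \<open>The index type \<open>'m + 'm\<close> displays the rank 2m: \<open>Inl\<close> indexes
  the splitting of v(x) B(x) w(y) after B, \<open>Inr\<close> that of v(x) B(y) w(y) before B. The
  minus sign is carried by the right factor.\<close>

definition sandwich_left ::
  "('a \<Rightarrow> complex^'m^'m) \<Rightarrow> ('a \<Rightarrow> complex^'m^'m) \<Rightarrow> 'm \<Rightarrow> 'm + 'm \<Rightarrow> 'a \<Rightarrow> complex" where
  "sandwich_left v B a s x = (case s of Inl d \<Rightarrow> \<Sum>c\<in>UNIV. v x $ a $ c * B x $ c $ d | Inr c \<Rightarrow> v x $ a $ c)"

definition sandwich_right ::
  "('a \<Rightarrow> complex^'m^'m) \<Rightarrow> ('a \<Rightarrow> complex^'m^'m) \<Rightarrow> 'm \<Rightarrow> 'm + 'm \<Rightarrow> 'a \<Rightarrow> complex" where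
  "sandwich_right B w b s y = (case s of Inl d \<Rightarrow> w y $ d $ b | Inr c \<Rightarrow> - (\<Sum>d\<in>UNIV. B y $ c $ d * w y $ d $ b))"

lemma sandwich_finite_rank:
  "(v x ** (B x - B y) ** w y) $ a $ b = (\<Sum>s\<in>UNIV. sandwich_left v B a s x * sandwich_right B w b s y)"
proof -
  have "(\<Sum>s\<in>UNIV. sandwich_left v B a s x * sandwich_right B w b s y) =
     (\<Sum>d\<in>UNIV. (\<Sum>c\<in>UNIV. v x $ a $ c * B x $ c $ d) * w y $ d $ b) -
     (\<Sum>c\<in>UNIV. v x $ a $ c * (\<Sum>d\<in>UNIV. B y $ c $ d * w y $ d $ b))"
    unfolding UNIV_Plus_UNIV[symmetric]
    by (subst sum.Plus) (auto simp: sandwich_left_def sandwich_right_def sum_negf)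
  also have "(\<Sum>c\<in>UNIV. v x $ a $ c * (\<Sum>d\<in>UNIV. B y $ c $ d * w y $ d $ b)) =
      (\<Sum>d\<in>UNIV. (\<Sum>c\<in>UNIV. v x $ a $ c * B y $ c $ d) * w y $ d $ b)"
    by (simp add: sum_distrib_left sum_distrib_right mult.assoc) (rule sum.swap)
  finally show ?thesis
    by (simp add: matrix_triple_nth sum_subtractf[symmetric] left_diff_distrib[symmetric] right_diff_distrib)
qed

text \<open>\<open>v\<close> and \<open>w\<close> are measurable everywhere and agree with the
  powers of the weights on \<open>E\<close>. The bound \<open>n\<close> provides convergence only
  and appears in no final estimate, so \<open>E\<close> may later grow. \<open>A\<close> majorises
  the commutator norm and is positive, as the pairing bound demands.\<close>

locale truncated_commutator =
  fixes U V B v w :: "real^'d \<Rightarrow> complex^'m^'m" and \<alpha> p q A n :: real and E :: "(real^'d) set"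
  assumes \<alpha>: "0 < \<alpha>" "\<alpha> < real CARD('d)" and p: "1 < p" and q: "1 < q"
    and measurable_v: "v \<in> borel_measurable lebesgue" and measurable_w: "w \<in> borel_measurable lebesgue"
    and measurable_B: "B \<in> borel_measurable lebesgue"
    and E: "E \<in> sets lebesgue" "bounded E"
    and pd: "\<And>x. x \<in> E \<Longrightarrow> positive_definite (U x)"
    and v_eq: "\<And>x. x \<in> E \<Longrightarrow> v x = mat_powr (V x) (1 / q)"
    and w_eq: "\<And>x. x \<in> E \<Longrightarrow> w x = mat_powr (U x) (- (1 / q))"
    and v_le: "\<And>x i j. x \<in> E \<Longrightarrow> cmod (v x $ i $ j) \<le> n"
    and w_le: "\<And>x i j. x \<in> E \<Longrightarrow> cmod (w x $ i $ j) \<le> n"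
    and B_le: "\<And>x i j. x \<in> E \<Longrightarrow> cmod (B x $ i $ j) \<le> n"
    and A: "0 < A" "commutator_norm B \<alpha> p (\<lambda>x. mat_powr (U x) (p / q)) q V \<le> ennreal A"
begin

abbreviation M where "M \<equiv> lebesgue_on E"

definition K :: "'m \<Rightarrow> 'm \<Rightarrow> (real^'d) \<times> (real^'d) \<Rightarrow> complex" where
  "K a b z = (v (fst z) ** (B (fst z) - B (snd z)) ** w (snd z)) $ a $ b"

definition \<beta> :: real where "\<beta> = real CARD('d) - \<alpha>"

definition \<kappa> :: "(real^'d) \<times> (real^'d) \<Rightarrow> real" where "\<kappa> z = 1 / norm (fst z - snd z) powr \<beta>"

lemma \<beta>: "0 < \<beta>" "\<beta> < real CARD('d)"
  using \<alpha> by (auto simp: \<beta>_def)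

lemma space_M: "space M = E"
  by (simp add: space_restrict_space)

lemma finite_M: "finite_measure M"
proof (rule finite_measureI)
  have "emeasure M E = emeasure lebesgue E" by (rule emeasure_restrict_space) (use E in auto)
  moreover have "emeasure lebesgue E \<noteq> \<infinity>"
    unfolding infinity_ennreal_def by (rule fmeasurableD2[OF bounded_set_imp_lmeasurable[OF E(2,1)]])
  ultimately show "emeasure M (space M) \<noteq> \<infinity>" by (simp only: space_M not_False_eq_True)
qed

lemma bounded_entries:
  "bounded_fun M (\<lambda>x. v x $ i $ j)" "bounded_fun M (\<lambda>x. w x $ i $ j)" "bounded_fun M (\<lambda>x. B x $ i $ j)"
proof -
  have *: "bounded_fun M (\<lambda>x. f x $ i $ j)"
    if "f \<in> borel_measurable lebesgue" "\<And>x. x \<in> E \<Longrightarrow> cmod (f x $ i $ j) \<le> n" for f :: "real^'d \<Rightarrow> complex^'m^'m"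
    using that by (auto simp: bounded_fun_def space_M intro!: measurable_restrict_space1 borel_measurable_entry)
  show "bounded_fun M (\<lambda>x. v x $ i $ j)" by (rule *[OF measurable_v v_le])
  show "bounded_fun M (\<lambda>x. w x $ i $ j)" by (rule *[OF measurable_w w_le])
  show "bounded_fun M (\<lambda>x. B x $ i $ j)" by (rule *[OF measurable_B B_le])
qed

lemma bounded_sandwich: "bounded_fun M (sandwich_left v B a s)" "bounded_fun M (sandwich_right B w b s)"
proof -
  show "bounded_fun M (sandwich_left v B a s)"
    by (cases s) (auto simp: sandwich_left_def[abs_def] intro!: bounded_fun_sum bounded_fun_mult bounded_entries)
  show "bounded_fun M (sandwich_right B w b s)"
  proof (cases s)
    case (Inr c)
    have "bounded_fun M (\<lambda>y. -1 * (\<Sum>d\<in>UNIV. B y $ c $ d * w y $ d $ b))"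
      by (intro bounded_fun_cmult bounded_fun_sum bounded_fun_mult bounded_entries)
    then show ?thesis using Inr by (simp add: sandwich_right_def[abs_def])
  qed (auto simp: sandwich_right_def[abs_def] intro!: bounded_entries)
qed

lemma K_finite_rank: "K a b z = (\<Sum>s\<in>UNIV. sandwich_left v B a s (fst z) * sandwich_right B w b s (snd z))"
  by (simp add: K_def sandwich_finite_rank)

lemma measurable_K: "K a b \<in> borel_measurable (M \<Otimes>\<^sub>M M)"
  unfolding K_finite_rank[abs_def]
  by (intro borel_measurable_sum test_pair_measurable bounded_fun_measurable bounded_sandwich)

lemma K_bounded: "\<exists>c\<ge>0. \<forall>x\<in>E. \<forall>y\<in>E. cmod (K a b (x, y)) \<le> c"
proof -
  have "\<exists>c. \<forall>x\<in>E. cmod (sandwich_left v B a s x) \<le> c" for s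
    using bounded_sandwich(1)[of a s] by (simp add: bounded_fun_def space_M)
  then obtain c where c: "\<And>s x. x \<in> E \<Longrightarrow> cmod (sandwich_left v B a s x) \<le> c s" by metis
  have "\<exists>c. \<forall>x\<in>E. cmod (sandwich_right B w b s x) \<le> c" for s
    using bounded_sandwich(2)[of b s] by (simp add: bounded_fun_def space_M)
  then obtain d where d: "\<And>s x. x \<in> E \<Longrightarrow> cmod (sandwich_right B w b s x) \<le> d s" by metis
  have "cmod (K a b (x, y)) \<le> (\<Sum>s\<in>UNIV. \<bar>c s\<bar> * \<bar>d s\<bar>)" if "x \<in> E" "y \<in> E" for x y
    unfolding K_finite_rank
    by (rule order_trans[OF norm_sum sum_mono]) (simp add: norm_mult_le_abs c[OF that(1)] d[OF that(2)])
  then show ?thesis by (intro exI[of _ "\<Sum>s\<in>UNIV. \<bar>c s\<bar> * \<bar>d s\<bar>"]) (auto intro: sum_nonneg)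
qed

lemma measurable_id_M: "(\<lambda>x. x) \<in> borel_measurable M"
proof (rule measurable_restrict_space1)
  show "(\<lambda>x. x) \<in> borel_measurable (lebesgue :: (real^'d) measure)"
    by (rule measurable_completion) simp
qed

lemma measurable_\<kappa>: "\<kappa> \<in> borel_measurable (M \<Otimes>\<^sub>M M)"
proof -
  have "fst \<in> borel_measurable (M \<Otimes>\<^sub>M M)" "snd \<in> borel_measurable (M \<Otimes>\<^sub>M M)"
    using measurable_compose[OF measurable_fst[of M M] measurable_id_M] measurable_compose[OF measurable_snd[of M M] measurable_id_M]
    by simp_all
  then show ?thesis unfolding \<kappa>_def by measurable
qed

text \<open>On \<open>E\<close> the factor \<open>K\<close> is bounded, and the Riesz kernel has
  integrals over balls bounded uniformly in their centre; Tonelli on a set of finite measure does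
  the rest.\<close>

lemma integrable_singular_kernel: "integrable (M \<Otimes>\<^sub>M M) (\<lambda>z. of_real (\<kappa> z) * K a b z)"
proof (rule integrableI_bounded)
  interpret finite_measure M by (rule finite_M)
  show meas: "(\<lambda>z. of_real (\<kappa> z) * K a b z) \<in> borel_measurable (M \<Otimes>\<^sub>M M)"
    using measurable_\<kappa> measurable_K by measurable
  obtain c where c: "0 \<le> c" "\<And>x y. x \<in> E \<Longrightarrow> y \<in> E \<Longrightarrow> cmod (K a b (x, y)) \<le> c" using K_bounded by blast
  obtain r where r: "\<And>y. y \<in> E \<Longrightarrow> norm y \<le> r" using E(2) by (auto simp: bounded_iff)
  define R where "R = 2 * \<bar>r\<bar> + 1"
  have R: "0 < R" by (simp add: R_def)
  have EB: "E \<subseteq> ball x R" if "x \<in> E" for x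
  proof
    fix y assume "y \<in> E"
    then show "y \<in> ball x R"
      using r[of y] r[OF that] norm_triangle_ineq4[of x y] by (simp add: dist_norm R_def)
  qed
  obtain C where C: "\<And>x :: real^'d. (\<integral>\<^sup>+y. ennreal (1 / norm (x - y) powr \<beta>) * indicator (ball x R) y \<partial>lebesgue) \<le> ennreal C"
    using riesz_kernel_locally_integrable[OF \<beta> R] by blast
  have "(\<integral>\<^sup>+y. ennreal (norm (of_real (\<kappa> (x, y)) * K a b (x, y))) \<partial>M) \<le> ennreal c * ennreal C" if x: "x \<in> E" for x
  proof -
    have "(\<integral>\<^sup>+y. ennreal (norm (of_real (\<kappa> (x, y)) * K a b (x, y))) \<partial>M) =
      (\<integral>\<^sup>+y. ennreal (norm (of_real (\<kappa> (x, y)) * K a b (x, y))) * indicator E y \<partial>lebesgue)"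
      using E(1) by (intro nn_integral_restrict_space) auto
    also have "\<dots> \<le> (\<integral>\<^sup>+y. ennreal c * (ennreal (1 / norm (x - y) powr \<beta>) * indicator (ball x R) y) \<partial>lebesgue)"
    proof (rule nn_integral_mono)
      fix y
      show "ennreal (norm (of_real (\<kappa> (x, y)) * K a b (x, y))) * indicator E y \<le>
        ennreal c * (ennreal (1 / norm (x - y) powr \<beta>) * indicator (ball x R) y)"
      proof (cases "y \<in> E")
        case True
        then have "y \<in> ball x R" using EB[OF x] by blast
        moreover have "norm (of_real (\<kappa> (x, y)) * K a b (x, y)) \<le> c * (1 / norm (x - y) powr \<beta>)"
          using c(2)[OF x True] by (simp add: norm_mult norm_divide \<kappa>_def divide_right_mono)
        ultimately show ?thesis using True c(1) by (simp add: ennreal_mult'[symmetric] ennreal_leI)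
      qed simp
    qed
    also have "\<dots> = ennreal c * (\<integral>\<^sup>+y. ennreal (1 / norm (x - y) powr \<beta>) * indicator (ball x R) y \<partial>lebesgue)"
      by (intro nn_integral_cmult borel_measurable_times_ennreal borel_measurable_indicator
          measurable_compose[OF riesz_kernel_measurable measurable_ennreal]) auto
    also have "\<dots> \<le> ennreal c * ennreal C" by (rule mult_left_mono[OF C]) simp
    finally show ?thesis .
  qed
  then have "(\<integral>\<^sup>+x. (\<integral>\<^sup>+y. ennreal (norm (of_real (\<kappa> (x, y)) * K a b (x, y))) \<partial>M) \<partial>M) \<le> (\<integral>\<^sup>+x. ennreal c * ennreal C \<partial>M)"
    by (intro nn_integral_mono) (simp add: space_M)
  also have "\<dots> < \<infinity>"
    by (simp add: emeasure_eq_measure ennreal_mult_less_top)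
  finally have "(\<integral>\<^sup>+x. (\<integral>\<^sup>+y. ennreal (norm (of_real (\<kappa> (x, y)) * K a b (x, y))) \<partial>M) \<partial>M) < \<infinity>" .
  moreover have "(\<lambda>z. ennreal (norm (of_real (\<kappa> z) * K a b z))) \<in> borel_measurable (M \<Otimes>\<^sub>M M)"
    using meas by measurable
  ultimately show "(\<integral>\<^sup>+z. ennreal (norm (of_real (\<kappa> z) * K a b z)) \<partial>(M \<Otimes>\<^sub>M M)) < \<infinity>"
    by (subst (asm) nn_integral_fst) auto
qed

text \<open>The weight U^(p/q) enters the L^p norm through its 1/p-th power U^(1/q), which cancels w
  = U^(-1/q). So the weighted norm of F is the plain L^p norm of f. As F and B F are bounded with
  bounded support, F lies in the domain over which the commutator norm is a supremum.\<close>

lemma commutator_test_function: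
  fixes f :: "real^'d \<Rightarrow> complex" and b :: 'm
  assumes f: "f \<in> lball M p"
  defines "F \<equiv> \<lambda>y. w y *v axis b (indicator E y *\<^sub>R f y)"
  shows "(\<integral>\<^sup>+x. ennreal (norm (mat_powr (V x) (1 / q) *v riesz_commutator B \<alpha> F x) powr q) \<partial>lebesgue) \<le> ennreal (A powr q)"
    and "\<And>x. integrable lebesgue (riesz_integrand \<alpha> F x)"
    and "\<And>x. integrable lebesgue (riesz_integrand \<alpha> (mult_op B F) x)"
proof -
  obtain c where c: "0 \<le> c" "\<And>x. x \<in> E \<Longrightarrow> cmod (f x) \<le> c"
    using lball_bound_pos[OF f] by (auto simp: space_M)
  have fm: "(\<lambda>y. indicator E y *\<^sub>R f y) \<in> borel_measurable lebesgue"
    using f E(1) by (subst borel_measurable_restrict_space_iff[symmetric]) (auto simp: lball_def)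
  have F_nth: "F y $ i = w y $ i $ b * (indicator E y *\<^sub>R f y)" for y i
    by (simp add: F_def matrix_vector_mult_axis)
  have F0: "F y = 0" if "y \<notin> E" for y using that by (simp add: vec_eq_iff F_nth)
  have Fm: "F \<in> borel_measurable lebesgue"
  proof -
    have "(\<lambda>y. (\<chi> i. w y $ i $ b * (indicator E y *\<^sub>R f y))) \<in> borel_measurable lebesgue"
      by (rule borel_measurable_continuous_Pair[OF measurable_w fm]) (intro continuous_intros)
    moreover have "F = (\<lambda>y. (\<chi> i. w y $ i $ b * (indicator E y *\<^sub>R f y)))"
      by (simp add: fun_eq_iff vec_eq_iff F_nth)
    ultimately show ?thesis by simp
  qed
  have Fi: "cmod (F y $ i) \<le> \<bar>n\<bar> * c" for y i
  proof (cases "y \<in> E")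
    case True
    then show ?thesis using norm_mult_le_abs[OF w_le[OF True, of i b] c(2)[OF True]] c(1) by (simp add: F_nth)
  qed (use c in \<open>simp add: F_nth\<close>)
  have Fb: "norm (F y) \<le> (\<Sum>i\<in>(UNIV::'m set). \<bar>n\<bar> * c)" for y
    by (rule order_trans[OF norm_vec_le_sum sum_mono]) (rule Fi)
  show int1: "integrable lebesgue (riesz_integrand \<alpha> F x)" for x
    by (rule riesz_integrand_integrable[OF \<alpha> E(2) Fm F0 Fb])
  have BF0: "mult_op B F y = 0" if "y \<notin> E" for y using F0[OF that] by (simp add: mult_op_def)
  have BFm: "mult_op B F \<in> borel_measurable lebesgue"
    unfolding mult_op_def[abs_def] matrix_vector_mult_def
    by (rule borel_measurable_continuous_Pair[OF measurable_B Fm]) (intro continuous_intros)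
  have BFi: "cmod (mult_op B F y $ i) \<le> (\<Sum>j\<in>(UNIV::'m set). \<bar>n\<bar> * (\<bar>n\<bar> * c))" for y i
  proof (cases "y \<in> E")
    case True
    have "mult_op B F y $ i = (\<Sum>j\<in>UNIV. B y $ i $ j * F y $ j)" by (simp add: mult_op_def matrix_vector_mult_def)
    moreover have "cmod (B y $ i $ j * F y $ j) \<le> \<bar>n\<bar> * (\<bar>n\<bar> * c)" for j
      using norm_mult_le_abs[OF B_le[OF True, of i j] Fi[of y j]] c(1) by (simp add: abs_mult)
    ultimately show ?thesis by (simp only:) (rule order_trans[OF norm_sum sum_mono])
  next
    case False
    then show ?thesis using c by (simp add: BF0)
  qed
  have BFb: "norm (mult_op B F y) \<le> (\<Sum>i\<in>(UNIV::'m set). \<Sum>j\<in>(UNIV::'m set). \<bar>n\<bar> * (\<bar>n\<bar> * c))" for y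
    by (rule order_trans[OF norm_vec_le_sum sum_mono]) (rule BFi)
  show int2: "integrable lebesgue (riesz_integrand \<alpha> (mult_op B F) x)" for x
    by (rule riesz_integrand_integrable[OF \<alpha> E(2) BFm BF0 BFb])
  have F_eq: "mat_powr (mat_powr (U x) (p / q)) (1 / p) *v F x = axis b (f x)" if x: "x \<in> E" for x
  proof -
    have "mat_powr (mat_powr (U x) (p / q)) (1 / p) = mat_powr (U x) (1 / q)"
      using p by (simp add: mat_powr_powr[OF pd[OF x]])
    then show ?thesis
      using x by (simp add: F_def w_eq matrix_vector_mul_assoc mat_powr_mult_minus[OF pd])
  qed
  have F_powr: "ennreal (norm (mat_powr (mat_powr (U x) (p / q)) (1 / p) *v F x) powr p) =
      ennreal (cmod (f x) powr p) * indicator E x" for x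
    using F_eq[of x] F0[of x] by (cases "x \<in> E") (auto simp: norm_axis)
  have "(\<integral>\<^sup>+x. ennreal (norm (mat_powr (mat_powr (U x) (p / q)) (1 / p) *v F x) powr p) \<partial>lebesgue) =
      (\<integral>\<^sup>+x. ennreal (cmod (f x) powr p) \<partial>M)"
    unfolding F_powr using E(1) by (intro nn_integral_restrict_space[symmetric]) auto
  also have "\<dots> = ennreal (\<integral>x. cmod (f x) powr p \<partial>M)"
    using f p by (intro nn_integral_eq_integral bounded_fun_powr_integrable finite_M) (auto simp: lball_iff)
  also have "\<dots> \<le> 1" using f by (simp add: lball_def)
  finally have "weighted_norm p (\<lambda>x. mat_powr (U x) (p / q)) F \<le> ennreal_powr 1 (1 / p)"
    unfolding weighted_norm_def using p by (intro ennreal_powr_mono) auto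
  then have F1: "weighted_norm p (\<lambda>x. mat_powr (U x) (p / q)) F \<le> 1"
    using ennreal_powr_ennreal[of 1 "1 / p"] by simp
  then have "F \<in> {f \<in> weighted_Lp p (\<lambda>x. mat_powr (U x) (p / q)). riesz_defined \<alpha> f \<and> riesz_defined \<alpha> (mult_op B f) \<and>
      weighted_norm p (\<lambda>x. mat_powr (U x) (p / q)) f \<le> 1}"
    using Fm int1 int2 le_less_trans[OF F1, of top] by (simp add: weighted_Lp_def riesz_defined_def)
  then have "weighted_norm q V (riesz_commutator B \<alpha> F) \<le> commutator_norm B \<alpha> p (\<lambda>x. mat_powr (U x) (p / q)) q V"
    unfolding commutator_norm_def by (rule SUP_upper)
  then have "weighted_norm q V (riesz_commutator B \<alpha> F) \<le> ennreal A" using A(2) by (rule order_trans)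
  then show "(\<integral>\<^sup>+x. ennreal (norm (mat_powr (V x) (1 / q) *v riesz_commutator B \<alpha> F x) powr q) \<partial>lebesgue) \<le> ennreal (A powr q)"
    unfolding weighted_norm_def using q A(1) by (subst (asm) ennreal_powr_le_iff) (auto simp: ennreal_powr_ennreal)
qed

text \<open>Both Riesz integrals converge absolutely at every x, so the matrices at x pass under the
  integral sign and the two terms merge into one.\<close>

lemma commutator_kernel_representation:
  assumes f: "f \<in> lball M p" and x: "x \<in> E"
  shows "(v x *v riesz_commutator B \<alpha> (\<lambda>y. w y *v axis b (indicator E y *\<^sub>R f y)) x) $ a =
    (\<integral>y. of_real (\<kappa> (x, y)) * K a b (x, y) * f y \<partial>M)"
proof -
  define F where "F = (\<lambda>y. w y *v axis b (indicator E y *\<^sub>R f y))"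
  note int = commutator_test_function(2,3)[OF f, where b = b, folded F_def]
  have BL: "bounded_linear (\<lambda>u. (v x *v (B x *v u)) $ a)" "bounded_linear (\<lambda>u. (v x *v u) $ a)"
    using bounded_linear_matrix_entry[of "v x ** B x" a] bounded_linear_matrix_entry[of "v x" a]
    by (simp_all add: matrix_vector_mul_assoc)
  have "(v x *v riesz_commutator B \<alpha> F x) $ a =
      (v x *v (B x *v (\<integral>y. riesz_integrand \<alpha> F x y \<partial>lebesgue))) $ a -
      (v x *v (\<integral>y. riesz_integrand \<alpha> (mult_op B F) x y \<partial>lebesgue)) $ a"
    by (simp add: riesz_commutator_def mult_op_def[of B "riesz \<alpha> F"] riesz_def matrix_vector_mult_diff_distrib)
  also have "\<dots> = (\<integral>y. (v x *v (B x *v riesz_integrand \<alpha> F x y)) $ a \<partial>lebesgue) -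
      (\<integral>y. (v x *v riesz_integrand \<alpha> (mult_op B F) x y) $ a \<partial>lebesgue)"
    using integral_bounded_linear[OF BL(1) int(1)] integral_bounded_linear[OF BL(2) int(2)] by simp
  also have "\<dots> = (\<integral>y. (v x *v (B x *v riesz_integrand \<alpha> F x y)) $ a - (v x *v riesz_integrand \<alpha> (mult_op B F) x y) $ a \<partial>lebesgue)"
    by (intro Bochner_Integration.integral_diff[symmetric] integrable_bounded_linear[OF BL(1) int(1)] integrable_bounded_linear[OF BL(2) int(2)])
  also have "\<dots> = (\<integral>y. indicator E y *\<^sub>R (of_real (\<kappa> (x, y)) * K a b (x, y) * f y) \<partial>lebesgue)"
  proof (rule Bochner_Integration.integral_cong[OF refl])
    fix y
    have "(v x *v (B x *v riesz_integrand \<alpha> F x y)) $ a - (v x *v riesz_integrand \<alpha> (mult_op B F) x y) $ a =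
      \<kappa> (x, y) *\<^sub>R ((v x *v (B x *v F y)) $ a - (v x *v (B y *v F y)) $ a)"
      by (simp add: riesz_integrand_def matrix_vector_mult_scaleR mult_op_def \<kappa>_def \<beta>_def scaleR_diff_right)
    also have "(v x *v (B x *v F y)) $ a - (v x *v (B y *v F y)) $ a =
      ((v x ** (B x - B y) ** w y) *v axis b (indicator E y *\<^sub>R f y)) $ a"
      by (simp add: F_def matrix_vector_mul_assoc[symmetric] matrix_vector_mult_diff_rdistrib matrix_vector_mult_diff_distrib)
    also have "\<dots> = K a b (x, y) * (indicator E y *\<^sub>R f y)"
      by (simp add: matrix_vector_mult_axis K_def)
    finally show "(v x *v (B x *v riesz_integrand \<alpha> F x y)) $ a - (v x *v riesz_integrand \<alpha> (mult_op B F) x y) $ a =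
      indicator E y *\<^sub>R (of_real (\<kappa> (x, y)) * K a b (x, y) * f y)"
      by (simp add: scaleR_conv_of_real)
  qed
  also have "\<dots> = (\<integral>y. of_real (\<kappa> (x, y)) * K a b (x, y) * f y \<partial>M)"
    using E(1) by (intro integral_restrict_space[symmetric]) auto
  finally show ?thesis by (simp add: F_def)
qed

text \<open>A component is at most the norm of the vector, so each scalar kernel maps the L^p ball
  into the ball of radius A of L^q. Pairing with \<psi> costs the factor 2 of the Young-type
  bound.\<close>

lemma form_bound_singular_kernel: "form_bound M p (conj_exponent q) (2 * A) (\<lambda>z. of_real (\<kappa> z) * K a b z)"
  unfolding form_bound_def
proof (intro conjI ballI integrable_singular_kernel)
  fix \<psi> f assume \<psi>: "\<psi> \<in> lball M (conj_exponent q)" and f: "f \<in> lball M p"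
  interpret finite_measure M by (rule finite_M)
  interpret MM: pair_sigma_finite M M ..
  define F where "F = (\<lambda>y. w y *v axis b (indicator E y *\<^sub>R f y))"
  define h where "h x = (\<integral>y. of_real (\<kappa> (x, y)) * K a b (x, y) * f y \<partial>M)" for x
  have h_eq: "h x = (mat_powr (V x) (1 / q) *v riesz_commutator B \<alpha> F x) $ a" if "x \<in> E" for x
    using commutator_kernel_representation[OF f that, of b a] v_eq[OF that] by (simp add: h_def F_def)
  have i1: "integrable (M \<Otimes>\<^sub>M M) (\<lambda>z. of_real (\<kappa> z) * K a b z * (1 * f (snd z)))"
  proof -
    obtain c where c: "\<And>y. y \<in> E \<Longrightarrow> cmod (f y) \<le> c" using lball_bound_pos[OF f] by (auto simp: space_M)
    have "integrable (M \<Otimes>\<^sub>M M) (\<lambda>z. (1 * f (snd z)) * (of_real (\<kappa> z) * K a b z))"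
      by (rule integrable_bounded_mult[OF integrable_singular_kernel test_pair_measurable[of "\<lambda>_. 1"], where c = c])
         (use f c in \<open>auto simp: lball_def space_pair_measure space_M\<close>)
    then show ?thesis by (simp add: mult_ac)
  qed
  have hm: "h \<in> borel_measurable M"
    unfolding h_def using borel_measurable_integrable[OF i1]
    by (intro borel_measurable_lebesgue_integral) (simp add: case_prod_beta')
  have "(\<integral>\<^sup>+x. ennreal (cmod (h x) powr q) \<partial>M) = (\<integral>\<^sup>+x. ennreal (cmod (h x) powr q) * indicator E x \<partial>lebesgue)"
    using E(1) by (intro nn_integral_restrict_space) auto
  also have "\<dots> \<le> (\<integral>\<^sup>+x. ennreal (norm (mat_powr (V x) (1 / q) *v riesz_commutator B \<alpha> F x) powr q) \<partial>lebesgue)"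
  proof (rule nn_integral_mono)
    fix x
    show "ennreal (cmod (h x) powr q) * indicator E x \<le> ennreal (norm (mat_powr (V x) (1 / q) *v riesz_commutator B \<alpha> F x) powr q)"
      using q by (cases "x \<in> E") (auto simp: h_eq intro!: ennreal_leI powr_mono2 Finite_Cartesian_Product.norm_nth_le)
  qed
  also have "\<dots> \<le> ennreal (A powr q)"
    unfolding F_def by (rule commutator_test_function(1)[OF f])
  finally have hle: "(\<integral>\<^sup>+x. ennreal (cmod (h x) powr q) \<partial>M) \<le> ennreal (A powr q)" .
  have hi: "integrable M (\<lambda>x. cmod (h x) powr q)"
    using hm le_less_trans[OF hle] by (intro integrableI_bounded) auto
  have hA: "(\<integral>x. cmod (h x) powr q \<partial>M) \<le> A powr q"
    using hle by (subst (asm) nn_integral_eq_integral[OF hi]) (auto simp: ennreal_le_iff)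
  have cq: "1 < conj_exponent q" "1 / conj_exponent q + 1 / q = 1"
    using q by (auto simp: conj_exponent_def field_simps)
  have "cmod (\<integral>x. h x * \<psi> x \<partial>M) \<le> 2 * A"
    by (rule lball_pairing_le[OF cq(1) q cq(2) \<psi> finite_M hm hi A(1) hA])
  also have "(\<integral>x. h x * \<psi> x \<partial>M) = (\<integral>x. (\<integral>y. of_real (\<kappa> (x, y)) * K a b (x, y) * (\<psi> x * f y) \<partial>M) \<partial>M)"
  proof (rule Bochner_Integration.integral_cong[OF refl])
    fix x
    have "(\<lambda>y. of_real (\<kappa> (x, y)) * K a b (x, y) * (\<psi> x * f y)) = (\<lambda>y. of_real (\<kappa> (x, y)) * K a b (x, y) * f y * \<psi> x)"
      by (simp add: mult_ac)
    then show "h x * \<psi> x = (\<integral>y. of_real (\<kappa> (x, y)) * K a b (x, y) * (\<psi> x * f y) \<partial>M)"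
      by (simp add: h_def)
  qed
  also have "\<dots> = (\<integral>z. of_real (\<kappa> z) * K a b z * (\<psi> (fst z) * f (snd z)) \<partial>(M \<Otimes>\<^sub>M M))"
    using MM.integral_fst'[OF integrable_form[OF integrable_singular_kernel \<psi> f]] by simp
  finally show "cmod (\<integral>z. of_real (\<kappa> z) * K a b z * (\<psi> (fst z) * f (snd z)) \<partial>(M \<Otimes>\<^sub>M M)) \<le> 2 * A" .
qed

end

text \<open>The norm of the multiplier u^(\<beta>/2), the factor 2 of the form bound of the singular
  kernel, and the compensation for the normalisation of u by 8d.\<close>

definition kernel_const :: "nat \<Rightarrow> real \<Rightarrow> real" where
  "kernel_const d \<beta> = powr_multiplier_const (\<beta> / 2) * 2 * (8 * real d) powr (\<beta> / 2)"

lemma kernel_const_pos: "0 < d \<Longrightarrow> 0 < kernel_const d \<beta>"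
  by (simp add: kernel_const_def powr_multiplier_const_def)

lemma conj_exponent_facts:
  assumes "1 < r"
  shows "1 < conj_exponent r" "1 / r + 1 / conj_exponent r = 1" "1 / conj_exponent r + 1 / r = 1"
    "conj_exponent (conj_exponent r) = r"
  using assms by (auto simp: conj_exponent_def field_simps)

context truncated_commutator
begin

text \<open>Coordinates relative to the cube are bounded by 1, so u = |x - y|^2 / (8 d l^2) is an
  admissible argument. Its power \<beta>/2, multiplied by the constant \<open>D\<close>, is |x -
  y|^\<beta> and cancels \<kappa>.\<close>

lemma form_bound_K:
  assumes Q: "E \<subseteq> cbox a0 (a0 + (\<chi> i. l))" and l: "0 < l"
  shows "form_bound M p (conj_exponent q) (kernel_const CARD('d) \<beta> * l powr \<beta> * A) (K a b)"
proof -
  define X where "X i x = (x $ i - a0 $ i) / l" for i and x :: "real^'d"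
  define D where "D = (8 * real CARD('d)) powr (\<beta> / 2) * l powr \<beta>"
  define u where "u z = 1 / (8 * real (card (UNIV :: 'd set))) * (\<Sum>i\<in>UNIV. (X i (fst z) - X i (snd z))\<^sup>2)" for z
  have Xm: "X i \<in> borel_measurable M" for i
  proof -
    have "(\<lambda>x :: real^'d. (x $ i - a0 $ i) / l) \<in> borel_measurable borel"
      by (intro borel_measurable_continuous_onI continuous_intros) (use l in auto)
    from measurable_compose[OF measurable_id_M this] show ?thesis by (simp add: X_def[abs_def])
  qed
  have Xb: "\<bar>X i x\<bar> \<le> 1" if "x \<in> space M" for i x
  proof -
    have "x \<in> cbox a0 (a0 + (\<chi> i. l))" using that Q by (auto simp: space_M)
    then have "a0 $ i \<le> x $ i" "x $ i \<le> a0 $ i + l" by (simp_all add: mem_box_cart)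
    then show ?thesis using l by (simp add: X_def)
  qed
  have "multiplier M p (conj_exponent q) (powr_multiplier_const (\<beta> / 2)) (\<lambda>z. of_real (u z powr (\<beta> / 2)))"
    unfolding u_def using \<beta> p conj_exponent_facts[OF q]
    by (intro multiplier_distance_powr finite_M Xm Xb) auto
  then have "form_bound M p (conj_exponent q) (powr_multiplier_const (\<beta> / 2) * (2 * A))
      (\<lambda>z. of_real (u z powr (\<beta> / 2)) * (of_real (\<kappa> z) * K a b z))"
    using form_bound_singular_kernel unfolding multiplier_def by blast
  then have "form_bound M p (conj_exponent q) (cmod (of_real D) * (powr_multiplier_const (\<beta> / 2) * (2 * A)))
      (\<lambda>z. of_real D * (of_real (u z powr (\<beta> / 2)) * (of_real (\<kappa> z) * K a b z)))"
    using multiplier_const[of M p "conj_exponent q" "of_real D"] unfolding multiplier_def by blast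
  moreover have "of_real D * (of_real (u z powr (\<beta> / 2)) * (of_real (\<kappa> z) * K a b z)) = K a b z" for z
  \<comment> \<open>On the diagonal \<kappa> is 0 by convention and cannot be cancelled, but there
    B(x) - B(y) vanishes and both sides are 0.\<close>
  proof (cases "fst z = snd z")
    case True
    then show ?thesis by (simp add: K_def)
  next
    case False
    then have n: "0 < norm (fst z - snd z)" by simp
    have "(\<Sum>i\<in>UNIV. (X i (fst z) - X i (snd z))\<^sup>2) = (\<Sum>i\<in>UNIV. ((fst z - snd z) $ i)\<^sup>2 / l\<^sup>2)"
      by (intro sum.cong refl) (simp add: X_def diff_divide_distrib[symmetric] power_divide)
    also have "\<dots> = (norm (fst z - snd z))\<^sup>2 / l\<^sup>2"
      unfolding power2_norm_eq_inner inner_vec_def sum_divide_distrib by (simp add: power2_eq_square)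
    finally have "u z = (norm (fst z - snd z) / l)\<^sup>2 / (8 * real CARD('d))"
      by (simp add: u_def power_divide)
    then have "u z powr (\<beta> / 2) = ((norm (fst z - snd z) / l)\<^sup>2) powr (\<beta> / 2) / (8 * real CARD('d)) powr (\<beta> / 2)"
      by (simp only: powr_divide)
    also have "((norm (fst z - snd z) / l)\<^sup>2) powr (\<beta> / 2) = norm (fst z - snd z) powr \<beta> / l powr \<beta>"
    proof -
      have "(norm (fst z - snd z) / l)\<^sup>2 = (norm (fst z - snd z) / l) powr 2" using n l by simp
      then show ?thesis by (simp only: powr_powr powr_divide) simp
    qed
    finally have "D * (u z powr (\<beta> / 2) * \<kappa> z) = 1"
      using n l by (simp add: D_def \<kappa>_def)
    then have "of_real (D * (u z powr (\<beta> / 2) * \<kappa> z)) * K a b z = K a b z" by (simp only: of_real_1 mult_1)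
    then show ?thesis by (simp add: mult.assoc)
  qed
  moreover have "cmod (of_real D) * (powr_multiplier_const (\<beta> / 2) * (2 * A)) = kernel_const CARD('d) \<beta> * l powr \<beta> * A"
    by (simp add: D_def kernel_const_def norm_mult)
  ultimately show ?thesis by (simp only:)
qed

text \<open>The second bound applies the finite rank estimate to the transposed kernel. The form
  then has exponents q' and p, whose conjugates q and p' are the inner and outer exponents.\<close>

lemma K_mixed_norms:
  assumes Q: "E \<subseteq> cbox a0 (a0 + (\<chi> i. l))" and l: "0 < l"
  shows "(\<integral>\<^sup>+x. ennreal_powr (\<integral>\<^sup>+y. ennreal (cmod (K a b (x, y)) powr conj_exponent p) \<partial>M) (q / conj_exponent p) \<partial>M)
      \<le> ennreal (mixed_norm_const (2 * CARD('m)) (conj_exponent p) q * (kernel_const CARD('d) \<beta> * l powr \<beta> * A) powr q)"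
      (is ?xy)
    and "(\<integral>\<^sup>+x. ennreal_powr (\<integral>\<^sup>+y. ennreal (cmod (K a b (y, x)) powr q) \<partial>M) (conj_exponent p / q) \<partial>M)
      \<le> ennreal (mixed_norm_const (2 * CARD('m)) q (conj_exponent p) * (kernel_const CARD('d) \<beta> * l powr \<beta> * A) powr conj_exponent p)"
      (is ?yx)
proof -
  have card: "card (UNIV :: ('m + 'm) set) = 2 * CARD('m)" by simp
  show ?xy
    unfolding card[symmetric]
    by (rule finite_rank_mixed_norm[OF p conj_exponent_facts(1,2)[OF p] conj_exponent_facts(1)[OF q] q conj_exponent_facts(3)[OF q]
          finite_M finite bounded_sandwich _ form_bound_K[OF Q l]]) (simp add: K_finite_rank)
  show ?yx
    unfolding card[symmetric]
    by (rule finite_rank_mixed_norm[OF conj_exponent_facts(1)[OF q] q conj_exponent_facts(3)[OF q] p conj_exponent_facts(1,2)[OF p]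
          finite_M finite bounded_sandwich(2,1) _ form_bound_swap[OF finite_M form_bound_K[OF Q l]], unfolded fst_conv snd_conv])
       (simp add: K_finite_rank mult.commute)
qed

lemmas mixed_norms = K_mixed_norms[unfolded K_def \<beta>_def fst_conv snd_conv]

end

text \<open>With n = card I, the exponent collects three losses: n^(r t) from the power r under the
  inner integral, n^t from the power t of the sum of inner integrals, and n from summing the outer
  ones.\<close>

lemma nn_integral_powr_sum_le:
  fixes k :: "'i \<Rightarrow> 'a \<Rightarrow> 'a \<Rightarrow> real"
  assumes I: "finite I" and r: "0 < r" and t: "0 < t" and M: "sigma_finite_measure M"
    and k: "\<And>i. i \<in> I \<Longrightarrow> case_prod (k i) \<in> borel_measurable (M \<Otimes>\<^sub>M M)" "\<And>i x y. 0 \<le> k i x y"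
    and D: "\<And>i. i \<in> I \<Longrightarrow> (\<integral>\<^sup>+x. ennreal_powr (\<integral>\<^sup>+y. ennreal (k i x y powr r) \<partial>M) t \<partial>M) \<le> ennreal D" "0 \<le> D"
  shows "(\<integral>\<^sup>+x. ennreal_powr (\<integral>\<^sup>+y. ennreal ((\<Sum>i\<in>I. k i x y) powr r) \<partial>M) t \<partial>M) \<le>
    ennreal (real (card I) powr (r * t + t + 1) * D)"
proof -
  interpret sigma_finite_measure M by (rule M)
  let ?n = "real (card I)"
  have km: "(\<lambda>y. k i x y) \<in> borel_measurable M" if "i \<in> I" "x \<in> space M" for i x
    using measurable_compose_Pair1[OF that(2) k(1)[OF that(1)]] by simp
  have Jm: "(\<lambda>x. ennreal_powr (\<integral>\<^sup>+y. ennreal (k i x y powr r) \<partial>M) t) \<in> borel_measurable M" if "i \<in> I" for i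
  proof -
    have "(\<lambda>z. ennreal (case_prod (k i) z powr r)) \<in> borel_measurable (M \<Otimes>\<^sub>M M)" using k(1)[OF that] by measurable
    then have "(\<lambda>x. \<integral>\<^sup>+y. ennreal (k i x y powr r) \<partial>M) \<in> borel_measurable M"
      using borel_measurable_nn_integral_fst by fastforce
    then show ?thesis by measurable
  qed
  have inner: "ennreal_powr (\<integral>\<^sup>+y. ennreal ((\<Sum>i\<in>I. k i x y) powr r) \<partial>M) t \<le>
      ennreal (?n powr (r * t)) * (ennreal (?n powr t) * (\<Sum>i\<in>I. ennreal_powr (\<integral>\<^sup>+y. ennreal (k i x y powr r) \<partial>M) t))"
    if x: "x \<in> space M" for x
  proof -
    have "(\<integral>\<^sup>+y. ennreal ((\<Sum>i\<in>I. k i x y) powr r) \<partial>M) \<le> (\<integral>\<^sup>+y. ennreal (?n powr r) * (\<Sum>i\<in>I. ennreal (k i x y powr r)) \<partial>M)"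
    proof (rule nn_integral_mono)
      fix y
      have "ennreal ((\<Sum>i\<in>I. k i x y) powr r) \<le> ennreal (?n powr r * (\<Sum>i\<in>I. k i x y powr r))"
        by (intro ennreal_leI powr_sum_le I k r)
      then show "ennreal ((\<Sum>i\<in>I. k i x y) powr r) \<le> ennreal (?n powr r) * (\<Sum>i\<in>I. ennreal (k i x y powr r))"
        by (simp add: ennreal_mult' sum_nonneg)
    qed
    also have "\<dots> = ennreal (?n powr r) * (\<Sum>i\<in>I. \<integral>\<^sup>+y. ennreal (k i x y powr r) \<partial>M)"
    proof -
      have m: "(\<lambda>y. ennreal (k i x y powr r)) \<in> borel_measurable M" if "i \<in> I" for i
        using km[OF that x] by measurable
      have "(\<lambda>y. \<Sum>i\<in>I. ennreal (k i x y powr r)) \<in> borel_measurable M" using m by (rule borel_measurable_sum)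
      then show ?thesis using m by (simp add: nn_integral_cmult nn_integral_sum del: sum_ennreal)
    qed
    finally have "ennreal_powr (\<integral>\<^sup>+y. ennreal ((\<Sum>i\<in>I. k i x y) powr r) \<partial>M) t \<le>
       ennreal_powr (ennreal (?n powr r) * (\<Sum>i\<in>I. \<integral>\<^sup>+y. ennreal (k i x y powr r) \<partial>M)) t"
      using t by (intro ennreal_powr_mono) auto
    also have "\<dots> = ennreal (?n powr (r * t)) * ennreal_powr (\<Sum>i\<in>I. \<integral>\<^sup>+y. ennreal (k i x y powr r) \<partial>M) t"
      using t by (simp add: ennreal_powr_mult powr_powr)
    also have "\<dots> \<le> ennreal (?n powr (r * t)) * (ennreal (?n powr t) * (\<Sum>i\<in>I. ennreal_powr (\<integral>\<^sup>+y. ennreal (k i x y powr r) \<partial>M) t))"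
      by (intro mult_left_mono ennreal_powr_sum_le I t) simp
    finally show ?thesis .
  qed
  have "(\<integral>\<^sup>+x. ennreal_powr (\<integral>\<^sup>+y. ennreal ((\<Sum>i\<in>I. k i x y) powr r) \<partial>M) t \<partial>M) \<le>
     (\<integral>\<^sup>+x. ennreal (?n powr (r * t)) * (ennreal (?n powr t) * (\<Sum>i\<in>I. ennreal_powr (\<integral>\<^sup>+y. ennreal (k i x y powr r) \<partial>M) t)) \<partial>M)"
    by (intro nn_integral_mono inner)
  also have "\<dots> = ennreal (?n powr (r * t)) * (ennreal (?n powr t) * (\<Sum>i\<in>I. \<integral>\<^sup>+x. ennreal_powr (\<integral>\<^sup>+y. ennreal (k i x y powr r) \<partial>M) t \<partial>M))"
    using Jm by (simp add: nn_integral_cmult nn_integral_sum borel_measurable_sum borel_measurable_times_ennreal)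
  also have "\<dots> \<le> ennreal (?n powr (r * t)) * (ennreal (?n powr t) * (\<Sum>i\<in>I. ennreal D))"
    by (intro mult_left_mono sum_mono D) auto
  also have "\<dots> = ennreal (?n powr (r * t + t + 1) * D)"
    using D(2) by (simp add: ennreal_mult'[symmetric] ennreal_of_nat_eq_real_of_nat powr_add mult.assoc)
  finally show ?thesis .
qed

lemma mat_opnorm_le: "mat_opnorm X \<le> (\<Sum>(a, b)\<in>UNIV. cmod (X $ a $ b))"
proof -
  have "norm (X *v u) \<le> (\<Sum>(a, b)\<in>UNIV. cmod (X $ a $ b)) * norm u" for u
  proof -
    have "norm (X *v u) \<le> (\<Sum>a\<in>UNIV. cmod ((X *v u) $ a))" by (rule norm_vec_le_sum)
    also have "\<dots> \<le> (\<Sum>a\<in>UNIV. \<Sum>b\<in>UNIV. cmod (X $ a $ b) * norm u)"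
    proof (rule sum_mono)
      fix a
      show "cmod ((X *v u) $ a) \<le> (\<Sum>b\<in>UNIV. cmod (X $ a $ b) * norm u)"
        unfolding matrix_vector_mult_def vec_lambda_beta
        by (rule order_trans[OF norm_sum sum_mono])
           (auto simp: norm_mult intro!: mult_left_mono Finite_Cartesian_Product.norm_nth_le)
    qed
    also have "\<dots> = (\<Sum>(a, b)\<in>UNIV. cmod (X $ a $ b)) * norm u"
      by (simp add: sum_distrib_right sum.cartesian_product UNIV_Times_UNIV case_prod_beta')
    finally show ?thesis .
  qed
  then show ?thesis unfolding mat_opnorm_def by (rule onorm_le)
qed

lemma nn_integral_restrict_subset:
  assumes "E \<in> sets lebesgue" "Q \<in> sets lebesgue" "E \<subseteq> Q"
  shows "(\<integral>\<^sup>+x. f x * indicator E x \<partial>lebesgue_on Q) = (\<integral>\<^sup>+x. f x \<partial>lebesgue_on E)"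
proof -
  have "(\<integral>\<^sup>+x. f x * indicator E x \<partial>lebesgue_on Q) = (\<integral>\<^sup>+x. f x * indicator E x * indicator Q x \<partial>lebesgue)"
    using assms by (intro nn_integral_restrict_space) auto
  also have "\<dots> = (\<integral>\<^sup>+x. f x * indicator E x \<partial>lebesgue)"
    using assms(3) by (intro nn_integral_cong) (auto simp: indicator_def)
  also have "\<dots> = (\<integral>\<^sup>+x. f x \<partial>lebesgue_on E)"
    using assms by (intro nn_integral_restrict_space[symmetric]) auto
  finally show ?thesis .
qed

subsection \<open>Passage to cubes\<close>

lemma cube_measure:
  fixes a :: "real^'d"
  assumes "0 < l"
  shows "emeasure lebesgue (cbox a (a + (\<chi> i. l))) = ennreal (l ^ CARD('d))"
proof -
  have "a \<in> cbox a (a + (\<chi> i. l))" using assms by (simp add: mem_box_cart)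
  then have "cbox a (a + (\<chi> i. l)) \<noteq> {}" by blast
  then have "measure lborel (cbox a (a + (\<chi> i. l))) = l ^ CARD('d)"
    by (simp add: content_cbox_cart)
  then show ?thesis using emeasure_lborel_cbox_finite[of a "a + (\<chi> i. l)"]
    by (simp add: emeasure_eq_ennreal_measure less_top)
qed

text \<open>A substitute for the operator norm: it dominates it, is visibly measurable, and splits
  into scalar kernels of finite rank. A simultaneous transposition of matrix and variables leaves it
  manageable for the adjoint.\<close>

definition sandwich_sum ::
  "('a \<Rightarrow> complex^'m^'m) \<Rightarrow> ('a \<Rightarrow> complex^'m^'m) \<Rightarrow> ('a \<Rightarrow> complex^'m^'m) \<Rightarrow> 'a \<Rightarrow> 'a \<Rightarrow> real" where
  "sandwich_sum v B w x y = (\<Sum>(a, b)\<in>UNIV. cmod ((v x ** (B x - B y) ** w y) $ a $ b))"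

lemma measurable_sandwich_entry:
  fixes v B w :: "'a \<Rightarrow> complex^'m^'m"
  assumes "v \<in> borel_measurable N" "B \<in> borel_measurable N" "w \<in> borel_measurable N"
  shows "case_prod (\<lambda>x y. cmod ((v x ** (B x - B y) ** w y) $ a $ b)) \<in> borel_measurable (N \<Otimes>\<^sub>M N)"
proof -
  have 1: "(\<lambda>z. f (fst z) $ i $ j) \<in> borel_measurable (N \<Otimes>\<^sub>M N)" "(\<lambda>z. f (snd z) $ i $ j) \<in> borel_measurable (N \<Otimes>\<^sub>M N)"
    if "f \<in> borel_measurable N" for f :: "'a \<Rightarrow> complex^'m^'m" and i j
    using measurable_compose[OF measurable_fst borel_measurable_entry[OF that]]
      measurable_compose[OF measurable_snd borel_measurable_entry[OF that]] by auto
  have "(\<lambda>z. cmod (\<Sum>d\<in>UNIV. (\<Sum>c\<in>UNIV. v (fst z) $ a $ c * (B (fst z) $ c $ d - B (snd z) $ c $ d)) * w (snd z) $ d $ b))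
      \<in> borel_measurable (N \<Otimes>\<^sub>M N)"
    using assms by (intro measurable_compose[OF _ borel_measurable_norm] borel_measurable_sum borel_measurable_times borel_measurable_diff 1)
  then show ?thesis by (simp add: case_prod_beta' matrix_triple_nth)
qed

lemma measurable_sandwich_sum:
  assumes "v \<in> borel_measurable N" "B \<in> borel_measurable N" "w \<in> borel_measurable N"
  shows "case_prod (sandwich_sum v B w) \<in> borel_measurable (N \<Otimes>\<^sub>M N)"
proof -
  have "(\<lambda>z. \<Sum>s\<in>UNIV. case_prod (\<lambda>x y. cmod ((v x ** (B x - B y) ** w y) $ fst s $ snd s)) z) \<in> borel_measurable (N \<Otimes>\<^sub>M N)"
    using assms by (intro borel_measurable_sum measurable_sandwich_entry)
  then show ?thesis by (simp add: sandwich_sum_def[abs_def] case_prod_beta')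
qed

definition mixed_bmo_const :: "nat \<Rightarrow> real \<Rightarrow> real \<Rightarrow> real" where
  "mixed_bmo_const m r \<rho> = real (m * m) powr (\<rho> + \<rho> / r + 1) * mixed_norm_const (2 * m) r \<rho>"

lemma mixed_norm_const_nonneg: "0 \<le> mixed_norm_const n r t"
  by (simp add: mixed_norm_const_def)

lemma locally_integrable_measurable:
  assumes "locally_integrable B"
  shows "B \<in> borel_measurable lebesgue"
proof (rule borel_measurable_LIMSEQ_metric)
  fix n :: nat
  have "B absolutely_integrable_on cball 0 (real n)" using assms by (simp add: locally_integrable_def)
  then show "(\<lambda>x. indicator (cball 0 (real n)) x *\<^sub>R B x) \<in> borel_measurable lebesgue"
    unfolding set_integrable_def by (rule borel_measurable_integrable)
next
  fix x :: "real^'a"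
  obtain n :: nat where "norm x \<le> real n" using real_arch_simple by blast
  then have "\<forall>\<^sub>F k in sequentially. indicator (cball 0 (real k)) x *\<^sub>R B x = B x"
    by (intro eventually_sequentiallyI[of n]) (auto simp: indicator_def)
  then show "(\<lambda>k. indicator (cball 0 (real k)) x *\<^sub>R B x) \<longlonglongrightarrow> B x"
    by (rule tendsto_eventually)
qed

lemma iterated_integral_on_subsets:
  fixes k :: "'a::euclidean_space \<Rightarrow> 'a \<Rightarrow> real"
  assumes Q: "Q \<in> sets lebesgue" "finite_measure (lebesgue_on Q)"
    and k: "case_prod k \<in> borel_measurable (lebesgue_on Q \<Otimes>\<^sub>M lebesgue_on Q)"
    and E: "\<And>n. E n \<in> sets lebesgue" "\<And>n. E n \<subseteq> Q" "incseq E" "AE x in lebesgue_on Q. \<exists>n. x \<in> E n"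
    and r: "0 < r" and t: "0 < t"
    and bound: "\<And>n. (\<integral>\<^sup>+x. ennreal_powr (\<integral>\<^sup>+y. ennreal (k x y powr r) \<partial>lebesgue_on (E n)) t \<partial>lebesgue_on (E n)) \<le> D"
  shows "(\<integral>\<^sup>+x. ennreal_powr (\<integral>\<^sup>+y. ennreal (k x y powr r) \<partial>lebesgue_on Q) t \<partial>lebesgue_on Q) \<le> D"
proof (rule iterated_integral_exhaustion[OF _ _ _ E(3,4) t])
  show "sigma_finite_measure (lebesgue_on Q)" using Q(2) by (simp add: finite_measure.axioms(1))
  have "(\<lambda>z. ennreal (case_prod k z powr r)) \<in> borel_measurable (lebesgue_on Q \<Otimes>\<^sub>M lebesgue_on Q)"
    using k by measurable
  then show "case_prod (\<lambda>x y. ennreal (k x y powr r)) \<in> borel_measurable (lebesgue_on Q \<Otimes>\<^sub>M lebesgue_on Q)"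
    by (simp add: case_prod_beta')
  show "E n \<in> sets (lebesgue_on Q)" for n using E(1,2) Q(1) by (auto simp: sets_restrict_space_iff)
  show "(\<integral>\<^sup>+x. ennreal_powr (\<integral>\<^sup>+y. ennreal (k x y powr r) * indicator (E n) y \<partial>lebesgue_on Q) t * indicator (E n) x \<partial>lebesgue_on Q) \<le> D" for n
    using bound[of n] by (simp add: nn_integral_restrict_subset[OF E(1) Q(1) E(2)])
qed

text \<open>The sets \<open>E n\<close> consist of the points of the cube where both weights are
  positive definite and all entries of v, w and B have modulus at most n. They increase to almost
  all of the cube, and the bounds on them are independent of n.\<close>

lemma sandwich_sum_mixed_norms_on_cube:
  fixes U V B :: "real^'d \<Rightarrow> complex^'m^'m" and a0 :: "real^'d"
  assumes \<alpha>: "0 < \<alpha>" "\<alpha> < real CARD('d)" and p: "1 < p" and q: "1 < q"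
    and U: "matrix_weight U" and V: "matrix_weight V" and B: "locally_integrable B"
    and A: "0 < A" "commutator_norm B \<alpha> p (\<lambda>x. mat_powr (U x) (p / q)) q V \<le> ennreal A"
    and l: "0 < l"
  defines "Q \<equiv> cbox a0 (a0 + (\<chi> i. l))"
    and "v \<equiv> \<lambda>x. if positive_definite (V x) then mat_powr (V x) (1 / q) else 0"
    and "w \<equiv> \<lambda>x. if positive_definite (U x) then mat_powr (U x) (- (1 / q)) else 0"
    and "c \<equiv> kernel_const CARD('d) (real CARD('d) - \<alpha>) * l powr (real CARD('d) - \<alpha>) * A"
  shows "(\<integral>\<^sup>+x. ennreal_powr (\<integral>\<^sup>+y. ennreal (sandwich_sum v B w x y powr conj_exponent p) \<partial>lebesgue_on Q) (q / conj_exponent p) \<partial>lebesgue_on Q)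
      \<le> ennreal (mixed_bmo_const CARD('m) (conj_exponent p) q * c powr q)"
      (is ?xy)
    and "(\<integral>\<^sup>+x. ennreal_powr (\<integral>\<^sup>+y. ennreal (sandwich_sum v B w y x powr q) \<partial>lebesgue_on Q) (conj_exponent p / q) \<partial>lebesgue_on Q)
      \<le> ennreal (mixed_bmo_const CARD('m) q (conj_exponent p) * c powr conj_exponent p)"
      (is ?yx)
proof -
  note p' = conj_exponent_facts[OF p]
  have vm: "v \<in> borel_measurable lebesgue" and wm: "w \<in> borel_measurable lebesgue"
    unfolding v_def w_def using U V by (auto simp: matrix_weight_def intro: borel_measurable_mat_powr)
  have Q: "Q \<in> sets lebesgue" "compact Q" by (auto simp: Q_def)
  have Bm: "B \<in> borel_measurable lebesgue" using B by (rule locally_integrable_measurable)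
  define E where "E n = {x \<in> space lebesgue. x \<in> Q \<and> positive_definite (U x) \<and> positive_definite (V x) \<and>
      (\<forall>i\<in>UNIV. \<forall>j\<in>UNIV. cmod (v x $ i $ j) \<le> real n \<and> cmod (w x $ i $ j) \<le> real n \<and> cmod (B x $ i $ j) \<le> real n)}" for n
  have Em: "E n \<in> sets lebesgue" for n
  proof -
    have 1: "{x \<in> space lebesgue. cmod (f x $ i $ j) \<le> real n} \<in> sets lebesgue"
      if "f \<in> borel_measurable lebesgue" for f :: "real^'d \<Rightarrow> complex^'m^'m" and i j
      by (intro borel_measurable_le measurable_compose[OF _ borel_measurable_norm] borel_measurable_entry that) simp
    have 2: "{x \<in> space lebesgue. positive_definite (U x)} \<in> sets lebesgue" "{x \<in> space lebesgue. positive_definite (V x)} \<in> sets lebesgue"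
      using sets_positive_definite[of U] sets_positive_definite[of V] U V by (auto simp: matrix_weight_def)
    have 3: "{x \<in> space lebesgue. x \<in> Q} \<in> sets lebesgue" using Q by simp
    show ?thesis unfolding E_def
      by (intro sets.sets_Collect_conj sets.sets_Collect_finite_All 1 2 3 vm wm Bm) auto
  qed
  have EQ: "E n \<subseteq> Q" for n by (auto simp: E_def)
  have Einc: "incseq E"
  proof (rule incseq_SucI, rule subsetI)
    fix n x assume "x \<in> E n"
    moreover have "t \<le> real (Suc n)" if "t \<le> real n" for t using that by simp
    ultimately show "x \<in> E (Suc n)" unfolding E_def by blast
  qed
  have ae: "AE x in lebesgue_on Q. \<exists>n. x \<in> E n"
  proof -
    have "AE x in lebesgue. positive_definite (U x)" "AE x in lebesgue. positive_definite (V x)"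
      using U V by (auto simp: matrix_weight_def)
    then have "AE x in lebesgue. x \<in> Q \<longrightarrow> (\<exists>n. x \<in> E n)"
    proof eventually_elim
      case (elim x)
      obtain n :: nat where n: "(\<Sum>i\<in>UNIV. \<Sum>j\<in>UNIV. cmod (v x $ i $ j) + cmod (w x $ i $ j) + cmod (B x $ i $ j)) \<le> real n"
        using real_arch_simple by blast
      have "cmod (v x $ i $ j) \<le> real n \<and> cmod (w x $ i $ j) \<le> real n \<and> cmod (B x $ i $ j) \<le> real n" for i j
      proof -
        have "cmod (v x $ i $ j) + cmod (w x $ i $ j) + cmod (B x $ i $ j) \<le>
            (\<Sum>j\<in>UNIV. cmod (v x $ i $ j) + cmod (w x $ i $ j) + cmod (B x $ i $ j))"
          by (rule member_le_sum) auto
        also have "\<dots> \<le> (\<Sum>i\<in>UNIV. \<Sum>j\<in>UNIV. cmod (v x $ i $ j) + cmod (w x $ i $ j) + cmod (B x $ i $ j))"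
          by (rule member_le_sum[of i UNIV "\<lambda>i. \<Sum>j\<in>UNIV. cmod (v x $ i $ j) + cmod (w x $ i $ j) + cmod (B x $ i $ j)"])
             (auto intro!: sum_nonneg)
        finally show ?thesis using n norm_ge_zero[of "v x $ i $ j"] norm_ge_zero[of "w x $ i $ j"] norm_ge_zero[of "B x $ i $ j"]
          by linarith
      qed
      then show ?case using elim by (auto simp: E_def)
    qed
    then show ?thesis using Q by (subst AE_restrict_space_iff) auto
  qed
  have finQ: "finite_measure (lebesgue_on Q)"
  proof (rule finite_measureI)
    have "emeasure (lebesgue_on Q) (space (lebesgue_on Q)) = emeasure lebesgue Q"
      using Q by (simp add: emeasure_restrict_space space_restrict_space)
    then show "emeasure (lebesgue_on Q) (space (lebesgue_on Q)) \<noteq> \<infinity>"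
      using cube_measure[OF l, of a0] by (simp add: Q_def)
  qed
  have Sm: "case_prod (sandwich_sum v B w) \<in> borel_measurable (lebesgue_on Q \<Otimes>\<^sub>M lebesgue_on Q)"
    using vm wm Bm by (intro measurable_sandwich_sum measurable_restrict_space1)
  then have Sm': "case_prod (\<lambda>x y. sandwich_sum v B w y x) \<in> borel_measurable (lebesgue_on Q \<Otimes>\<^sub>M lebesgue_on Q)"
    using measurable_pair_swap[OF Sm] by (simp add: case_prod_beta')
  have SmE: "case_prod (\<lambda>x y. cmod ((v x ** (B x - B y) ** w y) $ a $ b)) \<in> borel_measurable (lebesgue_on (E n) \<Otimes>\<^sub>M lebesgue_on (E n))"
    for a b n
    using vm wm Bm by (intro measurable_sandwich_entry measurable_restrict_space1)
  have SmE': "case_prod (\<lambda>x y. cmod ((v y ** (B y - B x) ** w x) $ a $ b)) \<in> borel_measurable (lebesgue_on (E n) \<Otimes>\<^sub>M lebesgue_on (E n))"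
    for a b n
    using measurable_pair_swap[OF SmE[of a b n]] by (simp add: case_prod_beta')
  have loc: "truncated_commutator U V B v w \<alpha> p q A (real n) (E n)" for n
  proof
    show "bounded (E n)" using bounded_subset[OF compact_imp_bounded[OF Q(2)] EQ] .
    show "v x = mat_powr (V x) (1 / q)" "w x = mat_powr (U x) (- (1 / q))" "positive_definite (U x)" if "x \<in> E n" for x
      using that by (auto simp: E_def v_def w_def)
    show "cmod (v x $ i $ j) \<le> real n" "cmod (w x $ i $ j) \<le> real n" "cmod (B x $ i $ j) \<le> real n" if "x \<in> E n" for x i j
      using that by (auto simp: E_def)
  qed (use \<alpha> p q vm wm Bm Em A in auto)
  have sfE: "sigma_finite_measure (lebesgue_on (E n))" for n
    using truncated_commutator.finite_M[OF loc] by (simp add: finite_measure.axioms(1))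
  note mixed = truncated_commutator.mixed_norms[OF loc EQ[unfolded Q_def] l, folded c_def]
  show ?xy
  proof (rule iterated_integral_on_subsets[OF Q(1) finQ Sm Em EQ Einc ae])
    fix n
    have "(\<integral>\<^sup>+x. ennreal_powr (\<integral>\<^sup>+y. ennreal (sandwich_sum v B w x y powr conj_exponent p) \<partial>lebesgue_on (E n)) (q / conj_exponent p) \<partial>lebesgue_on (E n))
      \<le> ennreal (real (card (UNIV :: ('m \<times> 'm) set)) powr (conj_exponent p * (q / conj_exponent p) + q / conj_exponent p + 1) *
         (mixed_norm_const (2 * CARD('m)) (conj_exponent p) q * c powr q))"
      (is "?J n \<le> _")
      unfolding sandwich_sum_def case_prod_beta'
      by (rule nn_integral_powr_sum_le) (use p p' q sfE SmE mixed(1) mixed_norm_const_nonneg in \<open>auto simp: case_prod_beta'\<close>)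
    then show "?J n \<le> ennreal (mixed_bmo_const CARD('m) (conj_exponent p) q * c powr q)"
      using p' by (simp add: mixed_bmo_const_def mult.assoc)
  qed (use p p' q in auto)
  show ?yx
  proof (rule iterated_integral_on_subsets[OF Q(1) finQ Sm' Em EQ Einc ae])
    fix n
    have "(\<integral>\<^sup>+x. ennreal_powr (\<integral>\<^sup>+y. ennreal (sandwich_sum v B w y x powr q) \<partial>lebesgue_on (E n)) (conj_exponent p / q) \<partial>lebesgue_on (E n))
      \<le> ennreal (real (card (UNIV :: ('m \<times> 'm) set)) powr (q * (conj_exponent p / q) + conj_exponent p / q + 1) *
         (mixed_norm_const (2 * CARD('m)) q (conj_exponent p) * c powr conj_exponent p))"
      (is "?J n \<le> _")
      unfolding sandwich_sum_def case_prod_beta'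
      by (rule nn_integral_powr_sum_le) (use p p' q sfE SmE' mixed(2) mixed_norm_const_nonneg in \<open>auto simp: case_prod_beta'\<close>)
    then show "?J n \<le> ennreal (mixed_bmo_const CARD('m) q (conj_exponent p) * c powr conj_exponent p)"
      using q by (simp add: mixed_bmo_const_def mult.assoc)
  qed (use p p' q in auto)
qed

section \<open>Averages over cubes and cancellation of the side length\<close>

lemma mat_opnorm_nonneg: "0 \<le> mat_opnorm X"
proof -
  have "bounded_linear (\<lambda>u. X *v u)"
    by (intro linear_conv_bounded_linear[THEN iffD1] linearI)
       (simp_all add: matrix_vector_right_distrib matrix_vector_mult_scaleR)
  then show ?thesis unfolding mat_opnorm_def by (rule onorm_pos_le)
qed

text \<open>Multiplication by 1/c carries simple functions below c f to simple functions below f, so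
  the inequality holds for an arbitrary f. In this way scalars leave integrals whose integrands
  carry no measurability information.\<close>

lemma nn_integral_cmult_le:
  assumes "0 < c"
  shows "(\<integral>\<^sup>+x. ennreal c * f x \<partial>M) \<le> ennreal c * (\<integral>\<^sup>+x. f x \<partial>M)"
  unfolding nn_integral_def[of M "\<lambda>x. ennreal c * f x"]
proof (rule SUP_least)
  fix g assume "g \<in> {g. simple_function M g \<and> g \<le> (\<lambda>x. ennreal c * f x)}"
  then have g: "simple_function M g" "\<And>x. g x \<le> ennreal c * f x" by (auto simp: le_fun_def)
  have c: "ennreal c * (ennreal (1 / c) * a) = a" "ennreal (1 / c) * (ennreal c * a) = a" for a
    using assms by (simp_all add: mult.assoc[symmetric] ennreal_mult'[symmetric])
  have "simple_function M (\<lambda>x. ennreal (1 / c) * g x)" using g(1) by simp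
  moreover have "ennreal (1 / c) * g x \<le> f x" for x
    using mult_left_mono[OF g(2)[of x], of "ennreal (1 / c)"] c(2)[of "f x"] by simp
  ultimately have "integral\<^sup>S M (\<lambda>x. ennreal (1 / c) * g x) \<le> (\<integral>\<^sup>+x. f x \<partial>M)"
    by (subst nn_integral_eq_simple_integral[symmetric]) (auto intro: nn_integral_mono)
  then have "ennreal c * (ennreal (1 / c) * integral\<^sup>S M g) \<le> ennreal c * (\<integral>\<^sup>+x. f x \<partial>M)"
    using g(1) by (intro mult_left_mono) (simp_all add: simple_integral_mult)
  then show "integral\<^sup>S M g \<le> ennreal c * (\<integral>\<^sup>+x. f x \<partial>M)" by (simp only: c(1))
qed

text \<open>Scale invariance. With L the measure of the cube, the averages contribute L^(-t) and
  L^(-1), while the kernel bound contributes l^(\<rho> \<beta>) = L^(t+1). The comparison of H with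
  G is required only at almost every point in each variable, where the weights are positive
  definite.\<close>

lemma average_mixed_norm_le:
  fixes a :: "real^'d"
  assumes l: "0 < l" and t: "0 < t" and \<rho>: "0 \<le> \<rho>" "\<rho> * \<beta> = real CARD('d) * (t + 1)" and D: "0 \<le> D" and A: "0 \<le> A"
    and P: "AE x in lebesgue. P x"
    and H: "\<And>x y. P x \<Longrightarrow> P y \<Longrightarrow> H x y \<le> G x y"
    and G: "(\<integral>\<^sup>+x. ennreal_powr (\<integral>\<^sup>+y. G x y \<partial>lebesgue_on (cbox a (a + (\<chi> i. l)))) t \<partial>lebesgue_on (cbox a (a + (\<chi> i. l))))
      \<le> ennreal (D * (c * l powr \<beta> * A) powr \<rho>)"
  shows "average (cbox a (a + (\<chi> i. l))) (\<lambda>x. ennreal_powr (average (cbox a (a + (\<chi> i. l))) (H x)) t)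
    \<le> ennreal (D * (c * A) powr \<rho>)"
proof -
  define Q where "Q = cbox a (a + (\<chi> i. l))"
  define L where "L = l ^ CARD('d)"
  have L: "0 < L" using l by (simp add: L_def)
  have LQ: "emeasure lebesgue Q = ennreal L" unfolding Q_def L_def by (rule cube_measure[OF l])
  have av: "average Q F = ennreal (1 / L) * (\<integral>\<^sup>+x. F x \<partial>lebesgue_on Q)" for F
  proof -
    have "(\<integral>\<^sup>+x. F x \<partial>lebesgue_on Q) = (\<integral>\<^sup>+x\<in>Q. F x \<partial>lebesgue)"
      by (rule nn_integral_restrict_space) (simp add: Q_def)
    then show ?thesis using L
      by (simp add: average_def LQ divide_ennreal_def inverse_ennreal mult.commute inverse_eq_divide)
  qed
  have PQ: "AE x in lebesgue_on Q. P x"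
    using P by (subst AE_restrict_space_iff) (auto simp: Q_def)
  have "ennreal_powr (average Q (H x)) t \<le> ennreal ((1 / L) powr t) * ennreal_powr (\<integral>\<^sup>+y. G x y \<partial>lebesgue_on Q) t" if "P x" for x
  proof -
    have "(\<integral>\<^sup>+y. H x y \<partial>lebesgue_on Q) \<le> (\<integral>\<^sup>+y. G x y \<partial>lebesgue_on Q)"
      by (rule nn_integral_mono_AE, use PQ in eventually_elim) (rule H[OF that])
    then have "ennreal_powr (average Q (H x)) t \<le> ennreal_powr (ennreal (1 / L) * (\<integral>\<^sup>+y. G x y \<partial>lebesgue_on Q)) t"
      unfolding av using t by (intro ennreal_powr_mono mult_left_mono) auto
    then show ?thesis using L t by (simp add: ennreal_powr_mult)
  qed
  then have "(\<integral>\<^sup>+x. ennreal_powr (average Q (H x)) t \<partial>lebesgue_on Q) \<le>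
      (\<integral>\<^sup>+x. ennreal ((1 / L) powr t) * ennreal_powr (\<integral>\<^sup>+y. G x y \<partial>lebesgue_on Q) t \<partial>lebesgue_on Q)"
    by (intro nn_integral_mono_AE, use PQ in eventually_elim)
  also have "\<dots> \<le> ennreal ((1 / L) powr t) * (\<integral>\<^sup>+x. ennreal_powr (\<integral>\<^sup>+y. G x y \<partial>lebesgue_on Q) t \<partial>lebesgue_on Q)"
    by (rule nn_integral_cmult_le) (use L in simp)
  also have "\<dots> \<le> ennreal ((1 / L) powr t) * ennreal (D * (c * l powr \<beta> * A) powr \<rho>)"
    using G by (intro mult_left_mono) (auto simp: Q_def)
  finally have "average Q (\<lambda>x. ennreal_powr (average Q (H x)) t) \<le>
     ennreal (1 / L) * (ennreal ((1 / L) powr t) * ennreal (D * (c * l powr \<beta> * A) powr \<rho>))"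
    unfolding av[of "\<lambda>x. ennreal_powr (average Q (H x)) t"] by (rule mult_left_mono) simp
  also have "\<dots> = ennreal (1 / L * ((1 / L) powr t * (D * (c * l powr \<beta> * A) powr \<rho>)))"
    using L D by (simp add: ennreal_mult'[symmetric])
  also have "1 / L * ((1 / L) powr t * (D * (c * l powr \<beta> * A) powr \<rho>)) = D * (c * A) powr \<rho>"
  proof -
    have "1 / L * ((1 / L) powr t * (D * (c * l powr \<beta> * A) powr \<rho>)) =
        (1 / L * ((1 / L) powr t * l powr (\<rho> * \<beta>))) * (D * (c * A) powr \<rho>)"
      by (simp add: powr_mult powr_powr mult_ac)
    moreover have "l powr (\<rho> * \<beta>) = L powr (t + 1)"
      using l by (simp add: \<rho>(2) L_def powr_realpow[symmetric] powr_powr)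
    moreover have "1 / L * ((1 / L) powr t * L powr (t + 1)) = 1"
      using L by (simp add: powr_add powr_divide)
    ultimately show ?thesis by (simp only: mult_1)
  qed
  finally show ?thesis by (simp add: Q_def)
qed

lemma bmo_le_of_average_le:
  assumes \<rho>: "0 < \<rho>" and D: "0 \<le> D" and c: "0 \<le> c * A"
    and le: "\<And>Q. Q \<in> cubes \<Longrightarrow> F Q \<le> ennreal (D * (c * A) powr \<rho>)"
  shows "ennreal_powr (SUP Q\<in>cubes. F Q) (1 / \<rho>) \<le> ennreal (D powr (1 / \<rho>) * c * A)"
proof -
  have "(SUP Q\<in>cubes. F Q) \<le> ennreal (D * (c * A) powr \<rho>)" by (rule SUP_least) (rule le)
  then have "ennreal_powr (SUP Q\<in>cubes. F Q) (1 / \<rho>) \<le> ennreal_powr (ennreal (D * (c * A) powr \<rho>)) (1 / \<rho>)"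
    using \<rho> by (intro ennreal_powr_mono) auto
  also have "\<dots> = ennreal (D powr (1 / \<rho>) * c * A)"
    using \<rho> D c by (simp add: ennreal_powr_ennreal powr_mult[of D] powr_powr mult.assoc)
  finally show ?thesis .
qed

text \<open>For Hermitian X and Y the left matrix is minus the conjugate transpose of the right one,
  so the entries have equal moduli up to transposition. The adjoint BMO quantity is thus governed by
  the same kernel with its variables exchanged.\<close>

lemma cmod_entry_transposed_sandwich:
  assumes "conj_transpose X = X" "conj_transpose Y = Y"
  shows "(\<Sum>(a, b)\<in>UNIV. cmod ((X ** (conj_transpose B1 - conj_transpose B2) ** Y) $ a $ b)) =
    (\<Sum>(a, b)\<in>UNIV. cmod ((Y ** (B2 - B1) ** X) $ a $ b))"
proof -
  have "conj_transpose B1 - conj_transpose B2 = - conj_transpose (B2 - B1)"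
    by (simp add: conj_transpose_def vec_eq_iff)
  then have "X ** (conj_transpose B1 - conj_transpose B2) ** Y = - (X ** conj_transpose (B2 - B1) ** Y)"
    by (simp add: vec_eq_iff matrix_matrix_mult_def sum_negf)
  also have "X ** conj_transpose (B2 - B1) ** Y = conj_transpose (Y ** (B2 - B1) ** X)"
    using assms by (simp add: conj_transpose_mult matrix_mul_assoc)
  finally have "cmod ((X ** (conj_transpose B1 - conj_transpose B2) ** Y) $ a $ b) = cmod ((Y ** (B2 - B1) ** X) $ b $ a)" for a b
    by (simp add: conj_transpose_def)
  then have "(\<Sum>(a, b)\<in>UNIV. cmod ((X ** (conj_transpose B1 - conj_transpose B2) ** Y) $ a $ b)) =
      (\<Sum>a\<in>UNIV. \<Sum>b\<in>UNIV. cmod ((Y ** (B2 - B1) ** X) $ b $ a))"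
    by (simp add: sum.cartesian_product UNIV_Times_UNIV)
  also have "\<dots> = (\<Sum>b\<in>UNIV. \<Sum>a\<in>UNIV. cmod ((Y ** (B2 - B1) ** X) $ b $ a))" by (rule sum.swap)
  finally show ?thesis by (simp add: sum.cartesian_product UNIV_Times_UNIV)
qed

lemma bmo_tilde_le:
  fixes U V B :: "real^'d \<Rightarrow> complex^'m^'m"
  assumes \<alpha>: "0 < \<alpha>" "\<alpha> < real CARD('d)" and p: "1 < p" and q: "1 < q"
    and pq: "\<alpha> / real CARD('d) + 1 / q = 1 / p"
    and U: "matrix_weight U" and V: "matrix_weight V" and B: "locally_integrable B"
    and A: "0 < A" "commutator_norm B \<alpha> p (\<lambda>x. mat_powr (U x) (p / q)) q V \<le> ennreal A"
  defines "c \<equiv> kernel_const CARD('d) (real CARD('d) - \<alpha>)"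
  shows "bmo_tilde p q V U B \<le> ennreal (mixed_bmo_const CARD('m) (conj_exponent p) q powr (1 / q) * c * A)" (is ?B)
    and "bmo_tilde (conj_exponent q) (conj_exponent p)
              (\<lambda>x. mat_powr (U x) (- (conj_exponent p / q)))
              (\<lambda>x. mat_powr (V x) (- (conj_exponent p / q)))
              (\<lambda>x. conj_transpose (B x))
      \<le> ennreal (mixed_bmo_const CARD('m) q (conj_exponent p) powr (1 / conj_exponent p) * c * A)" (is ?B_adjoint)
proof -
  note p' = conj_exponent_facts[OF p] and q' = conj_exponent_facts[OF q]
  define v where "v = (\<lambda>x. if positive_definite (V x) then mat_powr (V x) (1 / q) else 0)"
  define w where "w = (\<lambda>x. if positive_definite (U x) then mat_powr (U x) (- (1 / q)) else 0)"
  define P where "P x \<longleftrightarrow> positive_definite (U x) \<and> positive_definite (V x)" for x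
  have P: "AE x in lebesgue. P x" using U V by (simp add: matrix_weight_def P_def)
  have c: "0 \<le> c * A" using A(1) kernel_const_pos[of "CARD('d)"] by (simp add: c_def less_imp_le)
  have D: "0 \<le> mixed_bmo_const m r t" for m r t
    by (simp add: mixed_bmo_const_def mixed_norm_const_nonneg)
  have d: "0 < real CARD('d)" by simp
  \<comment> \<open>Here the relation between the exponents enters; it is the homogeneity condition
    behind the cancellation of the side length for both quantities.\<close>
  have \<beta>: "real CARD('d) - \<alpha> = real CARD('d) * (1 / q + 1 / conj_exponent p)"
  proof -
    have "real CARD('d) - \<alpha> = real CARD('d) * (1 - \<alpha> / real CARD('d))" using d by (simp add: field_simps)
    also have "1 - \<alpha> / real CARD('d) = 1 / q + 1 / conj_exponent p" using pq p'(2) by linarith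
    finally show ?thesis .
  qed
  note on_cube = sandwich_sum_mixed_norms_on_cube[OF \<alpha> p q U V B A, folded v_def w_def c_def]
  show ?B
    unfolding bmo_tilde_def
  proof (rule bmo_le_of_average_le[OF _ D c])
    fix Q :: "(real^'d) set" assume "Q \<in> cubes"
    then obtain a l where Q: "Q = cbox a (a + (\<chi> i. l))" and l: "0 < l" by (auto simp: cubes_def)
    show "average Q (\<lambda>x. ennreal_powr (average Q (\<lambda>y. ennreal (mat_opnorm
              (mat_powr (V x) (1 / q) ** (B x - B y) ** mat_powr (U y) (- (1 / q))) powr conj_exponent p))) (q / conj_exponent p))
        \<le> ennreal (mixed_bmo_const CARD('m) (conj_exponent p) q * (c * A) powr q)"
      unfolding Q
    proof (rule average_mixed_norm_le[OF l _ _ _ D _ P _ on_cube(1)[OF l]])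
      show "q * (real CARD('d) - \<alpha>) = real CARD('d) * (q / conj_exponent p + 1)"
        unfolding \<beta> using q p' by (simp add: field_simps)
      show "ennreal (mat_opnorm (mat_powr (V x) (1 / q) ** (B x - B y) ** mat_powr (U y) (- (1 / q))) powr conj_exponent p)
          \<le> ennreal (sandwich_sum v B w x y powr conj_exponent p)" if "P x" "P y" for x y
        using that p' mat_opnorm_le[of "mat_powr (V x) (1 / q) ** (B x - B y) ** mat_powr (U y) (- (1 / q))"]
        by (auto simp: P_def sandwich_sum_def v_def w_def mat_opnorm_nonneg intro!: ennreal_leI powr_mono2)
    qed (use q p' A in auto)
  qed (use q in simp)
  show ?B_adjoint
    unfolding bmo_tilde_def q'(4)
  proof (rule bmo_le_of_average_le[OF _ D c])
    fix Q :: "(real^'d) set" assume "Q \<in> cubes"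
    then obtain a l where Q: "Q = cbox a (a + (\<chi> i. l))" and l: "0 < l" by (auto simp: cubes_def)
    show "average Q (\<lambda>x. ennreal_powr (average Q (\<lambda>y. ennreal (mat_opnorm
              (mat_powr (mat_powr (U x) (- (conj_exponent p / q))) (1 / conj_exponent p) **
               (conj_transpose (B x) - conj_transpose (B y)) **
               mat_powr (mat_powr (V y) (- (conj_exponent p / q))) (- (1 / conj_exponent p))) powr q))) (conj_exponent p / q))
        \<le> ennreal (mixed_bmo_const CARD('m) q (conj_exponent p) * (c * A) powr conj_exponent p)"
      unfolding Q
    proof (rule average_mixed_norm_le[OF l _ _ _ D _ P _ on_cube(2)[OF l]])
      show "conj_exponent p * (real CARD('d) - \<alpha>) = real CARD('d) * (conj_exponent p / q + 1)"
        unfolding \<beta> using q p' by (simp add: field_simps)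
      show "ennreal (mat_opnorm (mat_powr (mat_powr (U x) (- (conj_exponent p / q))) (1 / conj_exponent p) **
               (conj_transpose (B x) - conj_transpose (B y)) **
               mat_powr (mat_powr (V y) (- (conj_exponent p / q))) (- (1 / conj_exponent p))) powr q)
          \<le> ennreal (sandwich_sum v B w y x powr q)" if xy: "P x" "P y" for x y
      proof -
        \<comment> \<open>The weights U' and V' are made for this: (U^(-p'/q))^(1/p') = U^(-1/q) and
          (V^(-p'/q))^(-1/p') = V^(1/q).\<close>
        have 1: "mat_powr (mat_powr (U x) (- (conj_exponent p / q))) (1 / conj_exponent p) = w x"
          "mat_powr (mat_powr (V y) (- (conj_exponent p / q))) (- (1 / conj_exponent p)) = v y"
          using xy p' by (auto simp: P_def w_def v_def mat_powr_powr)
        have 2: "conj_transpose (w x) = w x" "conj_transpose (v y) = v y"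
          using xy by (auto simp: P_def w_def v_def conj_transpose_mat_powr)
        have "mat_opnorm (w x ** (conj_transpose (B x) - conj_transpose (B y)) ** v y) \<le> sandwich_sum v B w y x"
          unfolding sandwich_sum_def cmod_entry_transposed_sandwich[OF 2, symmetric] by (rule mat_opnorm_le)
        then show ?thesis unfolding 1 using q by (intro ennreal_leI powr_mono2) (auto simp: mat_opnorm_nonneg)
      qed
    qed (use q p' A in auto)
  qed (use p' in simp)
qed

theorem theorem1p4:
  fixes \<alpha> p q :: real
  assumes "0 < \<alpha>" and "\<alpha> < real CARD('d::finite)"
    and "1 < p" and "1 < q"
    and "\<alpha> / real CARD('d) + 1 / q = 1 / p"
  shows "\<exists>C::real. 0 < C \<and>
    (\<forall>(U :: real^'d \<Rightarrow> complex^'m::finite^'m) (V :: real^'d \<Rightarrow> complex^'m^'m)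
       (B :: real^'d \<Rightarrow> complex^'m^'m).
       matrix_weight U \<longrightarrow> matrix_weight V \<longrightarrow> locally_integrable B \<longrightarrow>
       max (bmo_tilde p q V U B)
           (bmo_tilde (conj_exponent q) (conj_exponent p)
              (\<lambda>x. mat_powr (U x) (- (conj_exponent p / q)))
              (\<lambda>x. mat_powr (V x) (- (conj_exponent p / q)))
              (\<lambda>x. conj_transpose (B x)))
       \<le> ennreal C * commutator_norm B \<alpha> p (\<lambda>x. mat_powr (U x) (p / q)) q V)"
proof -
  define c where "c = kernel_const CARD('d) (real CARD('d) - \<alpha>)"
  define C1 where "C1 = mixed_bmo_const CARD('m) (conj_exponent p) q powr (1 / q) * c"
  define C2 where "C2 = mixed_bmo_const CARD('m) q (conj_exponent p) powr (1 / conj_exponent p) * c"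
  \<comment> \<open>The 1 makes C strictly positive; an infinite commutator norm then gives an
    infinite right side, whereas 0 times \<infinity> would be 0.\<close>
  define C where "C = max C1 C2 + 1"
  have "0 < c" unfolding c_def by (rule kernel_const_pos) simp
  then have C0: "0 < C" by (auto simp: C_def C1_def C2_def intro!: add_nonneg_pos simp: le_max_iff_disj)
  show ?thesis
  proof (intro exI[of _ C] conjI allI impI C0)
    fix U V B :: "real^'d \<Rightarrow> complex^'m^'m"
    assume UVB: "matrix_weight U" "matrix_weight V" "locally_integrable B"
    define N where "N = commutator_norm B \<alpha> p (\<lambda>x. mat_powr (U x) (p / q)) q V"
    let ?L = "max (bmo_tilde p q V U B)
           (bmo_tilde (conj_exponent q) (conj_exponent p)
              (\<lambda>x. mat_powr (U x) (- (conj_exponent p / q)))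
              (\<lambda>x. mat_powr (V x) (- (conj_exponent p / q)))
              (\<lambda>x. conj_transpose (B x)))"
    have le: "?L \<le> ennreal (C * A)" if A: "0 < A" "N \<le> ennreal A" for A
    proof -
      have "C1 * A \<le> C * A" "C2 * A \<le> C * A" using A(1) by (auto simp: C_def)
      then show ?thesis
        using bmo_tilde_le[OF assms UVB A[unfolded N_def], folded c_def, folded C1_def C2_def]
        by (auto intro: order_trans ennreal_leI)
    qed
    show "?L \<le> ennreal C * commutator_norm B \<alpha> p (\<lambda>x. mat_powr (U x) (p / q)) q V"
      unfolding N_def[symmetric]
    proof (cases N)
      case top
      then show "?L \<le> ennreal C * N" using C0 by (simp add: ennreal_mult_top)
    next
      case (real r)
      show "?L \<le> ennreal C * N"
      proof (rule ennreal_le_epsilon)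
        fix e :: real assume e: "0 < e"
        \<comment> \<open>The estimates require a positive majorant of N, and N may be 0. The excess
          e/C provides one and costs exactly e after multiplication by C.\<close>
        have "?L \<le> ennreal (C * (r + e / C))"
          using real e C0 by (intro le) (auto intro!: add_nonneg_pos ennreal_leI)
        also have "\<dots> = ennreal C * N + ennreal e"
          using real e C0 by (simp add: distrib_left ennreal_mult'[symmetric])
        finally show "?L \<le> ennreal C * N + ennreal e" .
      qed
    qed
  qed
qed

end
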